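(* An $n$-sesquicategory is an $n$-globular set $\mathcal{C}$ equipped with \begin{itemize} \item binary operations $\circ^{\mathcal{C}}_{i,j}\colon \mathcal{C}_{i}\times_{\mathcal{C}_{m-1}}\mathcal{C}_j\to\mathcal{C}_M$ for $1\leq i,j\leq n$, where $m=\min\{i,j\}$, $M=\max\{i,j\}$ and the pullback is taken with respect to the maps $s^{i-m+1}$ and $t^{j-m+1}$; \item unary operations $u_i^{\mathcal{C}}\colon \mathcal{C}_{i-1}\to\mathcal{C}_i$ for $1\leq i\leq n$; \end{itemize} subject to equations \begin{itemize} \item $s(x\circ y)=s(x)\circ y$ and $t(x\circ y)=t(x)\circ y$, if $|x|>|y|$; \item $s(x\circ y)=x\circ s(y)$ and $t(x\circ y)=x\circ t(y)$, if $|x|<|y|$; \item $s(x\circ y)=s(y)$ and $t(x\circ y)=t(x)$, if $|x|=|y|$; \item $s(u(x))=t(u(x))=x$; \item $(x\circ y)\circ z=x\circ (y\circ z)$ when the two smallest elements in $\{|x|,|y|,|z|\}$ are equal; \item $x\circ (y\circ z)=(x\circ y)\circ(x\circ z)$ when $|x|<|y|,|z|$; \item $(x\circ y)\circ z=(x\circ z)\circ(y\circ z)$ when $|z|<|x|,|y|$; \item $u(x)\circ y = y$ when $|x|<|y|$; \item $u(x)\circ y = u(x\circ y)$ when $|x|\geq |y|$; \item $x\circ u(y) = x$ when $|x|>|y|$; \item $x\circ u(y)=u(x\circ y)$ when $|x|\leq |y|$. \end{itemize}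
   Context: An $n$-globular set $X$ consists of sets $X_k$ ($0\le k\le n$) of $k$-cells with source and target maps $s,t\colon X_k\to X_{k-1}$ satisfying $ss=st$, $ts=tt$. A simple $k$-string diagram $D$ is a sequence of (not necessarily order preserving) maps of finite totally ordered sets $\langle\ell_k\rangle\to\cdots\to\langle\ell_1\rangle\to\langle 1\rangle$ (where $\langle \ell\rangle=\{1<\dots<\ell\}$); these form an $n$-globular set $D^s_n$ with source and target given by truncation. To each such $D$ one associates a $k$-globular set $\widehat{D}$ built by attaching one $m$-cell per element of $\langle\ell_m\rangle$ (its source glued to the parent cell if it is the first element of its fibre, otherwise to the target of the previous element in the same fibre). The monad $T_n^{D^s}$ on $n$-globular sets is $T_n^{D^s}(X)_m=\coprod_{D\in D^s_n(m)}\mathrm{Hom}_{\text{globular sets}}(\widehat{D},X)$, with multiplication given by substituting labelled diagrams into diagrams. An $n$-sesquicategory is an algebra over $T_n^{D^s}$. Here $\mathcal{C}_i$ denotes the set of $i$-morphisms (i-cells) of $\mathcal{C}$, and $|x|=i$ means $x$ is an $i$-morphism. *)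

theory Defs
  imports Main
begin

definition globular :: "nat \<Rightarrow> (nat \<Rightarrow> 'a set) \<Rightarrow> (nat \<Rightarrow> 'a \<Rightarrow> 'a) \<Rightarrow> (nat \<Rightarrow> 'a \<Rightarrow> 'a) \<Rightarrow> bool" where
  "globular n X s t \<longleftrightarrow>
     (\<forall>k\<in>{1..n}. \<forall>x\<in>X k. s k x \<in> X (k - 1) \<and> t k x \<in> X (k - 1)) \<and>
     (\<forall>k\<in>{2..n}. \<forall>x\<in>X k. s (k - 1) (s k x) = s (k - 1) (t k x) \<and>
                            t (k - 1) (s k x) = t (k - 1) (t k x))"

fun spow :: "(nat \<Rightarrow> 'a \<Rightarrow> 'a) \<Rightarrow> nat \<Rightarrow> nat \<Rightarrow> 'a \<Rightarrow> 'a" where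
  "spow s m 0 x = x"
| "spow s m (Suc k) x = s (m - k) (spow s m k x)"

text \<open>A simple m-string diagram  <l_m> \<rightarrow> ... \<rightarrow> <l_1> \<rightarrow> <1>  is encoded as a list D of length m;
  D ! (j-1) is the map <l_j> \<rightarrow> <l_(j-1)> written as the list of its values.
  Totally ordered sets <l> are encoded 0-based as {0..<l}.\<close>

definition ell :: "nat list list \<Rightarrow> nat \<Rightarrow> nat" where
  "ell D j = (if j = 0 then 1 else length (D ! (j - 1)))"

definition par :: "nat list list \<Rightarrow> nat \<Rightarrow> nat \<Rightarrow> nat" where
  "par D j a = D ! (j - 1) ! a"

definition wf_diag :: "nat list list \<Rightarrow> bool" where
  "wf_diag D \<longleftrightarrow> (\<forall>j\<in>{1..length D}. \<forall>a<ell D j. par D j a < ell D (j - 1))"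

text \<open>Cells of the globular set \<open>D^\<close>: at level j there is one cell Orig j a per a \<in> <l_j>,
  and (for j below the top) one cell Tgt j b per b \<in> <l_(j+1)> (the target of Orig (j+1) b).\<close>

datatype hcell = Orig nat nat | Tgt nat nat

definition hcells :: "nat list list \<Rightarrow> nat \<Rightarrow> hcell set" where
  "hcells D j = {Orig j a | a. a < ell D j} \<union> {Tgt j b | b. j < length D \<and> b < ell D (Suc j)}"

definition allcells :: "nat list list \<Rightarrow> hcell set" where
  "allcells D = (\<Union>j\<in>{0..length D}. hcells D j)"

definition osrc :: "nat list list \<Rightarrow> nat \<Rightarrow> nat \<Rightarrow> hcell" where
  "osrc D j a = (if \<exists>a'<a. par D j a' = par D j a
                 then Tgt (j - 1) (Max {a'. a' < a \<and> par D j a' = par D j a})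
                 else Orig (j - 1) (par D j a))"

definition hsrc :: "nat list list \<Rightarrow> hcell \<Rightarrow> hcell" where
  "hsrc D c = (case c of Orig j a \<Rightarrow> osrc D j a | Tgt j b \<Rightarrow> osrc D j (par D (Suc j) b))"

definition htgt :: "nat list list \<Rightarrow> hcell \<Rightarrow> hcell" where
  "htgt D c = (case c of Orig j a \<Rightarrow> Tgt (j - 1) a | Tgt j b \<Rightarrow> Tgt (j - 1) (par D (Suc j) b))"

text \<open>Globular maps \<open>D^ \<rightarrow> X\<close> (made canonical: undefined outside the cells of \<open>D^\<close>).\<close>

definition ghom :: "nat list list \<Rightarrow> (nat \<Rightarrow> 'a set) \<Rightarrow> (nat \<Rightarrow> 'a \<Rightarrow> 'a) \<Rightarrow> (nat \<Rightarrow> 'a \<Rightarrow> 'a)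
                    \<Rightarrow> (hcell \<Rightarrow> 'a) \<Rightarrow> bool" where
  "ghom D X s t \<phi> \<longleftrightarrow>
     (\<forall>j\<le>length D. \<forall>c\<in>hcells D j. \<phi> c \<in> X j) \<and>
     (\<forall>j\<in>{1..length D}. \<forall>c\<in>hcells D j. s j (\<phi> c) = \<phi> (hsrc D c) \<and> t j (\<phi> c) = \<phi> (htgt D c)) \<and>
     (\<forall>c. c \<notin> allcells D \<longrightarrow> \<phi> c = undefined)"

type_synonym 'a lab = "nat list list \<times> (hcell \<Rightarrow> 'a)"

definition TX :: "(nat \<Rightarrow> 'a set) \<Rightarrow> (nat \<Rightarrow> 'a \<Rightarrow> 'a) \<Rightarrow> (nat \<Rightarrow> 'a \<Rightarrow> 'a) \<Rightarrow> nat \<Rightarrow> 'a lab set" where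
  "TX X s t m = {(D, \<phi>). wf_diag D \<and> length D = m \<and> ghom D X s t \<phi>}"

definition Ts :: "'a lab \<Rightarrow> 'a lab" where
  "Ts w = (butlast (fst w), \<lambda>c. if c \<in> allcells (butlast (fst w)) then snd w c else undefined)"

text \<open>Target inclusion of \<open>(trunc D)^\<close> into \<open>D^\<close>.\<close>
definition tincl :: "nat list list \<Rightarrow> hcell \<Rightarrow> hcell" where
  "tincl D c = (case c of
      Orig j p \<Rightarrow> (if Suc j = length D \<and> (\<exists>b<ell D (Suc j). par D (Suc j) b = p)
                   then Tgt j (Max {b. b < ell D (Suc j) \<and> par D (Suc j) b = p})
                   else Orig j p)
    | Tgt j b \<Rightarrow> Tgt j b)"

definition Tt :: "'a lab \<Rightarrow> 'a lab" where
  "Tt w = (butlast (fst w), \<lambda>c. if c \<in> allcells (butlast (fst w)) then snd w (tincl (fst w) c) else undefined)"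

definition eta :: "(nat \<Rightarrow> 'a \<Rightarrow> 'a) \<Rightarrow> (nat \<Rightarrow> 'a \<Rightarrow> 'a) \<Rightarrow> nat \<Rightarrow> 'a \<Rightarrow> 'a lab" where
  "eta s t m x = (replicate m [0], \<lambda>c. case c of
      Orig j a \<Rightarrow> (if j \<le> m \<and> a = 0 then spow s m (m - j) x else undefined)
    | Tgt j b \<Rightarrow> (if j < m \<and> b = 0 then t (Suc j) (spow s m (m - Suc j) x) else undefined))"

text \<open>Multiplication: substitution of labelled diagrams into a diagram.  The new level-j set
  is the lexicographically ordered disjoint union over a \<in> <l_j> of the level-j sets of the
  diagrams labelling the cells Orig j a.\<close>
definition off :: "(hcell \<Rightarrow> 'a lab) \<Rightarrow> nat \<Rightarrow> nat \<Rightarrow> nat" where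
  "off \<Phi> j p = (\<Sum>q<p. ell (fst (\<Phi> (Orig j q))) j)"

definition mu_diag :: "nat list list \<Rightarrow> (hcell \<Rightarrow> 'a lab) \<Rightarrow> nat list list" where
  "mu_diag D \<Phi> = map (\<lambda>j. concat (map (\<lambda>a.
        map (\<lambda>i. off \<Phi> (j - 1) (par D j a) + par (fst (\<Phi> (Orig j a))) j i)
            [0..<ell (fst (\<Phi> (Orig j a))) j]) [0..<ell D j])) [1..<Suc (length D)]"

definition mu_lab :: "nat list list \<Rightarrow> (hcell \<Rightarrow> 'a lab) \<Rightarrow> hcell \<Rightarrow> 'a" where
  "mu_lab D \<Phi> c = (case c of
      Orig j n \<Rightarrow> (case (THE (a, i). a < ell D j \<and> i < ell (fst (\<Phi> (Orig j a))) j \<and> n = off \<Phi> j a + i)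
                   of (a, i) \<Rightarrow> snd (\<Phi> (Orig j a)) (Orig j i))
    | Tgt j n \<Rightarrow> (case (THE (b, i). b < ell D (Suc j) \<and> i < ell (fst (\<Phi> (Orig (Suc j) b))) (Suc j)
                                  \<and> n = off \<Phi> (Suc j) b + i)
                   of (b, i) \<Rightarrow> snd (\<Phi> (Orig (Suc j) b)) (Tgt j i)))"

definition mu :: "'a lab lab \<Rightarrow> 'a lab" where
  "mu W = (mu_diag (fst W) (snd W),
           \<lambda>c. if c \<in> allcells (mu_diag (fst W) (snd W)) then mu_lab (fst W) (snd W) c else undefined)"

definition Tmap :: "('a \<Rightarrow> 'b) \<Rightarrow> 'a lab \<Rightarrow> 'b lab" where
  "Tmap f W = (fst W, \<lambda>c. if c \<in> allcells (fst W) then f (snd W c) else undefined)"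

definition T_algebra :: "nat \<Rightarrow> (nat \<Rightarrow> 'a set) \<Rightarrow> (nat \<Rightarrow> 'a \<Rightarrow> 'a) \<Rightarrow> (nat \<Rightarrow> 'a \<Rightarrow> 'a)
                         \<Rightarrow> ('a lab \<Rightarrow> 'a) \<Rightarrow> bool" where
  "T_algebra n X s t a \<longleftrightarrow>
     (\<forall>m\<le>n. \<forall>w\<in>TX X s t m. a w \<in> X m) \<and>
     (\<forall>m\<in>{1..n}. \<forall>w\<in>TX X s t m. s m (a w) = a (Ts w) \<and> t m (a w) = a (Tt w)) \<and>
     (\<forall>m\<le>n. \<forall>x\<in>X m. a (eta s t m x) = x) \<and>
     (\<forall>m\<le>n. \<forall>W\<in>TX (TX X s t) (\<lambda>_. Ts) (\<lambda>_. Tt) m. a (mu W) = a (Tmap a W))"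

definition cdiag :: "nat \<Rightarrow> nat \<Rightarrow> nat list list" where
  "cdiag i j = (if i = j then replicate (i - 1) [0] @ [[0, 0]]
                else if j < i then replicate (j - 1) [0] @ [[0, 0], [1]] @ replicate (i - j - 1) [0]
                else replicate (i - 1) [0] @ [[0, 0], [0]] @ replicate (j - i - 1) [0])"

definition xcell :: "nat \<Rightarrow> nat \<Rightarrow> hcell" where
  "xcell i j = (if i \<le> j then Orig i 1 else Orig i 0)"

definition ycell :: "nat \<Rightarrow> nat \<Rightarrow> hcell" where
  "ycell i j = Orig j 0"

definition comp_of :: "(nat \<Rightarrow> 'a set) \<Rightarrow> (nat \<Rightarrow> 'a \<Rightarrow> 'a) \<Rightarrow> (nat \<Rightarrow> 'a \<Rightarrow> 'a) \<Rightarrow> ('a lab \<Rightarrow> 'a)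
                       \<Rightarrow> nat \<Rightarrow> nat \<Rightarrow> 'a \<Rightarrow> 'a \<Rightarrow> 'a" where
  "comp_of X s t a i j x y = a (cdiag i j,
      THE \<phi>. ghom (cdiag i j) X s t \<phi> \<and> \<phi> (xcell i j) = x \<and> \<phi> (ycell i j) = y)"

definition udiag :: "nat \<Rightarrow> nat list list" where
  "udiag i = replicate (i - 1) [0] @ [[]]"

definition unit_of :: "(nat \<Rightarrow> 'a set) \<Rightarrow> (nat \<Rightarrow> 'a \<Rightarrow> 'a) \<Rightarrow> (nat \<Rightarrow> 'a \<Rightarrow> 'a) \<Rightarrow> ('a lab \<Rightarrow> 'a)
                       \<Rightarrow> nat \<Rightarrow> 'a \<Rightarrow> 'a" where
  "unit_of X s t a i x = a (udiag i, THE \<phi>. ghom (udiag i) X s t \<phi> \<and> \<phi> (Orig (i - 1) 0) = x)"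

definition cp :: "nat \<Rightarrow> (nat \<Rightarrow> 'a set) \<Rightarrow> (nat \<Rightarrow> 'a \<Rightarrow> 'a) \<Rightarrow> (nat \<Rightarrow> 'a \<Rightarrow> 'a)
                  \<Rightarrow> nat \<Rightarrow> nat \<Rightarrow> 'a \<Rightarrow> 'a \<Rightarrow> bool" where
  "cp n X s t i j x y \<longleftrightarrow> i \<in> {1..n} \<and> j \<in> {1..n} \<and> x \<in> X i \<and> y \<in> X j \<and>
     spow s i (i - min i j + 1) x = spow t j (j - min i j + 1) y"

definition two_smallest_eq :: "nat \<Rightarrow> nat \<Rightarrow> nat \<Rightarrow> bool" where
  "two_smallest_eq i j k \<longleftrightarrow> (i = j \<and> i \<le> k) \<or> (i = k \<and> i \<le> j) \<or> (j = k \<and> j \<le> i)"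

definition sesqui :: "nat \<Rightarrow> (nat \<Rightarrow> 'a set) \<Rightarrow> (nat \<Rightarrow> 'a \<Rightarrow> 'a) \<Rightarrow> (nat \<Rightarrow> 'a \<Rightarrow> 'a)
                      \<Rightarrow> (nat \<Rightarrow> nat \<Rightarrow> 'a \<Rightarrow> 'a \<Rightarrow> 'a) \<Rightarrow> (nat \<Rightarrow> 'a \<Rightarrow> 'a) \<Rightarrow> bool" where
  "sesqui n X s t c u \<longleftrightarrow>
    \<comment> \<open>typing of the operations\<close>
    (\<forall>i j x y. cp n X s t i j x y \<longrightarrow> c i j x y \<in> X (max i j)) \<and>
    (\<forall>i x. i \<in> {1..n} \<and> x \<in> X (i - 1) \<longrightarrow> u i x \<in> X i) \<and>
    \<comment> \<open>s(x\<circ>y) = s(x)\<circ>y, t(x\<circ>y) = t(x)\<circ>y if |x| > |y|\<close>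
    (\<forall>i j x y. cp n X s t i j x y \<and> j < i \<longrightarrow>
        s i (c i j x y) = c (i - 1) j (s i x) y \<and> t i (c i j x y) = c (i - 1) j (t i x) y) \<and>
    \<comment> \<open>s(x\<circ>y) = x\<circ>s(y), t(x\<circ>y) = x\<circ>t(y) if |x| < |y|\<close>
    (\<forall>i j x y. cp n X s t i j x y \<and> i < j \<longrightarrow>
        s j (c i j x y) = c i (j - 1) x (s j y) \<and> t j (c i j x y) = c i (j - 1) x (t j y)) \<and>
    \<comment> \<open>s(x\<circ>y) = s(y), t(x\<circ>y) = t(x) if |x| = |y|\<close>
    (\<forall>i x y. cp n X s t i i x y \<longrightarrow> s i (c i i x y) = s i y \<and> t i (c i i x y) = t i x) \<and>
    \<comment> \<open>s(u(x)) = t(u(x)) = x\<close>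
    (\<forall>i x. i \<in> {1..n} \<and> x \<in> X (i - 1) \<longrightarrow> s i (u i x) = x \<and> t i (u i x) = x) \<and>
    \<comment> \<open>associativity when the two smallest dimensions are equal\<close>
    (\<forall>i j k x y z. cp n X s t i j x y \<and> cp n X s t (max i j) k (c i j x y) z \<and>
        cp n X s t j k y z \<and> cp n X s t i (max j k) x (c j k y z) \<and> two_smallest_eq i j k \<longrightarrow>
        c (max i j) k (c i j x y) z = c i (max j k) x (c j k y z)) \<and>
    \<comment> \<open>x\<circ>(y\<circ>z) = (x\<circ>y)\<circ>(x\<circ>z) when |x| < |y|, |z|\<close>
    (\<forall>i j k x y z. i < j \<and> i < k \<and> cp n X s t j k y z \<and> cp n X s t i (max j k) x (c j k y z) \<and>
        cp n X s t i j x y \<and> cp n X s t i k x z \<and>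
        cp n X s t (max i j) (max i k) (c i j x y) (c i k x z) \<longrightarrow>
        c i (max j k) x (c j k y z) = c (max i j) (max i k) (c i j x y) (c i k x z)) \<and>
    \<comment> \<open>(x\<circ>y)\<circ>z = (x\<circ>z)\<circ>(y\<circ>z) when |z| < |x|, |y|\<close>
    (\<forall>i j k x y z. k < i \<and> k < j \<and> cp n X s t i j x y \<and> cp n X s t (max i j) k (c i j x y) z \<and>
        cp n X s t i k x z \<and> cp n X s t j k y z \<and>
        cp n X s t (max i k) (max j k) (c i k x z) (c j k y z) \<longrightarrow>
        c (max i j) k (c i j x y) z = c (max i k) (max j k) (c i k x z) (c j k y z)) \<and>
    \<comment> \<open>u(x)\<circ>y = y when |x| < |y|\<close>
    (\<forall>i j x y. x \<in> X (i - 1) \<and> cp n X s t i j (u i x) y \<and> i - 1 < j \<longrightarrow> c i j (u i x) y = y) \<and>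
    \<comment> \<open>u(x)\<circ>y = u(x\<circ>y) when |x| \<ge> |y|\<close>
    (\<forall>i j x y. x \<in> X (i - 1) \<and> cp n X s t i j (u i x) y \<and> j \<le> i - 1 \<longrightarrow>
        c i j (u i x) y = u i (c (i - 1) j x y)) \<and>
    \<comment> \<open>x\<circ>u(y) = x when |x| > |y|\<close>
    (\<forall>i j x y. y \<in> X (j - 1) \<and> cp n X s t i j x (u j y) \<and> j - 1 < i \<longrightarrow> c i j x (u j y) = x) \<and>
    \<comment> \<open>x\<circ>u(y) = u(x\<circ>y) when |x| \<le> |y|\<close>
    (\<forall>i j x y. y \<in> X (j - 1) \<and> cp n X s t i j x (u j y) \<and> i \<le> j - 1 \<longrightarrow>
        c i j x (u j y) = u j (c i (j - 1) x y))"

end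

theory Submission
  imports Defs
begin

text \<open>
  A labelled diagram is a tower of rewriting sequences. Its level of dimension \<open>k\<close> is a list of moves
  \<open>(p, x)\<close>: the \<open>k\<close>-cell \<open>x\<close> sits over position \<open>p\<close> of the level below, whose current label there has to be
  \<open>s x\<close> and becomes \<open>t x\<close>. Two towers that are composable along dimension \<open>m - 1\<close> are composed by
  concatenating their moves of dimension \<open>m\<close>. For this composition, and with the empty level as unit, towers satisfy
  all the equations of a sesquicategory; every tower is a composite of single cells and of towers with empty top level;
  and flattening a tower of towers is a homomorphism. Hence a \<open>T\<close>-algebra is a homomorphism on towers. This yields
  the operations with their equations, and also uniqueness, as a homomorphism is determined on single cells.

  Conversely, in a sesquicategory a tower is evaluated as the vertical composite of its top moves, each whiskered by
  its context, one dimension after the other starting from the lowest. Associativity, distributivity and the unit laws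
  make the evaluation a homomorphism, so evaluating after flattening and after evaluating the labels are
  two homomorphisms on towers of towers which agree on single cells, and therefore everywhere.
\<close>

section \<open>Towers of moves\<close>

text \<open>The maps of a simple diagram need not preserve order, so the order in which the cells of
  one dimension are performed is part of the data. A level can therefore be a plain list of
  positions, the list of values of the map, and no interchange of moves has to be divided out. The
  price is that a move cannot be separated from its context: a cell of dimension \<open>k\<close>
  sitting in a tower of lower dimension is surrounded, dimension by dimension, by the moves before
  and after it. Neither induction over towers nor evaluation closes up on towers alone; each is
  carried out together with a companion statement about a cell of arbitrary higher dimension placed
  in a tower (\<open>graft\<close> and \<open>whisk\<close>), and the two are split in the same way
  (\<open>graft_Lev\<close>, \<open>whisk_split\<close>). A second obstacle is that labels change
  along a sequence. They only change to parallel cells, so a relabelled level stays legal, and in a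
  tower of towers only to towers of the same shape, so offsets can be computed from the initial
  labels.\<close>

datatype 'a tower = Pt 'a | Lev "'a tower" "(nat \<times> 'a) list"

primrec tdim :: "'a tower \<Rightarrow> nat" where
  "tdim (Pt x) = 0"
| "tdim (Lev E l) = Suc (tdim E)"

primrec lbls :: "'a tower \<Rightarrow> 'a list" where
  "lbls (Pt x) = [x]"
| "lbls (Lev E l) = map snd l"

text \<open>Source and target of a tower have the same diagram, so the target is obtained from the
  source by exchanging its top labels; the positions stay.\<close>

primrec relabel :: "'a tower \<Rightarrow> 'a list \<Rightarrow> 'a tower" where
  "relabel (Pt x) st = Pt (hd st)"
| "relabel (Lev E l) st = Lev E (zip (map fst l) st)"

fun run :: "('a \<Rightarrow> 'a) \<Rightarrow> (nat \<times> 'a) list \<Rightarrow> 'a list \<Rightarrow> 'a list" where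
  "run \<tau> [] st = st"
| "run \<tau> ((p, x) # l) st = run \<tau> l (st[p := \<tau> x])"

text \<open>The running state at \<open>p\<close> is the target of the last earlier move over
  \<open>p\<close>, or the initial label if there is none. Comparing it with
  \<open>\<sigma> x\<close> is the gluing rule for the source of a cell in a diagram.\<close>

fun legal :: "('a \<Rightarrow> 'a) \<Rightarrow> ('a \<Rightarrow> 'a) \<Rightarrow> (nat \<times> 'a) list \<Rightarrow> 'a list \<Rightarrow> bool" where
  "legal \<sigma> \<tau> [] st \<longleftrightarrow> True"
| "legal \<sigma> \<tau> ((p, x) # l) st \<longleftrightarrow> p < length st \<and> st ! p = \<sigma> x \<and> legal \<sigma> \<tau> l (st[p := \<tau> x])"

primrec tsrc :: "'a tower \<Rightarrow> 'a tower" where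
  "tsrc (Pt x) = Pt x"
| "tsrc (Lev E l) = E"

primrec ttgt :: "(nat \<Rightarrow> 'a \<Rightarrow> 'a) \<Rightarrow> 'a tower \<Rightarrow> 'a tower" where
  "ttgt t (Pt x) = Pt x"
| "ttgt t (Lev E l) = relabel E (run (t (Suc (tdim E))) l (lbls E))"

primrec valid :: "(nat \<Rightarrow> 'a set) \<Rightarrow> (nat \<Rightarrow> 'a \<Rightarrow> 'a) \<Rightarrow> (nat \<Rightarrow> 'a \<Rightarrow> 'a) \<Rightarrow> 'a tower \<Rightarrow> bool" where
  "valid X s t (Pt x) \<longleftrightarrow> x \<in> X 0"
| "valid X s t (Lev E l) \<longleftrightarrow> valid X s t E \<and> snd ` set l \<subseteq> X (Suc (tdim E)) \<and>
     legal (s (Suc (tdim E))) (t (Suc (tdim E))) l (lbls E)"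

definition towers :: "(nat \<Rightarrow> 'a set) \<Rightarrow> (nat \<Rightarrow> 'a \<Rightarrow> 'a) \<Rightarrow> (nat \<Rightarrow> 'a \<Rightarrow> 'a) \<Rightarrow> nat \<Rightarrow> 'a tower set" where
  "towers X s t m = {E. valid X s t E \<and> tdim E = m}"

lemma run_append: "run \<tau> (l @ l') st = run \<tau> l' (run \<tau> l st)"
  by (induction \<tau> l st rule: run.induct) auto

lemma length_run [simp]: "length (run \<tau> l st) = length st"
  by (induction \<tau> l st rule: run.induct) auto

lemma legal_append: "legal \<sigma> \<tau> (l @ l') st \<longleftrightarrow> legal \<sigma> \<tau> l st \<and> legal \<sigma> \<tau> l' (run \<tau> l st)"
  by (induction \<sigma> \<tau> l st rule: legal.induct) auto

lemma tdim_relabel [simp]: "tdim (relabel E st) = tdim E"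
  by (cases E) auto

lemma lbls_relabel [simp]: "length st = length (lbls E) \<Longrightarrow> lbls (relabel E st) = st"
  by (cases E) (auto simp: length_Suc_conv)

lemma relabel_lbls [simp]: "relabel E (lbls E) = E"
  by (cases E) (auto simp: zip_map_fst_snd)

lemma relabel_relabel [simp]:
  "length st = length (lbls E) \<Longrightarrow> relabel (relabel E st) st' = relabel E st'"
  by (cases E) auto

lemma tsrc_relabel [simp]: "0 < tdim E \<Longrightarrow> tsrc (relabel E st) = tsrc E"
  by (cases E) auto

lemma tdim_ttgt_Lev [simp]: "tdim (ttgt t (Lev E l)) = tdim E"
  by simp

lemma ttgt_Nil [simp]: "ttgt t (Lev E []) = E"
  by simp

lemma ttgt_append: "ttgt t (Lev E (l @ l')) = ttgt t (Lev (ttgt t (Lev E l)) l')"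
  by (simp add: run_append)

lemma tower_Lev_obtain:
  assumes "tdim E = Suc m"
  obtains E' l where "E = Lev E' l" "tdim E' = m"
  using assms by (cases E) auto

text \<open>\<open>spow\<close> adds new boundary maps on the outside; this peels one off on the
  inside, which is where inductions on the dimension of a cell act.\<close>

lemma spow_shift: "spow f (Suc m) (Suc k) x = spow f m k (f (Suc m) x)"
  by (induction k arbitrary: x) (auto)

section \<open>Parallel cells, and the globular set of towers\<close>

locale globular_set =
  fixes n :: nat and X :: "nat \<Rightarrow> 'a set" and s t :: "nat \<Rightarrow> 'a \<Rightarrow> 'a"
  assumes globular: "globular n X s t"
begin

abbreviation "V \<equiv> valid X s t"
abbreviation "TW \<equiv> towers X s t"
abbreviation "tt \<equiv> ttgt t"

lemma s_closed: "x \<in> X (Suc k) \<Longrightarrow> Suc k \<le> n \<Longrightarrow> s (Suc k) x \<in> X k"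
  and t_closed: "x \<in> X (Suc k) \<Longrightarrow> Suc k \<le> n \<Longrightarrow> t (Suc k) x \<in> X k"
proof -
  have "\<forall>k\<in>{1..n}. \<forall>x\<in>X k. s k x \<in> X (k - 1) \<and> t k x \<in> X (k - 1)"
    using globular by (simp add: globular_def)
  from bspec[OF this, of "Suc k"]
  show "x \<in> X (Suc k) \<Longrightarrow> Suc k \<le> n \<Longrightarrow> s (Suc k) x \<in> X k"
    and "x \<in> X (Suc k) \<Longrightarrow> Suc k \<le> n \<Longrightarrow> t (Suc k) x \<in> X k"
    by auto
qed

lemma ss_st: "x \<in> X (Suc (Suc k)) \<Longrightarrow> Suc (Suc k) \<le> n \<Longrightarrow>
    s (Suc k) (t (Suc (Suc k)) x) = s (Suc k) (s (Suc (Suc k)) x)"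
  and ts_tt: "x \<in> X (Suc (Suc k)) \<Longrightarrow> Suc (Suc k) \<le> n \<Longrightarrow>
    t (Suc k) (t (Suc (Suc k)) x) = t (Suc k) (s (Suc (Suc k)) x)"
proof -
  have "\<forall>k\<in>{2..n}. \<forall>x\<in>X k. s (k - 1) (s k x) = s (k - 1) (t k x) \<and>
                            t (k - 1) (s k x) = t (k - 1) (t k x)"
    using globular by (simp add: globular_def)
  from bspec[OF this, of "Suc (Suc k)"]
  show "x \<in> X (Suc (Suc k)) \<Longrightarrow> Suc (Suc k) \<le> n \<Longrightarrow>
    s (Suc k) (t (Suc (Suc k)) x) = s (Suc k) (s (Suc (Suc k)) x)"
   and "x \<in> X (Suc (Suc k)) \<Longrightarrow> Suc (Suc k) \<le> n \<Longrightarrow>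
    t (Suc k) (t (Suc (Suc k)) x) = t (Suc k) (s (Suc (Suc k)) x)"
    by auto
qed

text \<open>Moves replace labels by parallel ones, which is what keeps the level carrying these
  labels valid. In dimension 0 there is no boundary to compare.\<close>

definition parallel :: "nat \<Rightarrow> 'a \<Rightarrow> 'a \<Rightarrow> bool" where
  "parallel k x y \<longleftrightarrow> k = 0 \<or> s k x = s k y \<and> t k x = t k y"

lemma parallel_refl [simp]: "parallel k x x"
  by (simp add: parallel_def)

lemma parallel_trans: "parallel k x y \<Longrightarrow> parallel k y z \<Longrightarrow> parallel k x z"
  by (auto simp: parallel_def)

lemma parallel_s_t: "x \<in> X (Suc k) \<Longrightarrow> Suc k \<le> n \<Longrightarrow> parallel k (s (Suc k) x) (t (Suc k) x)"
  by (cases k) (auto simp: parallel_def ss_st ts_tt)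

text \<open>A move exchanges \<open>s x\<close> for \<open>t x\<close>, and these are parallel by
  globularity.\<close>

lemma run_parallel:
  assumes "legal (s (Suc m)) (t (Suc m)) l st" "snd ` set l \<subseteq> X (Suc m)" "Suc m \<le> n" "set st \<subseteq> X m"
  shows "set (run (t (Suc m)) l st) \<subseteq> X m \<and> list_all2 (parallel m) st (run (t (Suc m)) l st)"
  using assms
proof (induction l arbitrary: st)
  case Nil
  then show ?case by (simp add: list_all2_refl)
next
  case (Cons a l)
  obtain p x where a: "a = (p, x)" by force
  let ?st = "st[p := t (Suc m) x]"
  from Cons.prems a have p: "p < length st" "st ! p = s (Suc m) x" "x \<in> X (Suc m)"
    and l: "legal (s (Suc m)) (t (Suc m)) l ?st" "snd ` set l \<subseteq> X (Suc m)" by auto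
  have "set ?st \<subseteq> X m"
    using Cons.prems(3,4) t_closed[of x m] p(3) set_update_subset_insert[of st p] by blast
  note IH = Cons.IH[OF l Cons.prems(3) this]
  have "list_all2 (parallel m) st ?st"
    using p Cons.prems(3) by (auto simp: list_all2_conv_all_nth nth_list_update parallel_s_t)
  with IH show ?case
    using list_all2_trans[of "parallel m" "parallel m" "parallel m", OF parallel_trans] a by auto
qed

text \<open>Legality and running see a label only through its source and target.\<close>

lemma legal_zip_parallel:
  assumes "list_all2 (parallel (Suc m)) (map snd l) st"
  shows "legal (s (Suc m)) (t (Suc m)) (zip (map fst l) st) st0 = legal (s (Suc m)) (t (Suc m)) l st0"
    and "run (t (Suc m)) (zip (map fst l) st) st0 = run (t (Suc m)) l st0"
proof -
  have "legal (s (Suc m)) (t (Suc m)) (zip (map fst l) st) st0 = legal (s (Suc m)) (t (Suc m)) l st0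
    \<and> run (t (Suc m)) (zip (map fst l) st) st0 = run (t (Suc m)) l st0"
    using assms
    by (induction l arbitrary: st st0) (auto simp: parallel_def list_all2_Cons1)
  then show "legal (s (Suc m)) (t (Suc m)) (zip (map fst l) st) st0 = legal (s (Suc m)) (t (Suc m)) l st0"
    and "run (t (Suc m)) (zip (map fst l) st) st0 = run (t (Suc m)) l st0" by auto
qed

lemma valid_lbls: "V E \<Longrightarrow> set (lbls E) \<subseteq> X (tdim E)"
  by (cases E) auto

lemma valid_relabel:
  assumes "V E" "set st \<subseteq> X (tdim E)" "list_all2 (parallel (tdim E)) (lbls E) st"
  shows "V (relabel E st)" "0 < tdim E \<Longrightarrow> tt (relabel E st) = tt E"
proof -
  have "V (relabel E st) \<and> (0 < tdim E \<longrightarrow> tt (relabel E st) = tt E)"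
  proof (cases E)
    case (Pt x)
    then show ?thesis using assms by (auto simp: list_all2_Cons1)
  next
    case (Lev E' l)
    have "length st = length l" using assms(3) Lev by (auto dest: list_all2_lengthD)
    then have "snd ` set (zip (map fst l) st) = set st"
      by (metis length_map list.set_map map_snd_zip)
    then show ?thesis using assms Lev legal_zip_parallel[of "tdim E'" l st] by auto
  qed
  then show "V (relabel E st)" "0 < tdim E \<Longrightarrow> tt (relabel E st) = tt E" by auto
qed

lemma valid_tt_Lev:
  assumes "V (Lev E l)" "Suc (tdim E) \<le> n"
  shows "V (tt (Lev E l))" "0 < tdim E \<Longrightarrow> tt (tt (Lev E l)) = tt E"
  using run_parallel[of "tdim E" l "lbls E"] assms valid_lbls[of E] valid_relabel[of E] by auto

lemma valid_append:
  "V (Lev E (l @ l')) \<longleftrightarrow> V (Lev E l) \<and> V (Lev (tt (Lev E l)) l')" if "Suc (tdim E) \<le> n"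
proof
  assume a: "V (Lev E (l @ l'))"
  then have "V (Lev E l)" by (auto simp: legal_append)
  with a show "V (Lev E l) \<and> V (Lev (tt (Lev E l)) l')"
    using valid_tt_Lev[of E l] that by (auto simp: legal_append)
qed (auto simp: legal_append)

text \<open>The sources of source and target coincide because the target of \<open>Lev E l\<close>
  is \<open>E\<close> with other top labels; the targets coincide because the new labels are
  parallel to the old ones.\<close>

lemma globular_towers: "globular n TW (\<lambda>_. tsrc) (\<lambda>_. tt)"
  unfolding globular_def
proof (intro conjI ballI; elim atLeastAtMost_iff[THEN iffD1, elim_format] conjE)
  fix k E assume "E \<in> TW k" "1 \<le> k" "k \<le> n"
  then show "tsrc E \<in> TW (k - 1)" "tt E \<in> TW (k - 1)"
    using valid_tt_Lev by (cases E; auto simp: towers_def)+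
next
  fix k E assume "E \<in> TW k" "2 \<le> k" "k \<le> n"
  then show "tsrc (tsrc E) = tsrc (tt E)" "tt (tsrc E) = tt (tt E)"
    using valid_tt_Lev by (cases E; auto simp: towers_def)+
qed

section \<open>Composability as a recursion on dimension\<close>

lemma cp_dest: "cp n X s t i j x y \<Longrightarrow> 1 \<le> i \<and> i \<le> n \<and> 1 \<le> j \<and> j \<le> n \<and> x \<in> X i \<and> y \<in> X j"
  by (auto simp: cp_def)

lemma cp_eq: "cp n X s t (Suc i) (Suc i) x y \<longleftrightarrow>
    Suc i \<le> n \<and> x \<in> X (Suc i) \<and> y \<in> X (Suc i) \<and> s (Suc i) x = t (Suc i) y"
  by (auto simp: cp_def)

text \<open>Composability compares iterated boundaries below the smaller dimension. Peeling one
  boundary off the larger cell turns this into a recursion, the form used in all later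
  inductions.\<close>

lemma cp_gt:
  assumes "j \<le> i"
  shows "cp n X s t (Suc i) j x y \<longleftrightarrow> Suc i \<le> n \<and> x \<in> X (Suc i) \<and> cp n X s t i j (s (Suc i) x) y"
proof -
  have "spow s (Suc i) (Suc i - min (Suc i) j + 1) x = spow s i (i - min i j + 1) (s (Suc i) x)"
    using assms spow_shift[of s i "i - j + 1" x] by (simp add: Suc_diff_le min_def)
  then show ?thesis using assms s_closed unfolding cp_def by (auto simp: min_def)
qed

lemma cp_lt:
  assumes "i \<le> j"
  shows "cp n X s t i (Suc j) x y \<longleftrightarrow> Suc j \<le> n \<and> y \<in> X (Suc j) \<and> cp n X s t i j x (t (Suc j) y)"
proof -
  have "spow t (Suc j) (Suc j - min i (Suc j) + 1) y = spow t j (j - min i j + 1) (t (Suc j) y)"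
    using assms spow_shift[of t j "j - i + 1" y] by (simp add: Suc_diff_le min_def)
  then show ?thesis using assms t_closed unfolding cp_def by (auto simp: min_def)
qed

text \<open>\<open>cp\<close> applies at least one \<open>s\<close> to \<open>x\<close>, so only
  \<open>s i x\<close> matters. This permits the target in place of the source in the recursive
  description, as in \<open>cp_gt_t\<close>.\<close>

lemma cp_parallel1:
  assumes "cp n X s t i j x y" "parallel i x x'" "x' \<in> X i" 
  shows "cp n X s t i j x' y"
proof -
  have "s i x = s i x'" using assms by (auto simp: parallel_def cp_def)
  moreover obtain i' where "i = Suc i'" using assms(1) by (auto simp: cp_def intro: that[of "i-1"])
  ultimately have "spow s i (i - min i j + 1) x = spow s i (i - min i j + 1) x'"
    by (simp only: Suc_eq_plus1[symmetric] spow_shift)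
  then show ?thesis using assms by (auto simp: cp_def)
qed

lemma cp_parallel2:
  assumes "cp n X s t i j x y" "parallel j y y'" "y' \<in> X j"
  shows "cp n X s t i j x y'"
proof -
  have "t j y = t j y'" using assms by (auto simp: parallel_def cp_def)
  moreover obtain j' where "j = Suc j'" using assms(1) by (auto simp: cp_def intro: that[of "j-1"])
  ultimately have "spow t j (j - min i j + 1) y = spow t j (j - min i j + 1) y'"
    by (simp only: Suc_eq_plus1[symmetric] spow_shift)
  then show ?thesis using assms by (auto simp: cp_def)
qed

lemma cp_gt_t:
  assumes "j \<le> i"
  shows "cp n X s t (Suc i) j x y \<longleftrightarrow> Suc i \<le> n \<and> x \<in> X (Suc i) \<and> cp n X s t i j (t (Suc i) x) y"
  using cp_gt[OF assms, of x y] cp_parallel1[of i j "s (Suc i) x" y "t (Suc i) x"]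
    cp_parallel1[of i j "t (Suc i) x" y "s (Suc i) x"] parallel_s_t[of x i] t_closed[of x i] s_closed[of x i]
  by (auto simp: parallel_def)

lemma cp_lt_s:
  assumes "i \<le> j"
  shows "cp n X s t i (Suc j) x y \<longleftrightarrow> Suc j \<le> n \<and> y \<in> X (Suc j) \<and> cp n X s t i j x (s (Suc j) y)"
  using cp_lt[OF assms, of x y] cp_parallel2[of i j x "t (Suc j) y" "s (Suc j) y"]
    cp_parallel2[of i j x "s (Suc j) y" "t (Suc j) y"] parallel_s_t[of y j] t_closed[of y j] s_closed[of y j]
  by (auto simp: parallel_def)

end

definition shift :: "nat \<Rightarrow> (nat \<times> 'a) list \<Rightarrow> (nat \<times> 'a) list" where
  "shift d l = map (\<lambda>(p, x). (d + p, x)) l"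

section \<open>Composition of towers\<close>

text \<open>\<open>F\<close> is performed first, so positions of \<open>E\<close> over the common level are shifted past those of \<open>F\<close>.\<close>
fun tcomp :: "'a tower \<Rightarrow> 'a tower \<Rightarrow> 'a tower" where
  "tcomp (Lev E l) (Lev F k) =
    (if tdim E = tdim F then Lev F (k @ l)
     else if tdim F < tdim E
     then Lev (tcomp E (Lev F k)) (if tdim E = Suc (tdim F) then shift (length k) l else l)
     else Lev (tcomp (Lev E l) F) k)"
| "tcomp (Pt x) F = F"
| "tcomp E (Pt y) = E"

lemma shift_simps [simp]: "shift d [] = []" "shift d ((p, x) # l) = (d + p, x) # shift d l"
  "shift d (l @ l') = shift d l @ shift d l'" "length (shift d l) = length l"
  "map snd (shift d l) = map snd l" "snd ` set (shift d l) = snd ` set l"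
  "shift d (shift e l) = shift (d + e) l"
  by (auto simp: shift_def image_iff) force+

lemma shift_zip: "shift d (zip (map fst l) st) = zip (map fst (shift d l)) st"
  by (induction l arbitrary: st) (auto simp: zip_Cons1 split: list.splits)

lemma legal_shift [simp]: "legal \<sigma> \<tau> (shift (length A) l) (A @ st) \<longleftrightarrow> legal \<sigma> \<tau> l st"
  by (induction l arbitrary: st) (auto simp: nth_append list_update_append)

lemma run_shift [simp]: "run \<tau> (shift (length A) l) (A @ st) = A @ run \<tau> l st"
  by (induction l arbitrary: st) (auto simp: nth_append list_update_append)

lemma legal_append_state: "legal \<sigma> \<tau> l st \<Longrightarrow> legal \<sigma> \<tau> l (st @ A)"
  by (induction l arbitrary: st) (auto simp: nth_append list_update_append)

lemma run_append_state: "legal \<sigma> \<tau> l st \<Longrightarrow> run \<tau> l (st @ A) = run \<tau> l st @ A"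
  by (induction l arbitrary: st) (auto simp: nth_append list_update_append)

lemma tcomp_eq: "tdim E = tdim F \<Longrightarrow> tcomp (Lev E l) (Lev F k) = Lev F (k @ l)"
  by simp

lemma tcomp_gt: "0 < tdim F \<Longrightarrow> tdim F \<le> tdim E \<Longrightarrow>
    tcomp (Lev E l) F = Lev (tcomp E F) (if tdim E = tdim F then shift (length (lbls F)) l else l)"
  by (cases F) auto

lemma tcomp_lt: "0 < tdim E \<Longrightarrow> tdim E \<le> tdim F \<Longrightarrow> tcomp E (Lev F k) = Lev (tcomp E F) k"
  by (cases E) auto

lemmas [simp del] = tcomp.simps(1)

lemma tdim_tcomp [simp]: "0 < tdim E \<Longrightarrow> 0 < tdim F \<Longrightarrow> tdim (tcomp E F) = max (tdim E) (tdim F)"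
  by (induction E F rule: tcomp.induct) (auto simp: tcomp.simps(1))

lemma lbls_tcomp: "0 < tdim E \<Longrightarrow> 0 < tdim F \<Longrightarrow> lbls (tcomp E F) =
    (if tdim E = tdim F then lbls F @ lbls E else if tdim F < tdim E then lbls E else lbls F)"
  by (cases E; cases F) (auto simp: tcomp.simps(1))

text \<open>Composition moves positions but never inspects labels. Together with the behaviour of
  \<open>run\<close> under shifts this yields the target of a composite.\<close>

lemma tcomp_relabel_left:
  "0 < tdim F \<Longrightarrow> tdim F \<le> tdim E \<Longrightarrow>
    tcomp (relabel E st) F = relabel (tcomp E F) (if tdim F = tdim E then lbls F @ st else st)"
  by (cases E; cases F) (auto simp: tcomp.simps(1) shift_zip zip_map_fst_snd)

lemma tcomp_relabel_right:
  "0 < tdim E \<Longrightarrow> tdim E \<le> tdim F \<Longrightarrow> length st = length (lbls F) \<Longrightarrow>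
    tcomp E (relabel F st) = relabel (tcomp E F) (if tdim F = tdim E then st @ lbls E else st)"
  by (cases E; cases F) (auto simp: tcomp.simps(1) zip_map_fst_snd)

text \<open>Top levels are peeled off the factor of largest dimension until all three have the same
  dimension, where both sides concatenate the same lists. The hypothesis makes the two other factors
  agree in dimension, and the largest one can stand in three places.\<close>

lemma tcomp_assoc:
  assumes "0 < tdim E" "0 < tdim F" "0 < tdim G" "two_smallest_eq (tdim E) (tdim F) (tdim G)"
  shows "tcomp (tcomp E F) G = tcomp E (tcomp F G)"
proof -
  have 0: "tcomp (tcomp E F) G = tcomp E (tcomp F G)"
    if "tdim E = m" "tdim F = m" "tdim G = m" "0 < m" for E F G :: "'a tower" and m
    using that by (cases E; cases F; cases G) (auto simp: tcomp_eq)
  have 1: "tcomp (tcomp E F) G = tcomp E (tcomp F G)"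
    if "tdim E = tdim F" "tdim F \<le> tdim G" "0 < tdim E" for E F G :: "'a tower"
    using that
  proof (induction G)
    case (Lev G' l)
    show ?case
    proof (cases "tdim F = tdim (Lev G' l)")
      case False
      then show ?thesis using Lev by (simp add: tcomp_lt)
    qed (use Lev 0 in auto)
  qed auto
  have 2: "tcomp (tcomp E F) G = tcomp E (tcomp F G)"
    if "tdim E = tdim G" "tdim G \<le> tdim F" "0 < tdim E" for E F G :: "'a tower"
    using that
  proof (induction F)
    case (Lev F' l)
    show ?case
    proof (cases "tdim (Lev F' l) = tdim G")
      case False
      then show ?thesis using Lev by (simp add: tcomp_lt tcomp_gt)
    qed (use Lev 0 in auto)
  qed auto
  have 3: "tcomp (tcomp E F) G = tcomp E (tcomp F G)"
    if "tdim F = tdim G" "tdim G \<le> tdim E" "0 < tdim F" for E F G :: "'a tower"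
    using that
  proof (induction E)
    case (Lev E' l)
    show ?case
    proof (cases "tdim (Lev E' l) = tdim G")
      case False
      then show ?thesis using Lev by (simp add: tcomp_gt lbls_tcomp)
    qed (use Lev 0 in auto)
  qed auto
  show ?thesis using assms 1[of E F G] 2[of E G F] 3[of F G E] by (auto simp: two_smallest_eq_def)
qed

text \<open>A left factor of lower dimension leaves the top lists of \<open>F\<close> and
  \<open>G\<close> alone, and it does not change \<open>length (lbls G)\<close>, by which moves of
  \<open>F\<close> may have to be shifted.\<close>

lemma tcomp_distrib_left:
  assumes "0 < tdim E" "tdim E < tdim F" "tdim E < tdim G"
  shows "tcomp E (tcomp F G) = tcomp (tcomp E F) (tcomp E G)"
  using assms
proof (induction F G rule: tcomp.induct)
  case (1 F f G g)
  consider "tdim F = tdim G" | "tdim G < tdim F" | "tdim F < tdim G" by linarith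
  then show ?case
    using 1 by cases (simp_all add: tcomp_eq tcomp_lt tcomp_gt lbls_tcomp)
qed auto

text \<open>As for a left factor, except that \<open>G\<close> may shift top moves; shifting
  commutes with concatenation.\<close>

lemma tcomp_distrib_right:
  assumes "0 < tdim G" "tdim G < tdim E" "tdim G < tdim F"
  shows "tcomp (tcomp E F) G = tcomp (tcomp E G) (tcomp F G)"
  using assms
proof (induction E F rule: tcomp.induct)
  case (1 E e F f)
  consider "tdim E = tdim F" | "tdim F < tdim E" | "tdim E < tdim F" by linarith
  then show ?case
    using 1 by cases (simp_all add: tcomp_eq tcomp_lt tcomp_gt lbls_tcomp)
qed auto

lemma tcomp_unit_left_absorb: "tdim E < tdim F \<Longrightarrow> tcomp (Lev E []) F = F"
  by (induction F) (auto simp: tcomp.simps(1))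

lemma tcomp_unit_left: "0 < tdim F \<Longrightarrow> tdim F \<le> tdim E \<Longrightarrow> tcomp (Lev E []) F = Lev (tcomp E F) []"
  by (simp add: tcomp_gt)

lemma tcomp_unit_right: "0 < tdim E \<Longrightarrow> tdim E \<le> tdim F \<Longrightarrow> tcomp E (Lev F []) = Lev (tcomp E F) []"
  by (simp add: tcomp_lt)

text \<open>The boundary equations suffice to show that the composites in the associativity and
  distributivity equations are defined. They are isolated here because they are used for the given
  cells and for towers alike.\<close>

locale precategorical = globular_set +
  fixes c :: "nat \<Rightarrow> nat \<Rightarrow> 'a \<Rightarrow> 'a \<Rightarrow> 'a"
  assumes c_closed: "cp n X s t i j x y \<Longrightarrow> c i j x y \<in> X (max i j)"
    and c_gt: "cp n X s t (Suc i) j x y \<Longrightarrow> j \<le> i \<Longrightarrow>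
      s (Suc i) (c (Suc i) j x y) = c i j (s (Suc i) x) y \<and>
      t (Suc i) (c (Suc i) j x y) = c i j (t (Suc i) x) y"
    and c_lt: "cp n X s t i (Suc j) x y \<Longrightarrow> i \<le> j \<Longrightarrow>
      s (Suc j) (c i (Suc j) x y) = c i j x (s (Suc j) y) \<and>
      t (Suc j) (c i (Suc j) x y) = c i j x (t (Suc j) y)"
    and c_eq: "cp n X s t i i x y \<Longrightarrow> s i (c i i x y) = s i y \<and> t i (c i i x y) = t i x"
begin

abbreviation "C \<equiv> cp n X s t"

lemma c_closed_gt: "C i j x y \<Longrightarrow> j \<le> i \<Longrightarrow> c i j x y \<in> X i"
  and c_closed_lt: "C i j x y \<Longrightarrow> i \<le> j \<Longrightarrow> c i j x y \<in> X j"
  using c_closed[of i j x y] by (auto simp: max_def)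

text \<open>Induction on whichever of the three dimensions is largest; the boundary equations lower
  it until all three agree.\<close>

lemma cp_assoc_left_aux:
  "i \<le> k \<Longrightarrow> C i i x y \<Longrightarrow> C i k y z \<Longrightarrow> C i k (c i i x y) z"
  "i \<le> j \<Longrightarrow> C i j x y \<Longrightarrow> C j i y z \<Longrightarrow> C j i (c i j x y) z"
  "j \<le> i \<Longrightarrow> C i j x y \<Longrightarrow> C j j y z \<Longrightarrow> C i j (c i j x y) z"
proof -
  have 0: "C i i (c i i x y) z" if "C i i x y" "C i i y z" for i x y z
    using that c_eq[OF that(1)] c_closed[OF that(1)] by (cases i) (auto simp: cp_eq cp_def)
  show "i \<le> k \<Longrightarrow> C i i x y \<Longrightarrow> C i k y z \<Longrightarrow> C i k (c i i x y) z"
    by (induction k arbitrary: z rule: dec_induct) (auto simp: 0 cp_lt)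
  show "i \<le> j \<Longrightarrow> C i j x y \<Longrightarrow> C j i y z \<Longrightarrow> C j i (c i j x y) z"
  proof (induction j arbitrary: y rule: dec_induct)
    case (step j)
    then show ?case using c_lt[of i j x y] c_closed_lt[of i "Suc j" x y] cp_lt_s[of i j x y] by (auto simp: cp_gt)
  qed (auto simp: 0)
  show "j \<le> i \<Longrightarrow> C i j x y \<Longrightarrow> C j j y z \<Longrightarrow> C i j (c i j x y) z"
  proof (induction i arbitrary: x rule: dec_induct)
    case (step i)
    then show ?case using c_gt[of i j x y] c_closed_gt[of "Suc i" j x y] by (auto simp: cp_gt)
  qed (auto simp: 0)
qed

lemma cp_assoc_left:
  "C i j x y \<Longrightarrow> C j k y z \<Longrightarrow> two_smallest_eq i j k \<Longrightarrow> C (max i j) k (c i j x y) z"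
  using cp_assoc_left_aux[where x = x and y = y and z = z] unfolding two_smallest_eq_def
  by (auto simp: max_def)

lemma cp_assoc_right_aux:
  "j \<le> i \<Longrightarrow> C i j x y \<Longrightarrow> C j j y z \<Longrightarrow> C i j x (c j j y z)"
  "i \<le> j \<Longrightarrow> C i j x y \<Longrightarrow> C j i y z \<Longrightarrow> C i j x (c j i y z)"
  "i \<le> k \<Longrightarrow> C i i x y \<Longrightarrow> C i k y z \<Longrightarrow> C i k x (c i k y z)"
proof -
  have 0: "C i i x (c i i y z)" if "C i i x y" "C i i y z" for i x y z
    using that c_eq[OF that(2)] c_closed[OF that(2)] by (cases i) (auto simp: cp_eq cp_def)
  show "j \<le> i \<Longrightarrow> C i j x y \<Longrightarrow> C j j y z \<Longrightarrow> C i j x (c j j y z)"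
    by (induction i arbitrary: x rule: dec_induct) (auto simp: 0 cp_gt)
  show "i \<le> j \<Longrightarrow> C i j x y \<Longrightarrow> C j i y z \<Longrightarrow> C i j x (c j i y z)"
  proof (induction j arbitrary: y rule: dec_induct)
    case (step j)
    then show ?case using c_gt[of j i y z] c_closed_gt[of "Suc j" i y z] cp_gt_t[of i j y z] by (auto simp: cp_lt)
  qed (auto simp: 0)
  show "i \<le> k \<Longrightarrow> C i i x y \<Longrightarrow> C i k y z \<Longrightarrow> C i k x (c i k y z)"
  proof (induction k arbitrary: z rule: dec_induct)
    case (step k)
    then show ?case using c_lt[of i k y z] c_closed_lt[of i "Suc k" y z] by (auto simp: cp_lt)
  qed (auto simp: 0)
qed

lemma cp_assoc_right:
  "C i j x y \<Longrightarrow> C j k y z \<Longrightarrow> two_smallest_eq i j k \<Longrightarrow> C i (max j k) x (c j k y z)"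
  using cp_assoc_right_aux[where x = x and y = y and z = z] unfolding two_smallest_eq_def
  by (auto simp: max_def)

lemma cp_distrib_left:
  assumes "i < j" "i < k" "C j k y z" "C i j x y" "C i k x z"
  shows "C i (max j k) x (c j k y z) \<and> C j k (c i j x y) (c i k x z)"
proof -
  have 0: "C i j x (c j j y z) \<and> C j j (c i j x y) (c i j x z)"
    if "i < j" "C j j y z" "C i j x y" "C i j x z" for j y z
  proof -
    obtain j' where j: "j = Suc j'" "i \<le> j'" using \<open>i < j\<close> by (cases j) auto
    show ?thesis using that c_eq[of j y z] c_lt[of i j' x y] c_lt[of i j' x z] c_closed_lt[of i j x]
        c_closed_lt[of j j y z]
      by (auto simp: j cp_lt cp_eq)
  qed
  have 1: "C i j x (c j k y z) \<and> C j k (c i j x y) (c i k x z)" if "k \<le> j" "i < k" "C j k y z" "C i j x y" "C i k x z" for j k y z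
    using that
  proof (induction j arbitrary: y rule: dec_induct)
    case (step j)
    then show ?case using c_gt[of j k y z] c_closed_gt[of "Suc j" k y z] cp_gt_t[of k j y z] c_lt[of i j x y]
        c_closed_lt[of i "Suc j" x y] cp_lt_s[of i j x y]
      by (auto simp: cp_lt cp_gt)
  qed (auto simp: 0)
  have 2: "C i k x (c j k y z) \<and> C j k (c i j x y) (c i k x z)" if "j \<le> k" "i < j" "C j k y z" "C i j x y" "C i k x z" for j k y z
    using that
  proof (induction k arbitrary: z rule: dec_induct)
    case (step k)
    then show ?case using c_lt[of j k y z] c_closed_lt[of j "Suc k" y z] c_lt[of i k x z]
        c_closed_lt[of i "Suc k" x z]
      by (auto simp: cp_lt)
  qed (auto simp: 0)
  show ?thesis using 1[of k j y z] 2[of j k y z] assms by (auto simp: max_def)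
qed

lemma cp_distrib_right:
  assumes "k < i" "k < j" "C i j x y" "C i k x z" "C j k y z"
  shows "C (max i j) k (c i j x y) z \<and> C i j (c i k x z) (c j k y z)"
proof -
  have 0: "C j k (c j j x y) z \<and> C j j (c j k x z) (c j k y z)"
    if "k < j" "C j j x y" "C j k x z" "C j k y z" for j x y
  proof -
    obtain j' where j: "j = Suc j'" "k \<le> j'" using \<open>k < j\<close> by (cases j) auto
    show ?thesis using that c_eq[of j x y] c_gt[of j' k x z] c_gt[of j' k y z] c_closed_gt[of j k _ z]
        c_closed_lt[of j j x y]
      by (auto simp: j cp_gt cp_eq)
  qed
  have 1: "C i k (c i j x y) z \<and> C i j (c i k x z) (c j k y z)" if "j \<le> i" "k < j" "C i j x y" "C i k x z" "C j k y z" for i j x y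
    using that
  proof (induction i arbitrary: x rule: dec_induct)
    case (step i)
    then show ?case using c_gt[of i j x y] c_closed_gt[of "Suc i" j x y] c_gt[of i k x z]
        c_closed_gt[of "Suc i" k x z]
      by (auto simp: cp_gt)
  qed (auto simp: 0)
  have 2: "C j k (c i j x y) z \<and> C i j (c i k x z) (c j k y z)" if "i \<le> j" "k < i" "C i j x y" "C i k x z" "C j k y z" for i j x y
    using that
  proof (induction j arbitrary: y rule: dec_induct)
    case (step j)
    then show ?case using c_lt[of i j x y] c_closed_lt[of i "Suc j" x y] cp_gt_t[of k j y z] c_gt[of j k y z]
        c_closed_gt[of "Suc j" k y z] cp_lt_s[of i j x y]
      by (auto simp: cp_lt cp_gt)
  qed (auto simp: 0)
  show ?thesis using 1[of j i x y] 2[of i j x y] assms by (auto simp: max_def)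
qed

end

section \<open>Towers satisfy the boundary equations\<close>

context globular_set
begin

abbreviation "cpT \<equiv> cp n TW (\<lambda>_. tsrc) (\<lambda>_. tt)"

lemma towers_globular_set: "globular_set n TW (\<lambda>_. tsrc) (\<lambda>_. tt)"
  by unfold_locales (rule globular_towers)

interpretation T: globular_set n TW "\<lambda>_. tsrc" "\<lambda>_. tt"
  by (rule towers_globular_set)

lemma cpT_eq: "cpT (Suc m) (Suc m) (Lev E l) (Lev F k) \<longleftrightarrow>
    Suc m \<le> n \<and> tdim E = m \<and> tdim F = m \<and> V (Lev E l) \<and> V (Lev F k) \<and> E = tt (Lev F k)"
  by (subst T.cp_eq) (auto simp: towers_def simp del: valid.simps)

lemma cpT_gt: "j \<le> m \<Longrightarrow> cpT (Suc m) j (Lev E l) F \<longleftrightarrow>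
    Suc m \<le> n \<and> V (Lev E l) \<and> cpT m j E F"
  by (subst T.cp_gt) (auto simp: towers_def cp_def simp del: valid.simps)

lemma cpT_gt_t: "j \<le> m \<Longrightarrow> cpT (Suc m) j (Lev E l) F \<longleftrightarrow>
    Suc m \<le> n \<and> V (Lev E l) \<and> cpT m j (tt (Lev E l)) F"
  by (subst T.cp_gt_t) (auto simp: towers_def cp_def simp del: valid.simps)

lemma cpT_lt: "i \<le> m \<Longrightarrow> cpT i (Suc m) E (Lev F k) \<longleftrightarrow>
    Suc m \<le> n \<and> V (Lev F k) \<and> cpT i m E (tt (Lev F k))"
  by (subst T.cp_lt) (auto simp: towers_def cp_def simp del: valid.simps)

lemma cpT_lt_s: "i \<le> m \<Longrightarrow> cpT i (Suc m) E (Lev F k) \<longleftrightarrow>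
    Suc m \<le> n \<and> V (Lev F k) \<and> cpT i m E F"
  by (subst T.cp_lt_s) (auto simp: towers_def cp_def simp del: valid.simps)

lemma cpT_dest: "cpT i j E F \<Longrightarrow> tdim E = i \<and> tdim F = j \<and> 0 < i \<and> 0 < j \<and> i \<le> n \<and> j \<le> n \<and> V E \<and> V F"
  by (auto simp: cp_def towers_def)

text \<open>Where the two factors meet, the state of the composite is the labels of \<open>F\<close>
  followed by those of \<open>E\<close>. Moves over \<open>E\<close> are shifted past the labels of
  \<open>F\<close>, and moves over \<open>F\<close> do not notice labels appended behind.\<close>

lemma valid_tcomp: "cpT (tdim E) (tdim F) E F \<Longrightarrow> V (tcomp E F)"
proof (induction E F rule: tcomp.induct)
  case (1 E l F k)
  consider "tdim E = tdim F" | "tdim F < tdim E" | "tdim E < tdim F" by linarith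
  then show ?case
  proof cases
    case 1
    with "1.prems" show ?thesis by (auto simp: tcomp_eq cpT_eq valid_append simp del: valid.simps ttgt.simps)
  next
    case 2
    with "1.prems" have "Suc (tdim E) \<le> n" "V (Lev E l)" "cpT (tdim E) (tdim (Lev F k)) E (Lev F k)"
      by (auto simp: cpT_gt simp del: valid.simps ttgt.simps)
    moreover from this have "V (tcomp E (Lev F k))" using "1.IH"(1) 2 by auto
    ultimately show ?thesis using 2
        legal_shift[of _ _ "map snd k" l "lbls E"] by (auto simp: tcomp.simps(1) lbls_tcomp)
  next
    case 3
    with "1.prems" have "Suc (tdim F) \<le> n" "V (Lev F k)" "cpT (tdim (Lev E l)) (tdim F) (Lev E l) F"
      by (auto simp: cpT_lt_s simp del: valid.simps ttgt.simps)
    moreover from this have "V (tcomp (Lev E l) F)" using "1.IH"(2) 3 by auto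
    ultimately show ?thesis using 3
      by (auto simp: tcomp.simps(1) lbls_tcomp legal_append_state)
  qed
qed (auto simp: cp_def towers_def)

lemma ttgt_tcomp_gt:
  assumes "cpT (Suc m) j (Lev E l) F" "j \<le> m"
  shows "tt (tcomp (Lev E l) F) = tcomp (tt (Lev E l)) F"
  using assms run_shift[of "t (Suc m)" "lbls F" l "lbls E"]
  by (auto dest!: cpT_dest simp: tcomp_gt tcomp_relabel_left lbls_tcomp max_absorb1)

lemma ttgt_tcomp_lt:
  assumes "cpT i (Suc m) E (Lev F k)" "i \<le> m"
  shows "tt (tcomp E (Lev F k)) = tcomp E (tt (Lev F k))"
  using assms run_append_state[of "s (Suc m)" "t (Suc m)" k "lbls F" "lbls E"]
  by (auto dest!: cpT_dest simp: tcomp_lt tcomp_relabel_right lbls_tcomp max_absorb2)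

lemma precategorical_towers: "precategorical n TW (\<lambda>_. tsrc) (\<lambda>_. tt) (\<lambda>_ _. tcomp)"
proof unfold_locales
  fix i j E F assume a: "cpT i j E F"
  then show "tcomp E F \<in> TW (max i j)"
    using valid_tcomp[of E F] cpT_dest[OF a] by (auto simp: towers_def)
next
  fix i j E F assume a: "cpT (Suc i) j E F" "j \<le> i"
  moreover obtain E' l where "E = Lev E' l" "tdim E' = i"
    using cpT_dest[OF a(1)] by (metis tower_Lev_obtain)
  ultimately show "tsrc (tcomp E F) = tcomp (tsrc E) F \<and> tt (tcomp E F) = tcomp (tt E) F"
    using ttgt_tcomp_gt[of i j E' l F] cpT_dest[OF a(1)] by (simp add: tcomp_gt)
next
  fix i j E F assume a: "cpT i (Suc j) E F" "i \<le> j"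
  moreover obtain F' l where "F = Lev F' l" "tdim F' = j"
    using cpT_dest[OF a(1)] by (metis tower_Lev_obtain)
  ultimately show "tsrc (tcomp E F) = tcomp E (tsrc F) \<and> tt (tcomp E F) = tcomp E (tt F)"
    using ttgt_tcomp_lt[of i j E F' l] cpT_dest[OF a(1)] by (simp add: tcomp_lt)
next
  fix i E F assume a: "cpT i i E F"
  obtain m where m: "i = Suc m" using cpT_dest[OF a] by (metis gr0_implies_Suc)
  obtain E' l where E: "E = Lev E' l" "tdim E' = m"
    using cpT_dest[OF a] m by (metis tower_Lev_obtain)
  obtain F' k where F: "F = Lev F' k" "tdim F' = m"
    using cpT_dest[OF a] m by (metis tower_Lev_obtain)
  have "E' = tt (Lev F' k)" using a m E F by (simp add: cpT_eq)
  then show "tsrc (tcomp E F) = tsrc F \<and> tt (tcomp E F) = tt E"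
    using E F by (simp add: tcomp_eq ttgt_append del: ttgt.simps)
qed

end

section \<open>Generation by single cells\<close>

text \<open>The image of \<open>eta\<close>: the diagram with one cell in each dimension, labelled
  by the iterated sources of \<open>x\<close>.\<close>

primrec tunit :: "(nat \<Rightarrow> 'a \<Rightarrow> 'a) \<Rightarrow> nat \<Rightarrow> 'a \<Rightarrow> 'a tower" where
  "tunit s 0 x = Pt x"
| "tunit s (Suc m) x = Lev (tunit s m (s (Suc m) x)) [(0, x)]"

text \<open>The \<open>k\<close>-cell \<open>x\<close> placed at position \<open>p\<close> of \<open>E\<close>, with its iterated sources in between (\<open>k > tdim E\<close>).\<close>
primrec graft :: "(nat \<Rightarrow> 'a \<Rightarrow> 'a) \<Rightarrow> 'a tower \<Rightarrow> nat \<Rightarrow> nat \<Rightarrow> 'a \<Rightarrow> 'a tower" where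
  "graft s E p 0 x = Pt x"
| "graft s E p (Suc k) x =
    (if tdim E = k then Lev E [(p, x)] else Lev (graft s E p k (s (Suc k) x)) [(0, x)])"

lemma tdim_tunit [simp]: "tdim (tunit s m x) = m"
  by (induction m arbitrary: x) auto

lemma lbls_tunit [simp]: "lbls (tunit s m x) = [x]"
  by (cases m) auto

lemma graft_Pt: "spow s k k x = y \<Longrightarrow> graft s (Pt y) 0 k x = tunit s k x"
proof (induction k arbitrary: x)
  case (Suc k)
  then show ?case using spow_shift[of s k k x] by (cases k) auto
qed simp

lemma tdim_graft [simp]: "tdim E < k \<Longrightarrow> tdim (graft s E p k x) = k"
  by (induction k arbitrary: x) auto

lemma lbls_graft [simp]: "tdim E < k \<Longrightarrow> lbls (graft s E p k x) = [x]"
  by (cases k) auto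

text \<open>The moves \<open>l1\<close> are performed before the cell and \<open>l2\<close> after
  it, and what remains in the middle is the same cell grafted one dimension lower. The bases
  \<open>E'\<close> and \<open>E''\<close> are constrained in dimension only, because a composite
  takes its base from the right factor.\<close>

lemma graft_Lev:
  assumes "tdim E'' = tdim E" "tdim E' = tdim E" "Suc (tdim E) < k"
    "spow s k (k - Suc (tdim E)) x = y"
  shows "graft s (Lev E (l1 @ (q, y) # l2)) (length l1) k x =
    tcomp (Lev E'' l2) (tcomp (graft s E' q k x) (Lev E l1))"
  using assms(3,4)
proof (induction k arbitrary: x)
  case (Suc k)
  show ?case
  proof (cases "k = Suc (tdim E)")
    case True
    then show ?thesis using Suc.prems assms(1,2) by (auto simp: tcomp_eq tcomp_gt tcomp_lt)
  next
    case False
    with Suc.prems have "Suc (tdim E) < k" by simp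
    moreover have "spow s k (k - Suc (tdim E)) (s (Suc k) x) = y"
      using Suc.prems False spow_shift[of s k "k - Suc (tdim E)" x] by (simp add: Suc_diff_Suc Suc_diff_le)
    ultimately show ?thesis using Suc.IH assms(1,2) False
      by (auto simp: tcomp_gt tcomp_lt)
  qed
qed simp

lemma split_at:
  assumes "p < length l"
  obtains l1 q y l2 where "l = l1 @ (q, y) # l2" "length l1 = p"
  using id_take_nth_drop[OF assms] assms by (metis length_take min.absorb4 surj_pair)

section \<open>Every tower is generated by single cells and empty levels\<close>

context globular_set
begin

lemma valid_step: "V (Lev E [(p, x)]) \<longleftrightarrow> V E \<and> p < length (lbls E) \<and> lbls E ! p = s (Suc (tdim E)) x \<and> x \<in> X (Suc (tdim E))"
  by auto

lemma valid_split:
  assumes "V (Lev E (l1 @ (q, y) # l2))" "Suc (tdim E) \<le> n"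
  shows "V (Lev E l1)" "V (Lev (tt (Lev E l1)) [(q, y)])" "V (Lev (tt (Lev E (l1 @ [(q, y)]))) l2)"
    "V (Lev E (l1 @ [(q, y)]))" "V (Lev (tt (Lev E l1)) ((q, y) # l2))"
    using assms valid_append[OF assms(2), of l1 "(q,y) # l2"] valid_append[OF assms(2), of "l1 @ [(q,y)]" l2]
      valid_append[OF assms(2), of l1 "[(q,y)]"]
    by (auto simp del: valid.simps ttgt.simps)

definition anchored :: "nat \<Rightarrow> 'a \<Rightarrow> nat \<Rightarrow> 'a \<Rightarrow> bool" where
  "anchored m y k x \<longleftrightarrow> x \<in> X k \<and> spow s k (k - m) x = y"

lemma anchored_refl [simp]: "anchored m y m x \<longleftrightarrow> x \<in> X m \<and> x = y"
  by (auto simp: anchored_def)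

lemma anchored_Suc: "m \<le> k \<Longrightarrow> Suc k \<le> n \<Longrightarrow>
    anchored m y (Suc k) x \<longleftrightarrow> x \<in> X (Suc k) \<and> anchored m y k (s (Suc k) x)"
  using s_closed spow_shift[of s k "k - m" x] by (auto simp: anchored_def Suc_diff_le)

lemma anchored_s: "anchored m y (Suc k) x \<Longrightarrow> m \<le> k \<Longrightarrow> Suc k \<le> n \<Longrightarrow> anchored m y k (s (Suc k) x)"
  by (simp add: anchored_Suc)

lemma anchored_mem: "anchored m y k x \<Longrightarrow> x \<in> X k"
  by (simp add: anchored_def)

lemma anchored_base_mem: "m \<le> k \<Longrightarrow> k \<le> n \<Longrightarrow> anchored m y k x \<Longrightarrow> y \<in> X m"
  by (induction k arbitrary: x rule: dec_induct) (auto simp: anchored_Suc)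

lemma anchored_base_s: "Suc m \<le> k \<Longrightarrow> k \<le> n \<Longrightarrow> anchored (Suc m) y k x \<Longrightarrow> anchored m (s (Suc m) y) k x"
  by (induction k arbitrary: x rule: dec_induct) (auto simp: anchored_Suc s_closed)

lemma ttgt_tunit: "x \<in> X (Suc m) \<Longrightarrow> Suc m \<le> n \<Longrightarrow> tt (tunit s (Suc m) x) = tunit s m (t (Suc m) x)"
  by (cases m) (auto simp: ss_st)

lemma valid_tunit: "x \<in> X m \<Longrightarrow> m \<le> n \<Longrightarrow> V (tunit s m x)"
  by (induction m arbitrary: x) (auto intro: s_closed)

lemma valid_graft:
  assumes "V E" "p < length (lbls E)" "tdim E < k" "k \<le> n" "anchored (tdim E) (lbls E ! p) k x"
  shows "V (graft s E p k x)"
  using assms(3-5)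
proof (induction k arbitrary: x)
  case (Suc k)
  show ?case
  proof (cases "k = tdim E")
    case True
    then show ?thesis using Suc.prems assms(1,2) by (auto simp: anchored_Suc)
  next
    case False
    then have "V (graft s E p k (s (Suc k) x))" using Suc.IH[of "s (Suc k) x"] Suc.prems anchored_s[of "tdim E" _ k x] by auto
    then show ?thesis using False Suc.prems by (auto dest: anchored_mem)
  qed
qed simp

interpretation T: globular_set n TW "\<lambda>_. tsrc" "\<lambda>_. tt"
  by (rule towers_globular_set)

interpretation T: precategorical n TW "\<lambda>_. tsrc" "\<lambda>_. tt" "\<lambda>_ _. tcomp"
  by (rule precategorical_towers)

lemma cpT_tunit: "cp n X s t i j x y \<Longrightarrow> cpT i j (tunit s i x) (tunit s j y)"
proof -
  have 0: "cpT i i (tunit s i x) (tunit s i y)" if cp: "cp n X s t i i x y" for i x y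
  proof -
    obtain m where m: "i = Suc m" using cp_dest[OF cp] by (cases i) auto
    then show ?thesis using cp valid_tunit[of _ i] valid_tunit[of "t (Suc m) y" m] t_closed[of y m] ttgt_tunit[of y m]
      by (simp add: cp_eq cpT_eq)
  qed
  have 1: "j \<le> i \<Longrightarrow> cp n X s t i j x y \<Longrightarrow> cpT i j (tunit s i x) (tunit s j y)"
  proof (induction i arbitrary: x rule: dec_induct)
    case (step i)
    then show ?case using valid_tunit[of x "Suc i"] by (simp add: cp_gt cpT_gt)
  qed (rule 0)
  have 2: "i \<le> j \<Longrightarrow> cp n X s t i j x y \<Longrightarrow> cpT i j (tunit s i x) (tunit s j y)"
  proof (induction j arbitrary: y rule: dec_induct)
    case (step j)
    then show ?case using valid_tunit[of y "Suc j"] by (simp add: cp_lt_s cpT_lt_s)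
  qed (rule 0)
  show "cp n X s t i j x y \<Longrightarrow> cpT i j (tunit s i x) (tunit s j y)" 
    using 1 2 by (cases "i \<le> j") auto
qed

text \<open>The composites in \<open>graft_Lev\<close> are defined once \<open>E'\<close> and
  \<open>E''\<close> are the actual states before and after the move \<open>(q, y)\<close>. Lowering
  \<open>k\<close> by sources keeps the context fixed, so the claim reduces to
  \<open>k = Suc m\<close>, where the pieces are consecutive.\<close>

lemma cpT_graft:
  assumes "V (Lev E (l1 @ (q, y) # l2))" "tdim E = m" "Suc m \<le> k" "k \<le> n" "anchored (Suc m) y k x"
  shows "cpT k (Suc m) (graft s (tt (Lev E l1)) q k x) (Lev E l1)"
    "cpT (Suc m) k (Lev (tt (Lev E (l1 @ [(q, y)]))) l2) (graft s (tt (Lev E l1)) q k x)"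
    "cpT (Suc m) k (Lev (tt (Lev E (l1 @ [(q, y)]))) l2) (tcomp (graft s (tt (Lev E l1)) q k x) (Lev E l1))"
proof -
  let ?E' = "tt (Lev E l1)" and ?E'' = "tt (Lev E (l1 @ [(q, y)]))"
  have n: "Suc (tdim E) \<le> n" using assms by simp
  note v = valid_split[OF assms(1) n]
  have E': "V ?E'" "q < length (lbls ?E')" "lbls ?E' ! q = s (Suc m) y" "tdim ?E' = m"
    using v(2) assms(2) by auto
  have g: "V (graft s ?E' q k x)" if "Suc m \<le> k" "k \<le> n" "anchored (Suc m) y k x" for k x
    using valid_graft[of ?E' q k x] anchored_base_s[of m k y x] that E' by auto
  show 1: "cpT k (Suc m) (graft s ?E' q k x) (Lev E l1)"
    using assms(3-5)
  proof (induction k arbitrary: x rule: dec_induct)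
    case base
    then have "x = y" "graft s ?E' q (Suc m) x = Lev ?E' [(q, y)]" using E'(4) by auto
    then show ?case using v E' base assms(2) by (simp add: cpT_eq del: ttgt.simps valid.simps)
  next
    case (step k)
    then have "cpT k (Suc m) (graft s ?E' q k (s (Suc k) x)) (Lev E l1)" by (auto intro: anchored_s)
    moreover have "graft s ?E' q (Suc k) x = Lev (graft s ?E' q k (s (Suc k) x)) [(0, x)]"
      using E' step by auto
    ultimately show ?case using g[of "Suc k" x] step by (simp add: cpT_gt del: ttgt.simps valid.simps)
  qed
  show 2: "cpT (Suc m) k (Lev ?E'' l2) (graft s ?E' q k x)"
    using assms(3-5)
  proof (induction k arbitrary: x rule: dec_induct)
    case base
    then have "x = y" "graft s ?E' q (Suc m) x = Lev ?E' [(q, y)]" using E'(4) by auto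
    then show ?case using v E' base assms(2)
      by (simp add: cpT_eq ttgt_append[symmetric] del: ttgt.simps valid.simps)
  next
    case (step k)
    then have "cpT (Suc m) k (Lev ?E'' l2) (graft s ?E' q k (s (Suc k) x))" by (auto intro: anchored_s)
    moreover have "graft s ?E' q (Suc k) x = Lev (graft s ?E' q k (s (Suc k) x)) [(0, x)]"
      using E' step by auto
    ultimately show ?case using g[of "Suc k" x] step by (simp add: cpT_lt_s del: ttgt.simps valid.simps)
  qed
  show "cpT (Suc m) k (Lev ?E'' l2) (tcomp (graft s ?E' q k x) (Lev E l1))"
    using T.cp_assoc_right[OF 2 1] assms(3) by (simp add: two_smallest_eq_def max_absorb1)
qed

text \<open>Two claims go through one induction on \<open>m\<close>: towers of dimension
  \<open>m\<close> satisfy \<open>P\<close>, and so does every graft of a cell of higher dimension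
  on such a tower. A level is a composite of one-move towers, and a one-move tower is a graft on a
  tower of the dimension below. In turn \<open>graft_Lev\<close> splits a graft on a tower of the
  next dimension into two sequences and a graft one dimension lower.\<close>

theorem tower_induct [consumes 2, case_names tunit unit tcomp]:
  assumes "V E" "tdim E \<le> n"
    and tunit: "\<And>m x. m \<le> n \<Longrightarrow> x \<in> X m \<Longrightarrow> P (tunit s m x)"
    and degen: "\<And>E. V E \<Longrightarrow> tdim E < n \<Longrightarrow> P E \<Longrightarrow> P (Lev E [])"
    and comp: "\<And>i j E F. cpT i j E F \<Longrightarrow> P E \<Longrightarrow> P F \<Longrightarrow> P (tcomp E F)"
  shows "P E"
proof -
  have "(\<forall>E. V E \<longrightarrow> tdim E = m \<longrightarrow> P E) \<and>
    (\<forall>E p k x. V E \<longrightarrow> tdim E = m \<longrightarrow> p < length (lbls E) \<longrightarrow> m < k \<longrightarrow> k \<le> n \<longrightarrow>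
      anchored m (lbls E ! p) k x \<longrightarrow> P (graft s E p k x))" if "m \<le> n" for m
    using that
  proof (induction m)
    case 0
    show ?case
    proof (intro conjI allI impI)
      fix E assume "V E" "tdim E = 0"
      then show "P E" using tunit[of 0] by (cases E) auto
    next
      fix E p k x assume a: "V E" "tdim E = 0" "p < length (lbls E)" "k \<le> n" "anchored 0 (lbls E ! p) k x"
      then obtain y where "E = Pt y" "p = 0" by (cases E) auto
      then show "P (graft s E p k x)" using tunit[of k x] a by (auto simp: graft_Pt anchored_def)
    qed
  next
    case (Suc m)
    then have IH1: "P E" if "V E" "tdim E = m" for E
      using that by auto
    have IH2: "P (graft s E p k x)" if "V E" "tdim E = m" "p < length (lbls E)" "m < k" "k \<le> n"
        "anchored m (lbls E ! p) k x" for E p k x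
      using that Suc by auto
    have Lev: "P (Lev E l)" if "V (Lev E l)" "tdim E = m" for E l
      using that
    proof (induction l rule: rev_induct)
      case Nil
      then show ?case using degen[of E] IH1 Suc.prems by auto
    next
      case (snoc a l)
      obtain p x where a: "a = (p, x)" by force
      have n: "Suc (tdim E) \<le> n" using snoc Suc.prems by simp
      have v: "V (Lev E l)" "V (Lev (tt (Lev E l)) [a])"
        using snoc.prems valid_append[OF n, of l "[a]"] by (auto simp del: valid.simps ttgt.simps)
      \<comment> \<open>The last move alone is the graft of a cell of the next dimension, hence
        covered by the second claim one dimension lower.\<close>
      have "P (graft s (tt (Lev E l)) p (Suc m) x)"
        by (rule IH2) (use v a snoc.prems Suc.prems in \<open>auto simp: anchored_Suc intro: s_closed\<close>)
      moreover have "graft s (tt (Lev E l)) p (Suc m) x = Lev (tt (Lev E l)) [a]"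
        using snoc.prems a by simp
      moreover have "cpT (Suc m) (Suc m) (Lev (tt (Lev E l)) [a]) (Lev E l)"
        using v snoc.prems Suc.prems by (simp add: cpT_eq del: valid.simps ttgt.simps)
      ultimately have "P (tcomp (Lev (tt (Lev E l)) [a]) (Lev E l))"
        using comp v snoc by auto
      then show ?case by (simp add: tcomp_eq)
    qed
    show ?case
    proof (intro conjI allI impI)
      fix E assume "V E" "tdim E = Suc m"
      then show "P E" using Lev by (metis tower_Lev_obtain)
    next
      fix E p k x
      assume a: "V E" "tdim E = Suc m" "p < length (lbls E)" "Suc m < k" "k \<le> n"
        "anchored (Suc m) (lbls E ! p) k x"
      then obtain E0 l where E: "E = Lev E0 l" "tdim E0 = m" by (metis tower_Lev_obtain)
      have "p < length l" using a E by simp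
      then obtain l1 q y l2 where l: "l = l1 @ (q, y) # l2" and len: "length l1 = p" by (rule split_at)
      have y: "lbls E ! p = y" using E l len by (auto simp: nth_append)
      let ?E' = "tt (Lev E0 l1)" and ?E'' = "tt (Lev E0 (l1 @ [(q, y)]))"
      have vE: "V (Lev E0 (l1 @ (q, y) # l2))" using a E l by simp
      note cps = cpT_graft[OF vE E(2), of k x]
      have anch: "anchored (Suc m) y k x" using a y by simp
      have n: "Suc (tdim E0) \<le> n" using a E by simp
      note v = valid_split[OF vE n]
      have "P (graft s ?E' q k x)"
      proof (rule IH2)
        show "anchored m (lbls ?E' ! q) k x" using v(2) anchored_base_s[OF _ _ anch] a E by auto
      qed (use v a E in auto)
      moreover have "P (Lev E0 l1)" "P (Lev ?E'' l2)"
        using Lev[OF v(1)] Lev[OF v(3)] E(2) by simp_all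
      ultimately have "P (tcomp (Lev ?E'' l2) (tcomp (graft s ?E' q k x) (Lev E0 l1)))"
        using comp cps anch a by auto
      moreover have "graft s E p k x = tcomp (Lev ?E'' l2) (tcomp (graft s ?E' q k x) (Lev E0 l1))"
        unfolding E(1) l len[symmetric]
        by (rule graft_Lev) (use a E anch in \<open>auto simp: anchored_def\<close>)
      ultimately show "P (graft s E p k x)" by simp
    qed
  qed
  then show ?thesis using assms(1,2) by blast
qed

end

section \<open>Flattening and relabelling\<close>

primrec moves :: "'a tower \<Rightarrow> (nat \<times> 'a) list" where
  "moves (Pt x) = []"
| "moves (Lev E l) = l"

definition offset :: "'a tower list \<Rightarrow> nat \<Rightarrow> nat" where
  "offset st p = length (concat (map lbls (take p st)))"

definition flat_moves :: "'a tower list \<Rightarrow> (nat \<times> 'a tower) list \<Rightarrow> (nat \<times> 'a) list" where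
  "flat_moves st l = concat (map (\<lambda>(p, G). shift (offset st p) (moves G)) l)"

primrec tflat :: "'a tower tower \<Rightarrow> 'a tower" where
  "tflat (Pt E) = E"
| "tflat (Lev W l) = Lev (tflat W) (flat_moves (lbls W) l)"

text \<open>A move replaces a label that is a tower by one of the same shape; this is why the offsets used by
  \<open>flat_moves\<close> may be computed once and for all from the initial labels.\<close>
definition same_shape :: "'a tower \<Rightarrow> 'a tower \<Rightarrow> bool" where
  "same_shape E E' \<longleftrightarrow> relabel E (lbls E') = E' \<and> length (lbls E) = length (lbls E')"

lemma same_shape_refl [simp]: "same_shape E E"
  by (simp add: same_shape_def)

lemma same_shape_trans: "same_shape E E' \<Longrightarrow> same_shape E' E'' \<Longrightarrow> same_shape E E''"
  unfolding same_shape_def by (metis relabel_relabel)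

lemma list_all2_same_shape_trans:
  "list_all2 same_shape st st' \<Longrightarrow> list_all2 same_shape st' st'' \<Longrightarrow> list_all2 same_shape st st''"
  by (auto simp: list_all2_conv_all_nth) (metis same_shape_trans)

lemma same_shape_relabel: "length st = length (lbls E) \<Longrightarrow> same_shape E (relabel E st)"
  by (simp add: same_shape_def)

lemma offset_same_shape: "list_all2 same_shape st st' \<Longrightarrow> offset st p = offset st' p"
proof -
  assume "list_all2 same_shape st st'"
  then have "map (length \<circ> lbls) st = map (length \<circ> lbls) st'"
    by (induction rule: list_all2_induct) (auto simp: same_shape_def)
  then show ?thesis
    by (simp add: offset_def length_concat take_map[symmetric] comp_def)
qed

lemma flat_moves_simps [simp]: "flat_moves st [] = []"
  "flat_moves st ((p, G) # l) = shift (offset st p) (moves G) @ flat_moves st l"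
  "flat_moves st (l @ l') = flat_moves st l @ flat_moves st l'"
  by (auto simp: flat_moves_def)

lemma flat_moves_same_shape: "list_all2 same_shape st st' \<Longrightarrow> flat_moves st l = flat_moves st' l"
  using offset_same_shape by (force simp: flat_moves_def)

lemma flat_moves_append_state:
  "\<forall>(p, G) \<in> set l. p \<le> length st \<Longrightarrow> flat_moves (st @ st') l = flat_moves st l"
  by (induction l) (auto simp: offset_def)

lemma flat_moves_shift:
  "flat_moves (st @ st') (shift (length st) l) = shift (length (concat (map lbls st))) (flat_moves st' l)"
  by (induction l) (auto simp: offset_def)

lemma legal_bound: "legal \<sigma> \<tau> l st \<Longrightarrow> (p, x) \<in> set l \<Longrightarrow> p < length st"
proof (induction l arbitrary: st)
  case (Cons a l)
  then show ?case by (cases a) (auto, metis length_list_update)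
qed simp

lemma map_moves_lbls: "0 < tdim E \<Longrightarrow> map snd (moves E) = lbls E"
  by (cases E) auto

lemma shift_0 [simp]: "shift 0 l = l"
  by (induction l) auto

lemma moves_relabel: "moves (relabel E st) = zip (map fst (moves E)) st"
  by (cases E) auto

lemma moves_same_shape: "same_shape E E' \<Longrightarrow> moves E' = zip (map fst (moves E)) (lbls E')"
  by (cases E) (auto simp: same_shape_def moves_relabel dest!: arg_cong[of _ _ moves])

definition globular_map :: "nat \<Rightarrow> (nat \<Rightarrow> 'a set) \<Rightarrow> (nat \<Rightarrow> 'a \<Rightarrow> 'a) \<Rightarrow> (nat \<Rightarrow> 'a \<Rightarrow> 'a) \<Rightarrow>
    (nat \<Rightarrow> 'b set) \<Rightarrow> (nat \<Rightarrow> 'b \<Rightarrow> 'b) \<Rightarrow> (nat \<Rightarrow> 'b \<Rightarrow> 'b) \<Rightarrow> ('a \<Rightarrow> 'b) \<Rightarrow> bool" where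
  "globular_map n X s t X' s' t' f \<longleftrightarrow> (\<forall>k\<le>n. \<forall>x\<in>X k. f x \<in> X' k) \<and>
    (\<forall>k<n. \<forall>x\<in>X (Suc k). f (s (Suc k) x) = s' (Suc k) (f x) \<and> f (t (Suc k) x) = t' (Suc k) (f x))"

lemma map_tower_tcomp: "map_tower f (tcomp E F) = tcomp (map_tower f E) (map_tower f F)"
proof -
  have dim: "tdim (map_tower f E) = tdim E" for E by (induction E) auto
  have sh: "map (map_prod id f) (shift d l) = shift d (map (map_prod id f) l)" for d l
    by (induction l) auto
  show ?thesis by (induction E F rule: tcomp.induct) (auto simp: tcomp.simps(1) dim sh)
qed

lemma tdim_map_tower [simp]: "tdim (map_tower f E) = tdim E"
  by (induction E) auto

lemma lbls_map_tower [simp]: "lbls (map_tower f E) = map f (lbls E)"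
  by (cases E) auto

lemma map_tower_relabel: "st \<noteq> [] \<or> 0 < tdim E \<Longrightarrow> map_tower f (relabel E st) = relabel (map_tower f E) (map f st)"
  by (cases E) (auto simp: hd_map zip_map2 zip_map1 map_prod_def split_beta comp_def)

context globular_set
begin

interpretation T: globular_set n TW "\<lambda>_. tsrc" "\<lambda>_. tt"
  by (rule towers_globular_set)

interpretation T: precategorical n TW "\<lambda>_. tsrc" "\<lambda>_. tt" "\<lambda>_ _. tcomp"
  by (rule precategorical_towers)

text \<open>Performing \<open>G\<close> at \<open>p\<close> rewrites the block
  \<open>lbls (tsrc G)\<close> into \<open>lbls (tt G)\<close>, between the blocks \<open>A\<close>
  before and \<open>B\<close> behind. Offsets refer to the initial state \<open>st0\<close> while
  the induction changes \<open>st\<close>; the invariant is that the two have the same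
  shape.\<close>

lemma flat_moves_run:
  assumes "legal tsrc tt l st" "snd ` set l \<subseteq> TW (Suc m)" "list_all2 same_shape st0 st"
  shows "legal (s (Suc m)) (t (Suc m)) (flat_moves st0 l) (concat (map lbls st)) \<and>
    run (t (Suc m)) (flat_moves st0 l) (concat (map lbls st)) = concat (map lbls (run tt l st)) \<and>
    list_all2 same_shape st0 (run tt l st)"
  using assms
proof (induction l arbitrary: st)
  case (Cons a l)
  obtain p G where a: "a = (p, G)" by force
  have p: "p < length st" "st ! p = tsrc G" "G \<in> TW (Suc m)" using Cons.prems a by auto
  then obtain G0 g where G: "G = Lev G0 g" "tdim G0 = m" "V (Lev G0 g)"
    by (auto simp: towers_def elim: tower_Lev_obtain)
  define A B where "A = concat (map lbls (take p st))" and "B = concat (map lbls (drop (Suc p) st))"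
  have st: "concat (map lbls st) = A @ lbls G0 @ B"
    using p G by (subst id_take_nth_drop[OF p(1)]) (simp add: A_def B_def)
  have st': "concat (map lbls (st[p := tt G])) = A @ run (t (Suc m)) g (lbls G0) @ B"
    using p G by (subst upd_conv_take_nth_drop[OF p(1)]) (simp add: A_def B_def)
  have off: "offset st0 p = length A"
    using offset_same_shape[OF Cons.prems(3)] by (simp add: offset_def A_def)
  have lg: "legal (s (Suc m)) (t (Suc m)) g (lbls G0)" using G by simp
  have ss: "list_all2 same_shape st0 (st[p := tt G])"
  proof -
    have "same_shape (tsrc G) (tt G)" using G by (simp add: same_shape_relabel)
    then have "list_all2 same_shape st (st[p := tt G])"
      using p by (auto simp: list_all2_conv_all_nth nth_list_update)
    then show ?thesis using list_all2_same_shape_trans[OF Cons.prems(3)] by blast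
  qed
  have "legal tsrc tt l (st[p := tt G])" "snd ` set l \<subseteq> TW (Suc m)" using Cons.prems a by auto
  note IH = Cons.IH[OF this ss, unfolded st']
  have L: "legal (s (Suc m)) (t (Suc m)) (shift (length A) (moves G)) (A @ lbls G0 @ B)"
    by (simp add: G(1) legal_append_state[OF lg])
  have R: "run (t (Suc m)) (shift (length A) (moves G)) (A @ lbls G0 @ B) = A @ run (t (Suc m)) g (lbls G0) @ B"
    by (simp add: G(1) run_append_state[OF lg])
  show ?case
    unfolding a flat_moves_simps st off run.simps
      legal_append run_append R
    using L IH by blast
qed simp

lemma tdim_tflat: "T.V W \<Longrightarrow> tdim (tflat W) = tdim W"
  by (induction W) (auto simp: towers_def)

lemma lbls_tflat: "T.V W \<Longrightarrow> lbls (tflat W) = concat (map lbls (lbls W))"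
proof (cases W)
  case (Lev W' l)
  assume "T.V W"
  then have "\<forall>(p, G) \<in> set l. 0 < tdim G" using Lev by (force simp: towers_def)
  then have "map snd (flat_moves st l) = concat (map lbls (map snd l))" for st
    by (induction l) (auto simp: map_moves_lbls)
  then show ?thesis using Lev by simp
qed simp

text \<open>Labels of the same shape contribute moves with the same positions, so flattening sees
  only a change of labels.\<close>

lemma tflat_relabel:
  assumes "T.V W" "list_all2 same_shape (lbls W) st"
  shows "tflat (relabel W st) = relabel (tflat W) (concat (map lbls st))"
proof (cases W)
  case (Pt E)
  then show ?thesis using assms by (auto simp: list_all2_Cons1 same_shape_def)
next
  case (Lev W' l)
  have "\<forall>(p, G) \<in> set l. 0 < tdim G" using Lev assms(1) by (force simp: towers_def)
  moreover have "list_all2 same_shape (map snd l) st" using Lev assms by simp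
  ultimately have "flat_moves st' (zip (map fst l) st) =
      zip (map fst (flat_moves st' l)) (concat (map lbls st))" for st'
  proof (induction l arbitrary: st)
    case (Cons a l)
    obtain p G where a: "a = (p, G)" by force
    with Cons.prems obtain G' st1 where st: "st = G' # st1" "same_shape G G'" "list_all2 same_shape (map snd l) st1"
      by (auto simp: list_all2_Cons1)
    have "length (lbls G') = length (moves G)"
      using st(2) Cons.prems(1) a map_moves_lbls[of G] by (auto simp: same_shape_def) (metis length_map)
    then show ?case
      using Cons.IH[OF _ st(3)] Cons.prems a st(1) moves_same_shape[OF st(2)]
      by (simp add: shift_zip)
  qed simp
  then show ?thesis using Lev by simp
qed

text \<open>The flattened level runs through the concatenations of the states of \<open>W\<close>,
  so legality and target both come out of \<open>flat_moves_run\<close>.\<close>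

lemma tflat_valid_ttgt:
  assumes "T.V W" "tdim W \<le> n"
  shows "V (tflat W) \<and> tflat (ttgt (\<lambda>_. tt) W) = (if tdim W = 0 then tflat W else tt (tflat W))"
  using assms
proof (induction W)
  case (Lev W l)
  then have VW: "T.V W" "V (tflat W)" by auto
  note r = flat_moves_run[of l "lbls W" "tdim W" "lbls W"]
  have l: "legal tsrc tt l (lbls W)" "snd ` set l \<subseteq> TW (Suc (tdim W))" using Lev.prems by auto
  note r = r[OF l list_all2_refl[OF same_shape_refl]]
  have "snd ` set (flat_moves st l) \<subseteq> X (Suc (tdim W))" for st
  proof -
    have "snd ` set (moves G) \<subseteq> X (Suc (tdim W))" if "(p, G) \<in> set l" for p G
    proof -
      have "G \<in> TW (Suc (tdim W))" using that l(2) by force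
      then show ?thesis by (cases G) (auto simp: towers_def)
    qed
    moreover have "snd ` set (flat_moves st l) = (\<Union>(p, G) \<in> set l. snd ` set (moves G))"
    proof (induction l)
      case (Cons a l)
      then show ?case by (cases a) (simp add: image_Un del: shift_simps(3))
    qed simp
    ultimately show ?thesis by auto
  qed
  then show ?case using r VW tflat_relabel[OF VW(1), of "run tt l (lbls W)"]
    by (simp add: lbls_tflat[OF VW(1)] tdim_tflat[OF VW(1)])
qed (auto simp: towers_def)

lemma globular_map_tflat: "globular_map n (towers TW (\<lambda>_. tsrc) (\<lambda>_. tt)) (\<lambda>_. tsrc) (\<lambda>_. ttgt (\<lambda>_. tt))
    TW (\<lambda>_. tsrc) (\<lambda>_. tt) tflat"
  unfolding globular_map_def
proof (intro conjI allI impI ballI)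
  fix k W assume "k \<le> n" "W \<in> towers TW (\<lambda>_. tsrc) (\<lambda>_. tt) k"
  then show "tflat W \<in> TW k"
    using tflat_valid_ttgt[of W] tdim_tflat[of W] by (auto simp: towers_def)
next
  fix k W assume k: "k < n" "W \<in> towers TW (\<lambda>_. tsrc) (\<lambda>_. tt) (Suc k)"
  then show "tflat (tsrc W) = tsrc (tflat W)" by (cases W) (auto simp: towers_def)
  show "tflat (ttgt (\<lambda>_. tt) W) = tt (tflat W)"
    using tflat_valid_ttgt[of W] k by (auto simp: towers_def)
qed

lemma tflat_tunit: "E \<in> TW m \<Longrightarrow> tflat (tunit (\<lambda>_. tsrc) m E) = E"
proof (induction m arbitrary: E)
  case (Suc m)
  then show ?case by (cases E) (auto simp: towers_def offset_def)
qed simp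

lemma tflat_tcomp:
  "T.cpT (tdim W) (tdim W') W W' \<Longrightarrow> tflat (tcomp W W') = tcomp (tflat W) (tflat W')"
proof (induction W W' rule: tcomp.induct)
  case (1 A l B k)
  have V: "T.V (Lev A l)" "T.V (Lev B k)" using T.cpT_dest[OF 1(3)] by auto
  then have VA: "T.V A" and VB: "T.V B" by auto
  note d = tdim_tflat[OF VA] tdim_tflat[OF VB] tdim_tflat[OF V(1)] tdim_tflat[OF V(2)]
  consider "tdim A = tdim B" | "tdim B < tdim A" | "tdim A < tdim B" by linarith
  then show ?case
  proof cases
    case 1
    have A: "A = ttgt (\<lambda>_. tt) (Lev B k)"
      using T.cpT_eq[of "tdim B" A l B k] "1.prems" 1 by (simp del: ttgt.simps valid.simps)
    \<comment> \<open>The offsets for \<open>l\<close> are computed from \<open>lbls B\<close> on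
      one side and from \<open>lbls A\<close> on the other; \<open>A\<close> is the target of
      \<open>Lev B k\<close>, so they agree.\<close>
    have "list_all2 same_shape (lbls B) (lbls A)"
      using A flat_moves_run[of k "lbls B" "tdim B" "lbls B"] V(2)
      by (simp add: list_all2_refl)
    then show ?thesis using 1 d by (simp add: tcomp_eq flat_moves_same_shape)
  next
    case 2
    with "1.prems" have cp: "T.cpT (tdim A) (tdim (Lev B k)) A (Lev B k)"
      by (auto simp: T.cpT_gt simp del: valid.simps ttgt.simps)
    \<comment> \<open>Shifting by the number of towers in \<open>lbls (Lev B k)\<close> becomes
      shifting by the total number of their labels.\<close>
    have "flat_moves (lbls (Lev B k) @ lbls A) (shift (length (lbls (Lev B k))) l) =
      shift (length (lbls (tflat (Lev B k)))) (flat_moves (lbls A) l)"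
      unfolding flat_moves_shift by (simp add: lbls_tflat[OF V(2)] del: tflat.simps lbls.simps)
    moreover have "lbls (tcomp A (Lev B k)) =
        (if tdim A = Suc (tdim B) then lbls (Lev B k) @ lbls A else lbls A)"
      using 2 by (subst lbls_tcomp) auto
    moreover have "tflat (tcomp A (Lev B k)) = tcomp (tflat A) (tflat (Lev B k))"
      using "1.IH"(1)[OF _ 2 cp] 2 by auto
    moreover have "tcomp (Lev A l) (Lev B k) = Lev (tcomp A (Lev B k))
        (if tdim A = tdim (Lev B k) then shift (length (lbls (Lev B k))) l else l)"
      using 2 by (intro tcomp_gt) auto
    moreover have "tcomp (tflat (Lev A l)) (tflat (Lev B k)) = Lev (tcomp (tflat A) (tflat (Lev B k)))
        (if tdim A = tdim (Lev B k) then shift (length (lbls (tflat (Lev B k)))) (flat_moves (lbls A) l)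
         else flat_moves (lbls A) l)"
      unfolding tflat.simps(2)[of A] using 2 d(1,4)
      by (subst tcomp_gt) (simp_all del: tflat.simps lbls.simps)
    ultimately show ?thesis by (simp del: lbls.simps)
  next
    case 3
    with "1.prems" have cp: "T.cpT (tdim (Lev A l)) (tdim B) (Lev A l) B"
      by (auto simp: T.cpT_lt_s simp del: valid.simps ttgt.simps)
    \<comment> \<open>Legal positions stay inside \<open>lbls B\<close>, so labels appended behind
      do not affect the offsets.\<close>
    have "\<forall>(p, G) \<in> set k. p \<le> length (lbls B)"
      using legal_bound[of tsrc tt k "lbls B"] V(2) by force
    then have "flat_moves (lbls B @ st) k = flat_moves (lbls B) k" for st
      by (rule flat_moves_append_state)
    moreover have "lbls (tcomp (Lev A l) B) =
        (if tdim B = Suc (tdim A) then lbls B @ lbls (Lev A l) else lbls B)"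
      using 3 by (subst lbls_tcomp) auto
    moreover have "tflat (tcomp (Lev A l) B) = tcomp (tflat (Lev A l)) (tflat B)"
      using "1.IH"(2)[OF _ _ cp] 3 by auto
    moreover have "tcomp (Lev A l) (Lev B k) = Lev (tcomp (Lev A l) B) k"
      using 3 by (intro tcomp_lt) auto
    moreover have "tcomp (tflat (Lev A l)) (tflat (Lev B k)) =
        Lev (tcomp (tflat (Lev A l)) (tflat B)) (flat_moves (lbls B) k)"
      unfolding tflat.simps(2)[of B] using 3 d(2,3)
      by (intro tcomp_lt) (simp_all del: tflat.simps)
    ultimately show ?thesis by (simp del: lbls.simps)
  qed
next
  case (2 x F)
then show ?case using T.cpT_dest[OF 2] by simp
next
  case (3 E l y)
then show ?case using T.cpT_dest[OF 3] by simp
qed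

end

section \<open>Globular maps act on towers\<close>

locale globular_morphism = globular_set n X s t + Y: globular_set n X' s' t'
  for n and X :: "nat \<Rightarrow> 'a set" and s t and X' :: "nat \<Rightarrow> 'b set" and s' t' +
  fixes f :: "'a \<Rightarrow> 'b"
  assumes map: "globular_map n X s t X' s' t' f"
begin

lemma f_closed: "k \<le> n \<Longrightarrow> x \<in> X k \<Longrightarrow> f x \<in> X' k"
  and f_s: "Suc k \<le> n \<Longrightarrow> x \<in> X (Suc k) \<Longrightarrow> f (s (Suc k) x) = s' (Suc k) (f x)"
  and f_t: "Suc k \<le> n \<Longrightarrow> x \<in> X (Suc k) \<Longrightarrow> f (t (Suc k) x) = t' (Suc k) (f x)"
  using map by (auto simp: globular_map_def)

lemma cp_map: "cp n X s t i j x y \<Longrightarrow> cp n X' s' t' i j (f x) (f y)"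
proof -
  have 0: "cp n X' s' t' i i (f x) (f y)" if "cp n X s t i i x y" for i x y
    using that f_s[of "i - 1" x] f_t[of "i - 1" y] f_closed[of i]
    by (cases i) (auto simp: cp_eq Y.cp_eq cp_def)
  have 1: "j \<le> i \<Longrightarrow> cp n X s t i j x y \<Longrightarrow> cp n X' s' t' i j (f x) (f y)"
  proof (induction i arbitrary: x rule: dec_induct)
    case (step i)
    then show ?case using f_s[of i x] f_closed[of "Suc i" x] step.IH[of "s (Suc i) x"]
      by (simp add: cp_gt Y.cp_gt)
  qed (rule 0)
  have 2: "i \<le> j \<Longrightarrow> cp n X s t i j x y \<Longrightarrow> cp n X' s' t' i j (f x) (f y)"
  proof (induction j arbitrary: y rule: dec_induct)
    case (step j)
    then show ?case using f_t[of j y] f_closed[of "Suc j" y] step.IH[of "t (Suc j) y"]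
      by (simp add: cp_lt Y.cp_lt)
  qed (rule 0)
  show "cp n X s t i j x y \<Longrightarrow> cp n X' s' t' i j (f x) (f y)"
    using 1 2 by (cases "i \<le> j") auto
qed

lemma map_tower_tunit: "m \<le> n \<Longrightarrow> x \<in> X m \<Longrightarrow> map_tower f (tunit s m x) = tunit s' m (f x)"
  by (induction m arbitrary: x) (auto simp: f_s s_closed)

lemma legal_map:
  assumes "legal (s (Suc m)) (t (Suc m)) l st" "snd ` set l \<subseteq> X (Suc m)" "Suc m \<le> n"
  shows "legal (s' (Suc m)) (t' (Suc m)) (map (map_prod id f) l) (map f st) \<and>
    run (t' (Suc m)) (map (map_prod id f) l) (map f st) = map f (run (t (Suc m)) l st)"
  using assms
proof (induction l arbitrary: st)
  case (Cons a l)
  obtain p x where a: "a = (p, x)" by force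
  have "map f (st[p := t (Suc m) x]) = (map f st)[p := t' (Suc m) (f x)]"
    using Cons.prems a f_t by (auto simp: map_update)
  then show ?case using Cons.IH[of "st[p := t (Suc m) x]"] Cons.prems a f_s[of m x] by auto
qed simp

lemma valid_map_tower:
  "V E \<Longrightarrow> tdim E \<le> n \<Longrightarrow> Y.V (map_tower f E)"
proof (induction E)
  case (Lev E l)
  then show ?case using legal_map[of "tdim E" l "lbls E"] by (auto simp: f_closed image_subset_iff split_beta)
qed (simp add: f_closed)

lemma ttgt_map_tower:
  "V (Lev E l) \<Longrightarrow> tdim E < n \<Longrightarrow> Y.tt (map_tower f (Lev E l)) = map_tower f (tt (Lev E l))"
proof -
  assume a: "V (Lev E l)" "tdim E < n"
  \<comment> \<open>In dimension 0 \<open>relabel\<close> takes the head of the list, which commutes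
    with \<open>f\<close> only on a nonempty list; the state over a point has length one.\<close>
  have "0 < length (run (t (Suc (tdim E))) l (lbls E)) \<or> 0 < tdim E"
    by (cases E) simp_all
  then have "run (t (Suc (tdim E))) l (lbls E) \<noteq> [] \<or> 0 < tdim E"
    by (simp only: length_greater_0_conv)
  then show ?thesis using a legal_map[of "tdim E" l "lbls E"] by (simp add: map_tower_relabel)
qed

lemma globular_map_map_tower:
  "globular_map n TW (\<lambda>_. tsrc) (\<lambda>_. tt) Y.TW (\<lambda>_. tsrc) (\<lambda>_. Y.tt) (map_tower f)"
  unfolding globular_map_def
proof (intro conjI allI impI ballI)
  fix k E assume "k \<le> n" "E \<in> TW k"
  then show "map_tower f E \<in> Y.TW k" using valid_map_tower[of E] by (auto simp: towers_def)
next
  fix k E assume "k < n" "E \<in> TW (Suc k)"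
  then obtain E' l where E: "E = Lev E' l" "tdim E' = k" "V (Lev E' l)"
    by (auto simp: towers_def elim: tower_Lev_obtain)
  then show "map_tower f (tsrc E) = tsrc (map_tower f E)" "map_tower f (tt E) = Y.tt (map_tower f E)"
    using ttgt_map_tower[of E' l] \<open>k < n\<close> by auto
qed

end

section \<open>Evaluation in a sesquicategory\<close>

text \<open>\<open>whisk t c u E p k x\<close> is the \<open>k\<close>-cell \<open>x\<close>, sitting at position \<open>p\<close> of \<open>E\<close>, whiskered by the rest of \<open>E\<close>:
  the cells before and after position \<open>p\<close> act after all those of lower dimension have done so.\<close>
function (sequential) eval :: "(nat \<Rightarrow> 'a \<Rightarrow> 'a) \<Rightarrow> (nat \<Rightarrow> nat \<Rightarrow> 'a \<Rightarrow> 'a \<Rightarrow> 'a) \<Rightarrow> (nat \<Rightarrow> 'a \<Rightarrow> 'a) \<Rightarrow>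
    'a tower \<Rightarrow> 'a"
  and whisk :: "(nat \<Rightarrow> 'a \<Rightarrow> 'a) \<Rightarrow> (nat \<Rightarrow> nat \<Rightarrow> 'a \<Rightarrow> 'a \<Rightarrow> 'a) \<Rightarrow> (nat \<Rightarrow> 'a \<Rightarrow> 'a) \<Rightarrow>
    'a tower \<Rightarrow> nat \<Rightarrow> nat \<Rightarrow> 'a \<Rightarrow> 'a" where
  "eval t c u (Pt x) = x"
| "eval t c u (Lev E []) = u (Suc (tdim E)) (eval t c u E)"
| "eval t c u (Lev E ((p, x) # l)) = c (Suc (tdim E)) (Suc (tdim E))
    (eval t c u (Lev (ttgt t (Lev E [(p, x)])) l)) (whisk t c u E p (Suc (tdim E)) x)"
| "whisk t c u (Pt y) p k x = x"
| "whisk t c u (Lev E l) p k x = c (Suc (tdim E)) k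
    (eval t c u (Lev (ttgt t (Lev E (take (Suc p) l))) (drop (Suc p) l)))
    (c k (Suc (tdim E)) (whisk t c u (ttgt t (Lev E (take p l))) (fst (l ! p)) k x)
      (eval t c u (Lev E (take p l))))"
  by pat_completeness auto
termination
  \<comment> \<open>Whiskering evaluates the towers before and after the cell, which have the same
    dimension, so it ranks above evaluation in that dimension; evaluation calls whiskering only one
    dimension lower.\<close>
  by (relation "measures
      [\<lambda>z. case z of Inl (t, c, u, E) \<Rightarrow> tdim E | Inr (t, c, u, E, p, k, x) \<Rightarrow> tdim E,
       \<lambda>z. case z of Inl _ \<Rightarrow> 0 | Inr _ \<Rightarrow> 1,
       \<lambda>z. case z of Inl (t, c, u, E) \<Rightarrow> length (lbls E) | Inr _ \<Rightarrow> 0]") auto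

text \<open>The counterpart of \<open>graft_Lev\<close>, with \<open>tcomp\<close> replaced by the
  operation \<open>c\<close> and the sequences by their values.\<close>

lemma whisk_split:
  "whisk t c u (Lev E (l1 @ (q, y) # l2)) (length l1) k x = c (Suc (tdim E)) k
    (eval t c u (Lev (ttgt t (Lev E (l1 @ [(q, y)]))) l2))
    (c k (Suc (tdim E)) (whisk t c u (ttgt t (Lev E l1)) q k x) (eval t c u (Lev E l1)))"
  by (simp del: ttgt.simps)

declare whisk.simps(2) [simp del] eval.simps(3) [simp del]

section \<open>Evaluation respects boundaries\<close>

locale sesquicategory = globular_set +
  fixes c :: "nat \<Rightarrow> nat \<Rightarrow> 'a \<Rightarrow> 'a \<Rightarrow> 'a" and u :: "nat \<Rightarrow> 'a \<Rightarrow> 'a"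
  assumes sesqui: "sesqui n X s t c u"
begin

lemmas facts0 = sesqui[unfolded sesqui_def]
lemmas facts1 = facts0[THEN conjunct2]
lemmas facts2 = facts1[THEN conjunct2]
lemmas facts3 = facts2[THEN conjunct2]
lemmas facts4 = facts3[THEN conjunct2]
lemmas facts5 = facts4[THEN conjunct2]
lemmas facts6 = facts5[THEN conjunct2]
lemmas facts7 = facts6[THEN conjunct2]
lemmas facts8 = facts7[THEN conjunct2]
lemmas facts9 = facts8[THEN conjunct2]
lemmas facts10 = facts9[THEN conjunct2]
lemmas facts11 = facts10[THEN conjunct2]
lemmas facts12 = facts11[THEN conjunct2]
lemmas sesqui_facts = facts0[THEN conjunct1] facts1[THEN conjunct1] facts2[THEN conjunct1] facts3[THEN conjunct1]
    facts4[THEN conjunct1] facts5[THEN conjunct1] facts6[THEN conjunct1] facts7[THEN conjunct1]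
    facts8[THEN conjunct1] facts9[THEN conjunct1] facts10[THEN conjunct1] facts11[THEN conjunct1] facts12

lemma u_closed: "x \<in> X i \<Longrightarrow> Suc i \<le> n \<Longrightarrow> u (Suc i) x \<in> X (Suc i)"
  using sesqui_facts(2)[rule_format, of "Suc i" x] by simp

lemma s_u: "x \<in> X i \<Longrightarrow> Suc i \<le> n \<Longrightarrow> s (Suc i) (u (Suc i) x) = x"
  and t_u: "x \<in> X i \<Longrightarrow> Suc i \<le> n \<Longrightarrow> t (Suc i) (u (Suc i) x) = x"
  using sesqui_facts(6)[rule_format, of "Suc i" x] by simp_all

sublocale precategorical n X s t c
proof unfold_locales
  show "c i j x y \<in> X (max i j)" if "cp n X s t i j x y" for i j x y
    using sesqui_facts(1) that by simp
  show "s (Suc i) (c (Suc i) j x y) = c i j (s (Suc i) x) y \<and> t (Suc i) (c (Suc i) j x y) = c i j (t (Suc i) x) y"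
    if "cp n X s t (Suc i) j x y" "j \<le> i" for i j x y
    using sesqui_facts(3)[rule_format, of "Suc i" j x y] that by simp
  show "s (Suc j) (c i (Suc j) x y) = c i j x (s (Suc j) y) \<and> t (Suc j) (c i (Suc j) x y) = c i j x (t (Suc j) y)"
    if "cp n X s t i (Suc j) x y" "i \<le> j" for i j x y
    using sesqui_facts(4)[rule_format, of i "Suc j" x y] that by simp
  show "s i (c i i x y) = s i y \<and> t i (c i i x y) = t i x" if "cp n X s t i i x y" for i x y
    using sesqui_facts(5) that by simp
qed

lemma assoc:
  assumes "C i j x y" "C j k y z" "two_smallest_eq i j k"
  shows "c (max i j) k (c i j x y) z = c i (max j k) x (c j k y z)"
  using sesqui_facts(7)[rule_format, of i j x y k z] assms cp_assoc_left[OF assms] cp_assoc_right[OF assms]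
  by simp

lemma distrib_left:
  assumes "i < j" "i < k" "C j k y z" "C i j x y" "C i k x z"
  shows "c i (max j k) x (c j k y z) = c j k (c i j x y) (c i k x z)"
  using sesqui_facts(8)[rule_format, of i j k y z x] assms cp_distrib_left[OF assms]
  by (simp add: max_absorb2)

lemma distrib_right:
  assumes "k < i" "k < j" "C i j x y" "C i k x z" "C j k y z"
  shows "c (max i j) k (c i j x y) z = c i j (c i k x z) (c j k y z)"
  using sesqui_facts(9)[rule_format, of k i j x y z] assms cp_distrib_right[OF assms]
  by (simp add: max_absorb1)

lemma unit_left_absorb:
  assumes "x \<in> X i" "C (Suc i) j (u (Suc i) x) y" "i < j"
  shows "c (Suc i) j (u (Suc i) x) y = y"
  using sesqui_facts(10)[rule_format, of x "Suc i" j y] assms by simp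

lemma unit_left:
  assumes "x \<in> X i" "C (Suc i) j (u (Suc i) x) y" "j \<le> i"
  shows "c (Suc i) j (u (Suc i) x) y = u (Suc i) (c i j x y)"
  using sesqui_facts(11)[rule_format, of x "Suc i" j y] assms by simp

lemma unit_right_absorb:
  assumes "y \<in> X j" "C i (Suc j) x (u (Suc j) y)" "j < i"
  shows "c i (Suc j) x (u (Suc j) y) = x"
  using sesqui_facts(12)[rule_format, of y j i x] sesqui_facts(12)[rule_format, of y "Suc j" i x] assms by simp

lemma unit_right:
  assumes "y \<in> X j" "C i (Suc j) x (u (Suc j) y)" "i \<le> j"
  shows "c i (Suc j) x (u (Suc j) y) = u (Suc j) (c i j x y)"
  using sesqui_facts(13)[rule_format, of y "Suc j" i x] assms by simp

abbreviation "ev \<equiv> eval t c u"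
abbreviation "wh \<equiv> whisk t c u"

definition eval_ok :: "nat \<Rightarrow> bool" where
  "eval_ok m \<longleftrightarrow> (\<forall>E. V E \<longrightarrow> tdim E = m \<longrightarrow> ev E \<in> X m \<and>
     (0 < m \<longrightarrow> s m (ev E) = ev (tsrc E) \<and> t m (ev E) = ev (tt E)))"

text \<open>The companion of \<open>eval_ok\<close>: evaluating a level of dimension
  \<open>Suc m\<close> whiskers its moves by towers of dimension \<open>m\<close>. For
  \<open>k = Suc m\<close> a whiskered cell runs between values of towers; for larger
  \<open>k\<close> whiskering commutes with source and target.\<close>

definition whisk_ok :: "nat \<Rightarrow> bool" where
  "whisk_ok m \<longleftrightarrow> (\<forall>E p k x. V E \<longrightarrow> tdim E = m \<longrightarrow> p < length (lbls E) \<longrightarrow> m < k \<longrightarrow> k \<le> n \<longrightarrow>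
     anchored m (lbls E ! p) k x \<longrightarrow> wh E p k x \<in> X k \<and>
     (k = Suc m \<longrightarrow> s k (wh E p k x) = ev E \<and> t k (wh E p k x) = ev (tt (Lev E [(p, x)]))) \<and>
     (\<forall>k'. k = Suc k' \<longrightarrow> m < k' \<longrightarrow>
        s k (wh E p k x) = wh E p k' (s k x) \<and> t k (wh E p k x) = wh E p k' (t k x)))"

lemma eval_okD:
  assumes "eval_ok m" "V E" "tdim E = m"
  shows "ev E \<in> X m" "0 < m \<Longrightarrow> s m (ev E) = ev (tsrc E)" "0 < m \<Longrightarrow> t m (ev E) = ev (tt E)"
  using assms by (auto simp: eval_ok_def)

lemma eval_okD_Lev:
  assumes "eval_ok (Suc m)" "V (Lev E l)" "tdim E = m"
  shows "ev (Lev E l) \<in> X (Suc m)" "s (Suc m) (ev (Lev E l)) = ev E"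
    "t (Suc m) (ev (Lev E l)) = ev (tt (Lev E l))"
  using eval_okD[of "Suc m" "Lev E l"] assms by (auto simp del: valid.simps ttgt.simps)

lemma whisk_okD:
  assumes "whisk_ok m" "V E" "tdim E = m" "p < length (lbls E)" "m < k" "k \<le> n"
    "anchored m (lbls E ! p) k x"
  shows "wh E p k x \<in> X k"
    "k = Suc m \<Longrightarrow> s k (wh E p k x) = ev E"
    "k = Suc m \<Longrightarrow> t k (wh E p k x) = ev (tt (Lev E [(p, x)]))"
    "k = Suc k' \<Longrightarrow> m < k' \<Longrightarrow> s k (wh E p k x) = wh E p k' (s k x)"
    "k = Suc k' \<Longrightarrow> m < k' \<Longrightarrow> t k (wh E p k x) = wh E p k' (t k x)"
  using assms unfolding whisk_ok_def by blast+

lemma valid_Cons: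
  assumes "V (Lev E ((q, y) # l2))" "Suc (tdim E) \<le> n"
  shows "V (Lev E [(q, y)])" "V (Lev (tt (Lev E [(q, y)])) l2)"
  using valid_split[of E "[]" q y l2] assms by (auto simp del: valid.simps ttgt.simps)

lemma ttgt_Cons: "tt (Lev E (a # l)) = tt (Lev (tt (Lev E [a])) l)"
  using ttgt_append[of t E "[a]" l] by simp

section \<open>The inductive step from dimension \<open>m\<close> to \<open>Suc m\<close>\<close>

context
  fixes m assumes evm: "eval_ok m" and whm: "whisk_ok m" and mn: "Suc m \<le> n"
begin

lemma wh_step:
  assumes "V (Lev E [(p, x)])" "tdim E = m"
  shows "wh E p (Suc m) x \<in> X (Suc m)" "s (Suc m) (wh E p (Suc m) x) = ev E"
    "t (Suc m) (wh E p (Suc m) x) = ev (tt (Lev E [(p, x)]))"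
proof -
  have a: "anchored m (lbls E ! p) (Suc m) x" using assms mn s_closed[of x m] by (auto simp: anchored_Suc)
  have "V E" "p < length (lbls E)" using assms by auto
  note w = whisk_okD[OF whm this(1) assms(2) this(2) _ mn a]
  show "wh E p (Suc m) x \<in> X (Suc m)" "s (Suc m) (wh E p (Suc m) x) = ev E"
    "t (Suc m) (wh E p (Suc m) x) = ev (tt (Lev E [(p, x)]))" using w by (auto simp del: ttgt.simps)
qed

lemma eval_ok_Suc: "eval_ok (Suc m)"
proof -
  have "ev (Lev E l) \<in> X (Suc m) \<and> s (Suc m) (ev (Lev E l)) = ev E \<and> t (Suc m) (ev (Lev E l)) = ev (tt (Lev E l))"
    if "V (Lev E l)" "tdim E = m" for E l
    using that
  proof (induction l arbitrary: E)
    case Nil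
    then have "ev E \<in> X m" using eval_okD[OF evm] by auto
    then show ?case using Nil mn by (auto simp: u_closed s_u t_u)
  next
    case (Cons a l)
    obtain p x where a: "a = (p, x)" by force
    let ?E = "tt (Lev E [(p, x)])"
    have n: "Suc (tdim E) \<le> n" using Cons.prems mn by simp
    have v: "V (Lev E [(p, x)])" "V (Lev ?E l)" using valid_Cons[of E p x l] Cons.prems a n by auto
    have IH: "ev (Lev ?E l) \<in> X (Suc m)" "s (Suc m) (ev (Lev ?E l)) = ev ?E"
      "t (Suc m) (ev (Lev ?E l)) = ev (tt (Lev ?E l))"
      using Cons.IH[OF v(2)] Cons.prems(2) by auto
    note w = wh_step[OF v(1) Cons.prems(2)]
    have "C (Suc m) (Suc m) (ev (Lev ?E l)) (wh E p (Suc m) x)" using w IH mn by (simp add: cp_eq)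
    then show ?case using c_eq c_closed_lt w IH Cons.prems(2) unfolding a ttgt_Cons[of E "(p, x)" l]
      by (simp add: eval.simps(3) del: ttgt.simps)
  qed
  note Lev = this
  show ?thesis unfolding eval_ok_def
  proof (intro allI impI)
    fix E assume a: "V E" "tdim E = Suc m"
    then obtain E' l where E: "E = Lev E' l" "tdim E' = m" by (metis tower_Lev_obtain)
    show "ev E \<in> X (Suc m) \<and>
      (0 < Suc m \<longrightarrow> s (Suc m) (ev E) = ev (tsrc E) \<and> t (Suc m) (ev E) = ev (tt E))"
      using Lev[of E' l] a(1) E(2) unfolding E(1) by (simp del: valid.simps ttgt.simps)
  qed
qed

lemma cp_step_aux: "V (Lev E ((p, x) # l)) \<Longrightarrow> tdim E = m \<Longrightarrow>
  C (Suc m) (Suc m) (ev (Lev (tt (Lev E [(p, x)])) l)) (wh E p (Suc m) x)"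
  using valid_Cons[of E p x l] eval_okD_Lev[OF eval_ok_Suc, of "tt (Lev E [(p, x)])" l]
    wh_step[of E p x] mn
  by (simp add: cp_eq del: valid.simps ttgt.simps)

lemma cp_append: "V (Lev E (l1 @ l2)) \<Longrightarrow> tdim E = m \<Longrightarrow>
  C (Suc m) (Suc m) (ev (Lev (tt (Lev E l1)) l2)) (ev (Lev E l1))"
  using valid_append[of E l1 l2] eval_okD_Lev[OF eval_ok_Suc, of "tt (Lev E l1)" l2]
    eval_okD_Lev[OF eval_ok_Suc, of E l1] mn
  by (simp add: cp_eq del: valid.simps ttgt.simps)

text \<open>Evaluation composes the moves one by one; associativity regroups them at any place, and
  an empty prefix evaluates to an identity, which is absorbed on the right.\<close>

lemma eval_append_aux: "V (Lev E (l1 @ l2)) \<Longrightarrow> tdim E = m \<Longrightarrow>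
  ev (Lev E (l1 @ l2)) = c (Suc m) (Suc m) (ev (Lev (tt (Lev E l1)) l2)) (ev (Lev E l1))"
proof (induction l1 arbitrary: E)
  case Nil
  then have "ev E \<in> X m" using eval_okD[OF evm] by auto
  moreover have "C (Suc m) (Suc m) (ev (Lev E l2)) (u (Suc m) (ev E))"
    using cp_append[of E "[]" l2] Nil by (simp del: valid.simps)
  ultimately show ?case using unit_right_absorb Nil by (simp add: less_Suc_eq)
next
  case (Cons a l1)
  obtain p x where a: "a = (p, x)" by force
  let ?E = "tt (Lev E [(p, x)])"
  have n: "Suc (tdim E) \<le> n" using Cons.prems mn by simp
  have v: "V (Lev ?E (l1 @ l2))" "V (Lev E ((p, x) # l1))"
    using valid_Cons[of E p x "l1 @ l2"] valid_append[OF n, of "a # l1" l2] Cons.prems a n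
    by (auto simp del: valid.simps ttgt.simps)
  have d: "tdim ?E = m" using Cons.prems by simp
  have "ev (Lev E (a # l1 @ l2)) = c (Suc m) (Suc m) (ev (Lev ?E (l1 @ l2))) (wh E p (Suc m) x)"
    using Cons.prems a by (simp add: eval.simps(3) del: ttgt.simps)
  also have "\<dots> = c (Suc m) (Suc m) (c (Suc m) (Suc m) (ev (Lev (tt (Lev ?E l1)) l2)) (ev (Lev ?E l1)))
      (wh E p (Suc m) x)"
    by (simp only: Cons.IH[OF v(1) d])
  also have "\<dots> = c (Suc m) (Suc m) (ev (Lev (tt (Lev ?E l1)) l2))
      (c (Suc m) (Suc m) (ev (Lev ?E l1)) (wh E p (Suc m) x))"
    using assoc[OF cp_append[OF v(1) d] cp_step_aux[OF v(2) Cons.prems(2)]] by (simp add: two_smallest_eq_def)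
  also have "tt (Lev ?E l1) = tt (Lev E (a # l1))" unfolding a by (rule ttgt_Cons[symmetric])
  also have "c (Suc m) (Suc m) (ev (Lev ?E l1)) (wh E p (Suc m) x) = ev (Lev E (a # l1))"
    using Cons.prems a by (simp add: eval.simps(3) del: ttgt.simps)
  finally show ?case by simp
qed

text \<open>The analogue of \<open>cpT_graft\<close> for values: taking sources of \<open>x\<close>
  keeps the context fixed, so the claim reduces to \<open>k = Suc m\<close>, where the three pieces
  are consecutive.\<close>

lemma cp_split_aux:
  assumes "V (Lev E (l1 @ (q, y) # l2))" "tdim E = m" "Suc m \<le> k" "k \<le> n" "anchored (Suc m) y k x"
  shows "C k (Suc m) (wh (tt (Lev E l1)) q k x) (ev (Lev E l1))"
    "C (Suc m) k (ev (Lev (tt (Lev E (l1 @ [(q, y)]))) l2)) (wh (tt (Lev E l1)) q k x)"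
    "C (Suc m) k (ev (Lev (tt (Lev E (l1 @ [(q, y)]))) l2))
      (c k (Suc m) (wh (tt (Lev E l1)) q k x) (ev (Lev E l1)))"
proof -
  let ?E' = "tt (Lev E l1)" and ?E'' = "tt (Lev E (l1 @ [(q, y)]))"
  have n: "Suc (tdim E) \<le> n" using assms by simp
  note v = valid_split[OF assms(1) n]
  have d: "tdim ?E' = m" "tdim ?E'' = m" using assms(2) by simp_all
  have E': "V ?E'" "q < length (lbls ?E')" "lbls ?E' ! q = s (Suc m) y" "y \<in> X (Suc m)"
    using v(2) unfolding valid_step d(1) by auto
  have w: "k = Suc k' \<Longrightarrow> m < k' \<Longrightarrow> s k (wh ?E' q k x) = wh ?E' q k' (s k x)"
    "k = Suc k' \<Longrightarrow> m < k' \<Longrightarrow> t k (wh ?E' q k x) = wh ?E' q k' (t k x)"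
    if "Suc m \<le> k" "k \<le> n" "anchored (Suc m) y k x" for k k' x
    using whisk_okD(4,5)[OF whm E'(1) d(1) E'(2), of k x] anchored_base_s[of m k y x] that E' by auto
  have w1: "wh ?E' q k x \<in> X k" if "Suc m \<le> k" "k \<le> n" "anchored (Suc m) y k x" for k x
    using whisk_okD[OF whm E'(1) d(1) E'(2), of k x] anchored_base_s[of m k y x] that E' by auto
  show 1: "C k (Suc m) (wh ?E' q k x) (ev (Lev E l1))"
    using assms(3-5)
  proof (induction k arbitrary: x rule: dec_induct)
    case base
    then show ?case using wh_step[OF v(2) d(1)] eval_okD_Lev[OF eval_ok_Suc v(1) assms(2)] base mn
      by (simp add: cp_eq del: ttgt.simps valid.simps)
  next
    case (step k)
    then have "C k (Suc m) (wh ?E' q k (s (Suc k) x)) (ev (Lev E l1))" by (auto intro: anchored_s)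
    then show ?case using w[where k = "Suc k" and k' = k and x = x] w1[of "Suc k" x] step by (simp add: cp_gt del: ttgt.simps valid.simps)
  qed
  show 2: "C (Suc m) k (ev (Lev ?E'' l2)) (wh ?E' q k x)"
    using assms(3-5)
  proof (induction k arbitrary: x rule: dec_induct)
    case base
    then show ?case using wh_step[OF v(2) d(1)] eval_okD_Lev[OF eval_ok_Suc v(3) d(2)] base mn
      by (simp add: cp_eq ttgt_append[symmetric] del: ttgt.simps valid.simps)
  next
    case (step k)
    then have "C (Suc m) k (ev (Lev ?E'' l2)) (wh ?E' q k (s (Suc k) x))" by (auto intro: anchored_s)
    then show ?case using w[where k = "Suc k" and k' = k and x = x] w1[of "Suc k" x] step by (simp add: cp_lt_s del: ttgt.simps valid.simps)
  qed
  show "C (Suc m) k (ev (Lev ?E'' l2)) (c k (Suc m) (wh ?E' q k x) (ev (Lev E l1)))"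
    using cp_assoc_right[OF 2 1] assms(3) by (simp add: two_smallest_eq_def max_absorb1)
qed

text \<open>The right-hand side is that of \<open>whisk_split\<close> at \<open>k = Suc m\<close>
  and \<open>x = y\<close>. This is how the boundary of a whiskered cell is recognised as the value
  of a tower in \<open>whisk_ok_Suc\<close>.\<close>

lemma eval_split_aux:
  assumes "V (Lev E (l1 @ (q, y) # l2))" "tdim E = m"
  shows "ev (Lev E (l1 @ (q, y) # l2)) = c (Suc m) (Suc m) (ev (Lev (tt (Lev E (l1 @ [(q, y)]))) l2))
    (c (Suc m) (Suc m) (wh (tt (Lev E l1)) q (Suc m) y) (ev (Lev E l1)))"
proof -
  have n: "Suc (tdim E) \<le> n" using assms mn by simp
  note v = valid_split[OF assms(1) n]
  have y: "anchored (Suc m) y (Suc m) y" using v(2) assms(2) by auto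
  have "ev (Lev E (l1 @ (q, y) # l2)) =
    c (Suc m) (Suc m) (ev (Lev (tt (Lev E l1)) ((q, y) # l2))) (ev (Lev E l1))"
    by (rule eval_append_aux[OF assms])
  also have "ev (Lev (tt (Lev E l1)) ((q, y) # l2)) =
    c (Suc m) (Suc m) (ev (Lev (tt (Lev E (l1 @ [(q, y)]))) l2)) (wh (tt (Lev E l1)) q (Suc m) y)"
    using assms(2) by (simp add: eval.simps(3) ttgt_append[symmetric] del: ttgt.simps)
  finally show ?thesis
    using assoc[OF cp_split_aux(2)[OF assms _ mn y] cp_split_aux(1)[OF assms _ mn y]] by (simp add: two_smallest_eq_def del: ttgt.simps)
qed

lemma whisk_ok_Suc: "whisk_ok (Suc m)"
  unfolding whisk_ok_def
proof (intro allI impI)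
  fix E p k x
  assume a: "V E" "tdim E = Suc m" "p < length (lbls E)" "Suc m < k" "k \<le> n"
    "anchored (Suc m) (lbls E ! p) k x"
  then obtain E0 l where E: "E = Lev E0 l" "tdim E0 = m" by (metis tower_Lev_obtain)
  have "p < length l" using a E by simp
  then obtain l1 q y l2 where l: "l = l1 @ (q, y) # l2" and len: "p = length l1" using split_at by metis
  have "lbls E ! p = y" using E l len by (auto simp: nth_append)
  then have anch: "anchored (Suc m) y k x" using a by simp
  have vE: "V (Lev E0 (l1 @ (q, y) # l2))" using a E l by simp
  let ?E' = "tt (Lev E0 l1)" and ?E'' = "tt (Lev E0 (l1 @ [(q, y)]))"
  let ?A = "ev (Lev ?E'' l2)" and ?B = "ev (Lev E0 l1)"
  have n: "Suc (tdim E0) \<le> n" using E mn by simp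
  note v = valid_split[OF vE n]
  have d: "tdim ?E' = m" using E by simp
  have E': "V ?E'" "q < length (lbls ?E')" "lbls ?E' ! q = s (Suc m) y" "y \<in> X (Suc m)"
    using v(2) unfolding valid_step d(1) by auto
  have sp: "wh E p k x = c (Suc m) k ?A (c k (Suc m) (wh ?E' q k x) ?B)" for k x
    unfolding E(1) l len whisk_split E(2) ..
  note cps = cp_split_aux[OF vE E(2) _ a(5) anch]
  have cl: "wh E p k x \<in> X k" unfolding sp using cps(3) a by (intro c_closed_lt) auto
  obtain k' where k: "k = Suc k'" "Suc m \<le> k'" using a(4) by (cases k) auto
  have "wh ?E' q k x \<in> X k"
    "s k (wh ?E' q k x) = wh ?E' q k' (s k x)" "t k (wh ?E' q k x) = wh ?E' q k' (t k x)"
    using whisk_okD[OF whm E'(1) d(1) E'(2), of k x] anchored_base_s[of m k y x] anch a k E' by auto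
  \<comment> \<open>Both parts of the context have dimension \<open>Suc m\<close>, which is at most
    \<open>k'\<close>, so the boundary is taken in the middle factor only.\<close>
  then have b: "s k (wh E p k x) = c (Suc m) k' ?A (c k' (Suc m) (wh ?E' q k' (s k x)) ?B)"
     "t k (wh E p k x) = c (Suc m) k' ?A (c k' (Suc m) (wh ?E' q k' (t k x)) ?B)"
    using c_lt[of "Suc m" k'] c_gt[of k' "Suc m"] cps k unfolding sp k(1) by simp_all
  show "wh E p k x \<in> X k \<and>
     (k = Suc (Suc m) \<longrightarrow> s k (wh E p k x) = ev E \<and> t k (wh E p k x) = ev (tt (Lev E [(p, x)]))) \<and>
     (\<forall>k'. k = Suc k' \<longrightarrow> Suc m < k' \<longrightarrow>
        s k (wh E p k x) = wh E p k' (s k x) \<and> t k (wh E p k x) = wh E p k' (t k x))"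
  proof (intro conjI impI allI)
    show "s k (wh E p k x) = wh E p k'' (s k x)" "t k (wh E p k x) = wh E p k'' (t k x)"
      if "k = Suc k''" for k''
      using b that k unfolding sp by simp_all
  next
    assume k2: "k = Suc (Suc m)"
    then have k': "k' = Suc m" using k by simp
    have x: "s k x = y" "x \<in> X k" using anch k2 a(5) by (auto simp: anchored_Suc)
    show "s k (wh E p k x) = ev E" unfolding b(1) k' x(1) unfolding E(1) l
      by (rule eval_split_aux[OF vE E(2), symmetric])
    have vx: "V (Lev E [(p, x)])" using a x k2 \<open>lbls E ! p = y\<close> by simp
    have "tt (Lev E [(p, x)]) = Lev E0 (zip (map fst l) ((map snd l)[p := t k x]))"
      using E k2 by simp
    also have "zip (map fst l) ((map snd l)[p := t k x]) = l1 @ (q, t k x) # l2"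
      by (simp add: l len list_update_append zip_append zip_map_fst_snd)
    finally have eq: "tt (Lev E [(p, x)]) = Lev E0 (l1 @ (q, t k x) # l2)" .
    have vt: "V (Lev E0 (l1 @ (q, t k x) # l2))"
      using valid_tt_Lev(1)[OF vx] a k2 unfolding eq by simp
    \<comment> \<open>\<open>t k x\<close> and \<open>y = s k x\<close> have the same target, so
      after either move the remaining ones start from the same state.\<close>
    have "t (Suc m) (t k x) = t (Suc m) y" using ts_tt[of x m] x k2 a(5) by simp
    then have "tt (Lev E0 (l1 @ [(q, t k x)])) = ?E''" using E(2) by (simp add: run_append)
    then show "t k (wh E p k x) = ev (tt (Lev E [(p, x)]))"
      unfolding b k' eq eval_split_aux[OF vt E(2)] by simp
  qed (rule cl)
qed

end

lemma eval_whisk_ok: "m \<le> n \<Longrightarrow> eval_ok m \<and> (m < n \<longrightarrow> whisk_ok m)"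
proof (induction m)
  case 0
  have "eval_ok 0"
    unfolding eval_ok_def
  proof (intro allI impI)
    fix E assume "V E" "tdim E = 0"
    then show "ev E \<in> X 0 \<and> (0 < (0::nat) \<longrightarrow> s 0 (ev E) = ev (tsrc E) \<and> t 0 (ev E) = ev (tt E))"
      by (cases E) auto
  qed
  moreover have "whisk_ok 0"
    unfolding whisk_ok_def
  proof (intro allI impI)
    fix E p k x assume a: "V E" "tdim E = 0" "p < length (lbls E)" "0 < k" "k \<le> n" "anchored 0 (lbls E ! p) k x"
    then obtain y where "E = Pt y" "p = 0" by (cases E) auto
    then show "wh E p k x \<in> X k \<and>
     (k = Suc 0 \<longrightarrow> s k (wh E p k x) = ev E \<and> t k (wh E p k x) = ev (tt (Lev E [(p, x)]))) \<and>
     (\<forall>k'. k = Suc k' \<longrightarrow> 0 < k' \<longrightarrow>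
        s k (wh E p k x) = wh E p k' (s k x) \<and> t k (wh E p k x) = wh E p k' (t k x))"
      using a by (auto simp: anchored_def)
  qed
  ultimately show ?case by simp
next
  case (Suc m)
  then show ?case using eval_ok_Suc[of m] whisk_ok_Suc[of m] by auto
qed

lemma globular_map_eval: "globular_map n TW (\<lambda>_. tsrc) (\<lambda>_. tt) X s t ev"
  unfolding globular_map_def
proof (intro conjI allI impI ballI)
  fix k E assume "k \<le> n" "E \<in> TW k"
  then show "ev E \<in> X k" 
    using eval_okD(1)[OF conjunct1[OF eval_whisk_ok]] by (simp add: towers_def)
next
  fix k E assume "k < n" "E \<in> TW (Suc k)"
  then have "V E" "tdim E = Suc k" "Suc k \<le> n" by (auto simp: towers_def)
  then show "ev (tsrc E) = s (Suc k) (ev E)" "ev (tt E) = t (Suc k) (ev E)"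
    using eval_okD(2,3)[OF conjunct1[OF eval_whisk_ok], of "Suc k" E] by simp_all
qed

end

section \<open>Evaluation is a homomorphism\<close>

context sesquicategory
begin

interpretation T: globular_set n TW "\<lambda>_. tsrc" "\<lambda>_. tt"
  by (rule towers_globular_set)

interpretation T: precategorical n TW "\<lambda>_. tsrc" "\<lambda>_. tt" "\<lambda>_ _. tcomp"
  by (rule precategorical_towers)

interpretation ev: globular_morphism n TW "\<lambda>_. tsrc" "\<lambda>_. tt" X s t ev
  by unfold_locales (rule globular_map_eval)

interpretation flat: globular_morphism n T.TW "\<lambda>_. tsrc" "\<lambda>_. T.tt" TW "\<lambda>_. tsrc" "\<lambda>_. tt" tflat
  by (intro globular_morphism.intro globular_morphism_axioms.intro T.towers_globular_set
    towers_globular_set globular_map_tflat)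

interpretation mapev: globular_morphism n T.TW "\<lambda>_. tsrc" "\<lambda>_. T.tt" TW "\<lambda>_. tsrc" "\<lambda>_. tt" "map_tower ev"
  by (intro globular_morphism.intro globular_morphism_axioms.intro T.towers_globular_set
    towers_globular_set ev.globular_map_map_tower)

lemma ok:
  assumes "Suc m \<le> n"
  shows "eval_ok m" "whisk_ok m"
  using eval_whisk_ok[of m] assms by auto

lemmas eval_append = eval_append_aux[OF ok(1) ok(2)]
lemmas cp_split = cp_split_aux[OF ok(1) ok(2)]
lemmas cp_step = cp_step_aux[OF ok(1) ok(2)]

text \<open>The empty sequence left behind the move evaluates to an identity, which is absorbed on
  the left.\<close>

lemma eval_single:
  assumes "V (Lev E [(p, x)])" "Suc (tdim E) \<le> n"
  shows "ev (Lev E [(p, x)]) = wh E p (Suc (tdim E)) x"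
proof -
  let ?E' = "tt (Lev E [(p, x)])"
  have "V ?E'" using valid_tt_Lev(1)[OF assms] .
  then have "ev ?E' \<in> X (tdim E)" using eval_okD(1)[OF ok(1)[OF assms(2)]] by (simp only: tdim_ttgt_Lev)
  moreover have "C (Suc (tdim E)) (Suc (tdim E)) (u (Suc (tdim E)) (ev ?E')) (wh E p (Suc (tdim E)) x)"
    using cp_step[OF assms(2,2,2,1) refl] by (simp del: ttgt.simps valid.simps)
  ultimately have "c (Suc (tdim E)) (Suc (tdim E)) (u (Suc (tdim E)) (ev ?E')) (wh E p (Suc (tdim E)) x) =
      wh E p (Suc (tdim E)) x" by (rule unit_left_absorb) simp
  then show ?thesis by (simp add: eval.simps(3) del: ttgt.simps)
qed

text \<open>In a unit tower nothing stands before or after the cell, so the context consists of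
  identities on cells of dimension below \<open>k\<close>, and these are absorbed on both
  sides.\<close>

lemma whisk_tunit:
  "m < k \<Longrightarrow> k \<le> n \<Longrightarrow> anchored m y k x \<Longrightarrow> wh (tunit s m y) 0 k x = x"
proof (induction m arbitrary: y)
  case (Suc m)
  let ?T = "tunit s m (s (Suc m) y)"
  have y: "y \<in> X (Suc m)" using anchored_base_mem[of "Suc m" k y x] Suc.prems by simp
  have n: "Suc m \<le> n" using Suc.prems by simp
  have v: "V (Lev ?T ([] @ (0, y) # []))" using valid_tunit[OF y n] by simp
  have "anchored m (s (Suc m) y) k x" using anchored_base_s[of m k y x] Suc.prems by simp
  then have IH: "wh ?T 0 k x = x" using Suc by simp
  have d: "tdim ?T = m" by simp
  have T'': "tt (Lev ?T [(0, y)]) = tunit s m (t (Suc m) y)" using ttgt_tunit[OF y n] by simp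
  note cps = cp_split[OF n n n v d, of k x]
  have evX: "ev (tunit s m z) \<in> X m" if "z \<in> X m" for z
    using eval_okD(1)[OF ok(1)[OF n] valid_tunit] that n by simp
  have 1: "C k (Suc m) x (u (Suc m) (ev ?T))" using cps(1) Suc.prems IH by (simp del: ttgt.simps)
  have "C (Suc m) k (u (Suc m) (ev (tunit s m (t (Suc m) y)))) x"
    using cps(2) Suc.prems IH T'' by (simp del: ttgt.simps)
  then have "c (Suc m) k (u (Suc m) (ev (tunit s m (t (Suc m) y)))) x = x"
    using Suc.prems by (intro unit_left_absorb evX t_closed y n) auto
  moreover have "c k (Suc m) x (u (Suc m) (ev ?T)) = x"
    using Suc.prems by (intro unit_right_absorb 1 evX s_closed y n) auto
  ultimately show ?case
    using whisk_split[of t c u ?T "[]" 0 y "[]" k x] IH T'' by (simp del: ttgt.simps)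
qed simp

lemma eval_tunit: "m \<le> n \<Longrightarrow> x \<in> X m \<Longrightarrow> ev (tunit s m x) = x"
proof (cases m)
  case (Suc k)
  assume a: "m \<le> n" "x \<in> X m"
  then have "V (Lev (tunit s k (s (Suc k) x)) [(0, x)])" using valid_tunit[of x m] Suc by simp
  then show ?thesis using eval_single a Suc whisk_tunit[of k "Suc k" "s (Suc k) x" x] s_closed
    by (simp add: anchored_Suc)
qed simp

lemma whisk_mem:
  assumes "V E" "tdim E = m" "p < length (lbls E)" "m < k" "k \<le> n" "anchored m (lbls E ! p) k x"
  shows "wh E p k x \<in> X k"
    "k = Suc m \<Longrightarrow> s k (wh E p k x) = ev E"
    "k = Suc k' \<Longrightarrow> m < k' \<Longrightarrow> s k (wh E p k x) = wh E p k' (s k x)"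
proof -
  have "Suc m \<le> n" using assms by simp
  note w = whisk_okD[OF ok(2)[OF this] assms]
  show "wh E p k x \<in> X k" "k = Suc m \<Longrightarrow> s k (wh E p k x) = ev E"
    "k = Suc k' \<Longrightarrow> m < k' \<Longrightarrow> s k (wh E p k x) = wh E p k' (s k x)"
    by (fact w)+
qed

text \<open>The value of \<open>E\<close> is an iterated source of the whiskered cell, and
  composability with a cell of dimension at most \<open>m\<close> is decided there.\<close>

lemma cp_whisk_left:
  assumes "cpT m j E F" "j \<le> m" "p < length (lbls E)" "m < k" "k \<le> n" "anchored m (lbls E ! p) k x"
  shows "C k j (wh E p k x) (ev F)"
  using Suc_leI[OF assms(4)] assms(5,6)
proof (induction k arbitrary: x rule: dec_induct)
  case base
  have E: "V E" "tdim E = m" using cpT_dest[OF assms(1)] by auto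
  note w = whisk_mem[OF E assms(3) lessI base]
  show ?case
    using ev.cp_map[OF assms(1)] w(1) w(2)[OF refl] base(1) by (simp add: cp_gt[OF assms(2)])
next
  case (step k)
  have E: "V E" "tdim E = m" using cpT_dest[OF assms(1)] by auto
  have mk: "m < k" "m < Suc k" and jk: "j \<le> k" using step assms(2) by auto
  note w = whisk_mem[OF E assms(3) mk(2) step.prems]
  have "anchored m (lbls E ! p) k (s (Suc k) x)" using anchored_s[OF step.prems(2) _ step.prems(1)] mk by simp
  then have "C k j (wh E p k (s (Suc k) x)) (ev F)" using step.IH step.prems(1) by simp
  then show ?case using w(1) w(3)[OF refl mk(1)] step.prems(1) by (simp add: cp_gt[OF jk])
qed

lemma cp_whisk_right:
  assumes "cpT i m E F" "i \<le> m" "p < length (lbls F)" "m < k" "k \<le> n" "anchored m (lbls F ! p) k x"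
  shows "C i k (ev E) (wh F p k x)"
  using Suc_leI[OF assms(4)] assms(5,6)
proof (induction k arbitrary: x rule: dec_induct)
  case base
  have F: "V F" "tdim F = m" using cpT_dest[OF assms(1)] by auto
  note w = whisk_mem[OF F assms(3) lessI base]
  show ?case
    using ev.cp_map[OF assms(1)] w(1) w(2)[OF refl] base(1) by (simp add: cp_lt_s[OF assms(2)])
next
  case (step k)
  have F: "V F" "tdim F = m" using cpT_dest[OF assms(1)] by auto
  have mk: "m < k" "m < Suc k" and ik: "i \<le> k" using step assms(2) by auto
  note w = whisk_mem[OF F assms(3) mk(2) step.prems]
  have "anchored m (lbls F ! p) k (s (Suc k) x)" using anchored_s[OF step.prems(2) _ step.prems(1)] mk by simp
  then have "C i k (ev E) (wh F p k (s (Suc k) x))" using step.IH step.prems(1) by simp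
  then show ?case using w(1) w(3)[OF refl mk(1)] step.prems(1) by (simp add: cp_lt_s[OF ik])
qed

lemma eval_tcomp_eq:
  assumes "cpT (Suc m) (Suc m) E F"
  shows "ev (tcomp E F) = c (Suc m) (Suc m) (ev E) (ev F)"
proof -
  obtain E0 l where E: "E = Lev E0 l" "tdim E0 = m" using cpT_dest[OF assms] by (metis tower_Lev_obtain)
  obtain F0 k where F: "F = Lev F0 k" "tdim F0 = m" using cpT_dest[OF assms] by (metis tower_Lev_obtain)
  have a: "Suc m \<le> n" "V (Lev E0 l)" "V (Lev F0 k)" "E0 = tt (Lev F0 k)"
    using assms unfolding E F cpT_eq by auto
  have "V (Lev F0 (k @ l))" using a F by (subst valid_append) auto
  note ap = eval_append[OF a(1,1,1) this F(2)]
  have "tcomp E F = Lev F0 (k @ l)" using E F by (simp add: tcomp_eq)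
  then show ?thesis unfolding E(1) F(1) a(4) by (simp only: ap)
qed

text \<open>Induction on the dimension \<open>m\<close> of \<open>E\<close>, starting from that of
  \<open>F\<close>; evaluation and whiskering again need each other. For \<open>m = j\<close>
  associativity regroups the pieces. Above that, \<open>F\<close> has lower dimension than all
  pieces of \<open>E\<close>, and distributivity spreads it over them. The position changes only for
  \<open>m = j\<close>, where the labels of \<open>F\<close> come first.\<close>

lemma eval_whisk_tcomp_left:
  assumes "0 < tdim F" "tdim F = j" "j \<le> m" "m \<le> n"
  shows "(\<forall>E. cpT m j E F \<longrightarrow> ev (tcomp E F) = c m j (ev E) (ev F)) \<and>
    (\<forall>E p k x. cpT m j E F \<longrightarrow> p < length (lbls E) \<longrightarrow> m < k \<longrightarrow> k \<le> n \<longrightarrow> anchored m (lbls E ! p) k x \<longrightarrow>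
      wh (tcomp E F) (if m = j then length (lbls F) + p else p) k x = c k j (wh E p k x) (ev F))"
  using assms(3,4)
proof (induction m rule: dec_induct)
  case base
  obtain m where m: "j = Suc m" using assms by (cases j) auto
  obtain F0 f where F: "F = Lev F0 f" "tdim F0 = m" using assms m by (metis tower_Lev_obtain)
  show ?case
  proof (intro conjI allI impI)
    show "ev (tcomp E F) = c j j (ev E) (ev F)" if "cpT j j E F" for E
      using that eval_tcomp_eq m by auto
    fix E p k x
    assume a: "cpT j j E F" "p < length (lbls E)" "j < k" "k \<le> n" "anchored j (lbls E ! p) k x"
    obtain E0 l where E: "E = Lev E0 l" "tdim E0 = m" using cpT_dest[OF a(1)] m by (metis tower_Lev_obtain)
    have "p < length l" using a(2) unfolding E by simp
    then obtain l1 q y l2 where l: "l = l1 @ (q, y) # l2" "length l1 = p" by (rule split_at)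
    have b: "Suc m \<le> n" "V (Lev E0 l)" "V (Lev F0 f)" "E0 = tt (Lev F0 f)"
      using a(1) unfolding E F m cpT_eq by auto
    have "V (Lev F0 (f @ l))" using b F by (subst valid_append) auto
    have n: "Suc (tdim E0) \<le> n" using b E by simp
    note v = valid_split[OF b(2)[unfolded l] n]
    have anch: "anchored (Suc m) y k x" using a(5) l unfolding E m by (auto simp: nth_append)
    have d: "tdim E0 = m" using E by simp
    let ?A = "ev (Lev (tt (Lev E0 (l1 @ [(q, y)]))) l2)" and ?W = "wh (tt (Lev E0 l1)) q k x"
      and ?B = "ev (Lev E0 l1)"
    have W: "C k j ?W ?B" "C j k ?A ?W" "C j k ?A (c k j ?W ?B)"
      using cp_split[OF b(1,1,1) b(2)[unfolded l(1)] d _ a(4) anch] a(3) b(1) unfolding m by auto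
    have cpB: "cpT j j (Lev E0 l1) F" using b v(1) E F unfolding m by (simp add: cpT_eq del: ttgt.simps valid.simps)
    have B: "C j j ?B (ev F)" by (rule ev.cp_map[OF cpB])
    have evB: "ev (Lev F0 (f @ l1)) = c j j ?B (ev F)"
      using eval_tcomp_eq[of m "Lev E0 l1" F] cpB E F unfolding m by (simp add: tcomp_eq)
    \<comment> \<open>The moves of \<open>F\<close> join those performed before the cell; the moves
      behind it stay the same.\<close>
    have tc: "tcomp E F = Lev F0 ((f @ l1) @ (q, y) # l2)" using E F l by (simp add: tcomp_eq)
    have t1: "tt (Lev F0 (f @ l1)) = tt (Lev E0 l1)"
      "tt (Lev F0 ((f @ l1) @ [(q, y)])) = tt (Lev E0 (l1 @ [(q, y)]))"
      unfolding b(4) ttgt_append[symmetric] by simp_all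
    have "wh (tcomp E F) (length (f @ l1)) k x = c j k ?A (c k j ?W (c j j ?B (ev F)))"
      unfolding tc whisk_split t1 evB F(2) m ..
    also have "\<dots> = c j k ?A (c k j (c k j ?W ?B) (ev F))"
      using assoc[OF W(1) B] a(3) by (simp add: two_smallest_eq_def max_absorb1)
    also have "\<dots> = c k j (c j k ?A (c k j ?W ?B)) (ev F)"
      using assoc[OF W(3), of j "ev F"] cp_assoc_left[OF W(1) B] a(3)
      by (simp add: two_smallest_eq_def max_absorb1 max_absorb2)
    also have "c j k ?A (c k j ?W ?B) = wh E p k x"
      unfolding E(1) l(1) l(2)[symmetric] whisk_split d m ..
    finally show "wh (tcomp E F) (if j = j then length (lbls F) + p else p) k x = c k j (wh E p k x) (ev F)"
      using F l by simp
  qed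
next
  case (step m)
  let ?sh = "\<lambda>l :: (nat \<times> 'a) list. if m = j then shift (length (lbls F)) l else l"
  let ?sp = "\<lambda>p. if m = j then length (lbls F) + p else p"
  have IH1: "ev (tcomp E F) = c m j (ev E) (ev F)" if "cpT m j E F" for E
    using step that by simp
  have IH2: "wh (tcomp E F) (?sp p) k x = c k j (wh E p k x) (ev F)"
    if "cpT m j E F" "p < length (lbls E)" "m < k" "k \<le> n" "anchored m (lbls E ! p) k x" for E p k x
    using step that by simp
  have n: "Suc m \<le> n" using step by simp
  have jm: "j \<le> m" using step by simp
  have tc: "tcomp (Lev E l) F = Lev (tcomp E F) (?sh l)" if "tdim E = m" for E l
    using tcomp_gt[of F E l] assms step that by simp
  have ttc: "tt (Lev (tcomp E F) (?sh l)) = tcomp (tt (Lev E l)) F" if "tdim E = m" "cpT (Suc m) j (Lev E l) F" for E l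
    using ttgt_tcomp_gt[OF that(2) jm] tc[OF that(1), of l] by (simp only:)
  have dtc: "tdim (tcomp E F) = m" if "tdim E = m" for E
    using tdim_tcomp[of E F] assms(1,2) jm that by simp
  have ev1: "ev (tcomp (Lev E l) F) = c (Suc m) j (ev (Lev E l)) (ev F)"
    if "cpT (Suc m) j (Lev E l) F" "tdim E = m" for E l
    using that
  proof (induction l arbitrary: E)
    case Nil
    then have cp: "cpT m j E F" using cpT_gt[OF jm] by blast
    have "ev E \<in> X m" using cpT_dest[OF cp] eval_okD(1)[OF ok(1)[OF n]] by blast
    moreover have "C (Suc m) j (u (Suc m) (ev E)) (ev F)" using ev.cp_map[OF Nil(1)] Nil(2) by simp
    ultimately have "c (Suc m) j (u (Suc m) (ev E)) (ev F) = u (Suc m) (c m j (ev E) (ev F))"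
      using jm by (rule unit_left)
    then show ?case using IH1[OF cp] tc[OF Nil(2)] dtc[OF Nil(2)] Nil(2) by simp
  next
    case (Cons a l)
    obtain p x where a: "a = (p, x)" by force
    let ?E = "tt (Lev E [(p, x)])"
    have vE: "V (Lev E ((p, x) # l))" and cp0: "cpT m j E F" using Cons.prems cpT_gt[OF jm] a by auto
    have nE: "Suc (tdim E) \<le> n" using n Cons.prems by simp
    note v = valid_Cons[OF vE nE]
    have cp1: "cpT (Suc m) j (Lev E [(p, x)]) F" using v cp0 n by (simp only: cpT_gt[OF jm])
    then have "cpT m j ?E F" using cpT_gt_t[OF jm] by blast
    then have cp2: "cpT (Suc m) j (Lev ?E l) F" using v n by (simp only: cpT_gt[OF jm])
    have d: "tdim ?E = m" using Cons.prems by simp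
    note IH = Cons.IH[OF cp2 d]
    have px: "p < length (lbls E)" "lbls E ! p = s (Suc m) x" "x \<in> X (Suc m)"
      using v(1) Cons.prems(2) unfolding valid_step by auto
    have anch: "anchored m (lbls E ! p) (Suc m) x" using px n s_closed by (simp add: anchored_Suc)
    let ?W = "wh E p (Suc m) x" and ?A = "ev (Lev ?E l)"
    have w: "wh (tcomp E F) (?sp p) (Suc m) x = c (Suc m) j ?W (ev F)"
      using IH2[OF cp0 px(1) _ n anch] by simp
    have sh: "?sh (a # l) = (?sp p, x) # ?sh l" "?sh [(p, x)] = [(?sp p, x)]" using a by auto
    have "ev (tcomp (Lev E (a # l)) F) = c (Suc m) (Suc m) (ev (Lev (tt (Lev (tcomp E F) [(?sp p, x)])) (?sh l)))
        (wh (tcomp E F) (?sp p) (Suc m) x)"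
      unfolding tc[OF Cons.prems(2)] sh eval.simps(3) dtc[OF Cons.prems(2)] ..
    also have "tt (Lev (tcomp E F) [(?sp p, x)]) = tcomp ?E F"
      using ttc[OF Cons.prems(2) cp1] unfolding sh .
    also have "Lev (tcomp ?E F) (?sh l) = tcomp (Lev ?E l) F" using tc[OF d] by simp
    also have "c (Suc m) (Suc m) (ev (tcomp (Lev ?E l) F)) (wh (tcomp E F) (?sp p) (Suc m) x) =
        c (Suc m) (Suc m) (c (Suc m) j ?A (ev F)) (c (Suc m) j ?W (ev F))"
      unfolding IH w ..
    also have "\<dots> = c (Suc m) j (c (Suc m) (Suc m) ?A ?W) (ev F)"
      using distrib_right[of j "Suc m" "Suc m" ?A ?W "ev F"] cp_step[OF n n n vE Cons.prems(2)]
        ev.cp_map[OF cp2] cp_whisk_left[OF cp0 jm px(1) _ n anch] jm by simp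
    also have "c (Suc m) (Suc m) ?A ?W = ev (Lev E (a # l))"
      unfolding a eval.simps(3) Cons.prems(2) ..
    finally show ?case .
  qed
  show ?case
  proof (intro conjI allI impI)
    show "ev (tcomp E F) = c (Suc m) j (ev E) (ev F)" if "cpT (Suc m) j E F" for E
      using ev1 that cpT_dest[OF that] by (metis tower_Lev_obtain)
    fix E p k x
    assume a: "cpT (Suc m) j E F" "p < length (lbls E)" "Suc m < k" "k \<le> n" "anchored (Suc m) (lbls E ! p) k x"
    obtain E0 l where E: "E = Lev E0 l" "tdim E0 = m" using cpT_dest[OF a(1)] by (metis tower_Lev_obtain)
    have "p < length l" using a(2) unfolding E by simp
    then obtain l1 q y l2 where l: "l = l1 @ (q, y) # l2" "length l1 = p" by (rule split_at)
    have b: "V (Lev E0 l)" and cp0: "cpT m j E0 F" using a(1) unfolding E(1) cpT_gt[OF jm] by auto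
    have nE: "Suc (tdim E0) \<le> n" using n E by simp
    note v = valid_split[OF b[unfolded l] nE]
    have anch: "anchored (Suc m) y k x" using a(5) l unfolding E by (auto simp: nth_append)
    let ?E' = "tt (Lev E0 l1)" and ?E'' = "tt (Lev E0 (l1 @ [(q, y)]))"
    have d: "tdim ?E' = m" "tdim ?E'' = m" using E by simp_all
    let ?A = "ev (Lev ?E'' l2)" and ?W = "wh ?E' q k x" and ?B = "ev (Lev E0 l1)"
    have W: "C k (Suc m) ?W ?B" "C (Suc m) k ?A ?W" "C (Suc m) k ?A (c k (Suc m) ?W ?B)"
      using cp_split[OF n n n b[unfolded l(1)] E(2) _ a(4) anch] a(3) by auto
    have cpB: "cpT (Suc m) j (Lev E0 l1) F" and cpB': "cpT (Suc m) j (Lev E0 (l1 @ [(q, y)])) F"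
      using v cp0 n by (simp_all only: cpT_gt[OF jm] simp_thms)
    then have cpE': "cpT m j ?E' F" and "cpT m j ?E'' F" using cpT_gt_t[OF jm] by blast+
    then have cpA: "cpT (Suc m) j (Lev ?E'' l2) F" using v n by (simp_all only: cpT_gt[OF jm] simp_thms)
    have E': "V ?E'" "q < length (lbls ?E')" "lbls ?E' ! q = s (Suc m) y" "y \<in> X (Suc m)"
      using v(2) unfolding valid_step d(1) by auto
    have anch': "anchored m (lbls ?E' ! q) k x" using anchored_base_s[of m k y x] a anch E' by simp
    have mk: "m < k" using a by simp
    note w = IH2[OF cpE' E'(2) mk a(4) anch']
    have CW: "C k j ?W (ev F)" by (rule cp_whisk_left[OF cpE' jm E'(2) mk a(4) anch'])
    have sh: "?sh l = ?sh l1 @ (?sp q, y) # ?sh l2" "?sh (l1 @ [(q, y)]) = ?sh l1 @ [(?sp q, y)]"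
      using l by auto
    have len: "p = length (?sh l1)" using l by simp
    have "wh (tcomp E F) p k x = c (Suc m) k (ev (Lev (tt (Lev (tcomp E0 F) (?sh l1 @ [(?sp q, y)]))) (?sh l2)))
        (c k (Suc m) (wh (tt (Lev (tcomp E0 F) (?sh l1))) (?sp q) k x) (ev (Lev (tcomp E0 F) (?sh l1))))"
      unfolding E(1) tc[OF E(2)] sh(1) unfolding len whisk_split dtc[OF E(2)] ..
    also have "\<dots> = c (Suc m) k (ev (tcomp (Lev ?E'' l2) F))
        (c k (Suc m) (wh (tcomp ?E' F) (?sp q) k x) (ev (tcomp (Lev E0 l1) F)))"
      using ttc[OF E(2) cpB] ttc[OF E(2) cpB'] tc[OF E(2), of l1] tc[OF d(2), of l2]
      unfolding sh(2) by (simp only:)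
    also have "\<dots> = c (Suc m) k (c (Suc m) j ?A (ev F)) (c k (Suc m) (c k j ?W (ev F)) (c (Suc m) j ?B (ev F)))"
      unfolding ev1[OF cpA d(2)] ev1[OF cpB E(2)] w ..
    also have "c k (Suc m) (c k j ?W (ev F)) (c (Suc m) j ?B (ev F)) = c k j (c k (Suc m) ?W ?B) (ev F)"
      using distrib_right[of j k "Suc m" ?W ?B "ev F"] W CW ev.cp_map[OF cpB] jm a by simp
    also have "c (Suc m) k (c (Suc m) j ?A (ev F)) (c k j (c k (Suc m) ?W ?B) (ev F)) =
        c k j (c (Suc m) k ?A (c k (Suc m) ?W ?B)) (ev F)"
      using distrib_right[of j "Suc m" k ?A "c k (Suc m) ?W ?B" "ev F"] W CW ev.cp_map[OF cpB] ev.cp_map[OF cpA] jm a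
        cp_distrib_right[of j k "Suc m" ?W ?B "ev F"] by simp
    also have "c (Suc m) k ?A (c k (Suc m) ?W ?B) = wh E p k x"
      unfolding E(1) l(1) l(2)[symmetric] whisk_split E(2) ..
    finally show "wh (tcomp E F) (if Suc m = j then length (lbls F) + p else p) k x = c k j (wh E p k x) (ev F)"
      using jm by simp
  qed
qed

text \<open>The mirror image, with distributivity on the other side. Positions in \<open>F\<close>
  do not move, as its labels come first in the composite.\<close>

lemma eval_whisk_tcomp_right:
  assumes "0 < tdim E" "tdim E = i" "i \<le> m" "m \<le> n"
  shows "(\<forall>F. cpT i m E F \<longrightarrow> ev (tcomp E F) = c i m (ev E) (ev F)) \<and>
    (\<forall>F p k x. cpT i m E F \<longrightarrow> p < length (lbls F) \<longrightarrow> m < k \<longrightarrow> k \<le> n \<longrightarrow> anchored m (lbls F ! p) k x \<longrightarrow>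
      wh (tcomp E F) p k x = c i k (ev E) (wh F p k x))"
  using assms(3,4)
proof (induction m rule: dec_induct)
  case base
  obtain m where m: "i = Suc m" using assms by (cases i) auto
  obtain E0 e where E: "E = Lev E0 e" "tdim E0 = m" using assms m by (metis tower_Lev_obtain)
  show ?case
  proof (intro conjI allI impI)
    show "ev (tcomp E F) = c i i (ev E) (ev F)" if "cpT i i E F" for F
      using that eval_tcomp_eq m by auto
    fix F p k x
    assume a: "cpT i i E F" "p < length (lbls F)" "i < k" "k \<le> n" "anchored i (lbls F ! p) k x"
    obtain F0 l where F: "F = Lev F0 l" "tdim F0 = m" using cpT_dest[OF a(1)] m by (metis tower_Lev_obtain)
    have "p < length l" using a(2) unfolding F by simp
    then obtain l1 q y l2 where l: "l = l1 @ (q, y) # l2" "length l1 = p" by (rule split_at)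
    have b: "Suc m \<le> n" "V (Lev E0 e)" "V (Lev F0 l)" "E0 = tt (Lev F0 l)"
      using a(1) unfolding E F m cpT_eq by auto
    have n: "Suc (tdim F0) \<le> n" using b F by simp
    note v = valid_split[OF b(3)[unfolded l] n]
    have anch: "anchored (Suc m) y k x" using a(5) l unfolding F m by (auto simp: nth_append)
    let ?F'' = "tt (Lev F0 (l1 @ [(q, y)]))"
    let ?A = "ev (Lev ?F'' l2)" and ?W = "wh (tt (Lev F0 l1)) q k x" and ?B = "ev (Lev F0 l1)"
    have W: "C k i ?W ?B" "C i k ?A ?W" "C i k ?A (c k i ?W ?B)"
      using cp_split[OF b(1,1,1) b(3)[unfolded l(1)] F(2) _ a(4) anch] a(3) b(1) unfolding m by auto
    have t1: "tt (Lev ?F'' l2) = E0" unfolding b(4) l ttgt_append[symmetric] by simp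
    have cpA: "cpT i i E (Lev ?F'' l2)" using b v(3) E F t1 unfolding m
      by (simp add: cpT_eq del: ttgt.simps valid.simps)
    have A: "C i i (ev E) ?A" by (rule ev.cp_map[OF cpA])
    have evA: "ev (Lev ?F'' (l2 @ e)) = c i i (ev E) ?A"
    proof -
      have "tcomp E (Lev ?F'' l2) = Lev ?F'' (l2 @ e)"
        unfolding E(1) by (rule tcomp_eq) (simp add: E(2) F(2))
      then show ?thesis using eval_tcomp_eq[of m E "Lev ?F'' l2"] cpA unfolding m by simp
    qed
    have tc: "tcomp E F = Lev F0 (l1 @ (q, y) # (l2 @ e))" using E F l by (simp add: tcomp_eq)
    have "wh (tcomp E F) (length l1) k x = c i k (c i i (ev E) ?A) (c k i ?W ?B)"
      unfolding tc whisk_split evA F(2) m ..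
    also have "\<dots> = c i k (ev E) (c i k ?A (c k i ?W ?B))"
      using assoc[OF A W(3)] a(3) by (simp add: two_smallest_eq_def max_absorb2)
    also have "c i k ?A (c k i ?W ?B) = wh F p k x"
      unfolding F(1) l(1) l(2)[symmetric] whisk_split F(2) m ..
    finally show "wh (tcomp E F) p k x = c i k (ev E) (wh F p k x)" using l by simp
  qed
next
  case (step m)
  have IH1: "ev (tcomp E F) = c i m (ev E) (ev F)" if "cpT i m E F" for F
    using step that by simp
  have IH2: "wh (tcomp E F) p k x = c i k (ev E) (wh F p k x)"
    if "cpT i m E F" "p < length (lbls F)" "m < k" "k \<le> n" "anchored m (lbls F ! p) k x" for F p k x
    using step that by simp
  have n: "Suc m \<le> n" using step by simp
  have im: "i \<le> m" using step by simp
  have tc: "tcomp E (Lev F l) = Lev (tcomp E F) l" if "tdim F = m" for F l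
    using tcomp_lt[of E F l] assms step that by simp
  have ttc: "tt (Lev (tcomp E F) l) = tcomp E (tt (Lev F l))" if "tdim F = m" "cpT i (Suc m) E (Lev F l)" for F l
    using ttgt_tcomp_lt[OF that(2) im] tc[OF that(1), of l] by (simp only:)
  have dtc: "tdim (tcomp E F) = m" if "tdim F = m" for F
    using tdim_tcomp[of E F] assms(1,2) im that by simp
  have ev1: "ev (tcomp E (Lev F l)) = c i (Suc m) (ev E) (ev (Lev F l))"
    if "cpT i (Suc m) E (Lev F l)" "tdim F = m" for F l
    using that
  proof (induction l arbitrary: F)
    case Nil
    then have cp: "cpT i m E F" using cpT_lt_s[OF im] by blast
    have "ev F \<in> X m" using cpT_dest[OF cp] eval_okD(1)[OF ok(1)[OF n]] by blast
    moreover have "C i (Suc m) (ev E) (u (Suc m) (ev F))" using ev.cp_map[OF Nil(1)] Nil(2) by simp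
    ultimately have "c i (Suc m) (ev E) (u (Suc m) (ev F)) = u (Suc m) (c i m (ev E) (ev F))"
      using im by (rule unit_right)
    then show ?case using IH1[OF cp] tc[OF Nil(2)] dtc[OF Nil(2)] Nil(2) by simp
  next
    case (Cons a l)
    obtain p x where a: "a = (p, x)" by force
    let ?F = "tt (Lev F [(p, x)])"
    have vF: "V (Lev F ((p, x) # l))" and cp0: "cpT i m E F" using Cons.prems cpT_lt_s[OF im] a by auto
    have nF: "Suc (tdim F) \<le> n" using n Cons.prems by simp
    note v = valid_Cons[OF vF nF]
    have cp1: "cpT i (Suc m) E (Lev F [(p, x)])" using v cp0 n by (simp only: cpT_lt_s[OF im])
    then have "cpT i m E ?F" using cpT_lt[OF im] by blast
    then have cp2: "cpT i (Suc m) E (Lev ?F l)" using v n by (simp only: cpT_lt_s[OF im])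
    have d: "tdim ?F = m" using Cons.prems by simp
    note IH = Cons.IH[OF cp2 d]
    have px: "p < length (lbls F)" "lbls F ! p = s (Suc m) x" "x \<in> X (Suc m)"
      using v(1) Cons.prems(2) unfolding valid_step by auto
    have anch: "anchored m (lbls F ! p) (Suc m) x" using px n s_closed by (simp add: anchored_Suc)
    let ?W = "wh F p (Suc m) x" and ?A = "ev (Lev ?F l)"
    have w: "wh (tcomp E F) p (Suc m) x = c i (Suc m) (ev E) ?W"
      using IH2[OF cp0 px(1) _ n anch] by simp
    have "ev (tcomp E (Lev F (a # l))) = c (Suc m) (Suc m) (ev (Lev (tt (Lev (tcomp E F) [(p, x)])) l))
        (wh (tcomp E F) p (Suc m) x)"
      unfolding tc[OF Cons.prems(2)] a eval.simps(3) dtc[OF Cons.prems(2)] ..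
    also have "tt (Lev (tcomp E F) [(p, x)]) = tcomp E ?F"
      by (rule ttc[OF Cons.prems(2) cp1])
    also have "Lev (tcomp E ?F) l = tcomp E (Lev ?F l)" using tc[OF d] by simp
    also have "c (Suc m) (Suc m) (ev (tcomp E (Lev ?F l))) (wh (tcomp E F) p (Suc m) x) =
        c (Suc m) (Suc m) (c i (Suc m) (ev E) ?A) (c i (Suc m) (ev E) ?W)"
      unfolding IH w ..
    also have "\<dots> = c i (Suc m) (ev E) (c (Suc m) (Suc m) ?A ?W)"
      using distrib_left[of i "Suc m" "Suc m" ?A ?W "ev E"] cp_step[OF n n n vF Cons.prems(2)]
        ev.cp_map[OF cp2] cp_whisk_right[OF cp0 im px(1) _ n anch] im by simp
    also have "c (Suc m) (Suc m) ?A ?W = ev (Lev F (a # l))"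
      unfolding a eval.simps(3) Cons.prems(2) ..
    finally show ?case .
  qed
  show ?case
  proof (intro conjI allI impI)
    show "ev (tcomp E F) = c i (Suc m) (ev E) (ev F)" if "cpT i (Suc m) E F" for F
      using ev1 that cpT_dest[OF that] by (metis tower_Lev_obtain)
    fix F p k x
    assume a: "cpT i (Suc m) E F" "p < length (lbls F)" "Suc m < k" "k \<le> n" "anchored (Suc m) (lbls F ! p) k x"
    obtain F0 l where F: "F = Lev F0 l" "tdim F0 = m" using cpT_dest[OF a(1)] by (metis tower_Lev_obtain)
    have "p < length l" using a(2) unfolding F by simp
    then obtain l1 q y l2 where l: "l = l1 @ (q, y) # l2" "length l1 = p" by (rule split_at)
    have b: "V (Lev F0 l)" and cp0: "cpT i m E F0" using a(1) unfolding F(1) cpT_lt_s[OF im] by auto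
    have nF: "Suc (tdim F0) \<le> n" using n F by simp
    note v = valid_split[OF b[unfolded l] nF]
    have anch: "anchored (Suc m) y k x" using a(5) l unfolding F by (auto simp: nth_append)
    let ?F' = "tt (Lev F0 l1)" and ?F'' = "tt (Lev F0 (l1 @ [(q, y)]))"
    have d: "tdim ?F' = m" "tdim ?F'' = m" using F by simp_all
    let ?A = "ev (Lev ?F'' l2)" and ?W = "wh ?F' q k x" and ?B = "ev (Lev F0 l1)"
    have W: "C k (Suc m) ?W ?B" "C (Suc m) k ?A ?W" "C (Suc m) k ?A (c k (Suc m) ?W ?B)"
      using cp_split[OF n n n b[unfolded l(1)] F(2) _ a(4) anch] a(3) by auto
    have cpB: "cpT i (Suc m) E (Lev F0 l1)" and cpB': "cpT i (Suc m) E (Lev F0 (l1 @ [(q, y)]))"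
      using v cp0 n by (simp_all only: cpT_lt_s[OF im] simp_thms)
    then have cpF': "cpT i m E ?F'" and "cpT i m E ?F''" using cpT_lt[OF im] by blast+
    then have cpA: "cpT i (Suc m) E (Lev ?F'' l2)" using v n by (simp_all only: cpT_lt_s[OF im] simp_thms)
    have F': "V ?F'" "q < length (lbls ?F')" "lbls ?F' ! q = s (Suc m) y" "y \<in> X (Suc m)"
      using v(2) unfolding valid_step d(1) by auto
    have anch': "anchored m (lbls ?F' ! q) k x" using anchored_base_s[of m k y x] a anch F' by simp
    have mk: "m < k" using a by simp
    note w = IH2[OF cpF' F'(2) mk a(4) anch']
    have CW: "C i k (ev E) ?W" by (rule cp_whisk_right[OF cpF' im F'(2) mk a(4) anch'])
    have "wh (tcomp E F) p k x = c (Suc m) k (ev (Lev (tt (Lev (tcomp E F0) (l1 @ [(q, y)]))) l2))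
        (c k (Suc m) (wh (tt (Lev (tcomp E F0) l1)) q k x) (ev (Lev (tcomp E F0) l1)))"
      unfolding F(1) tc[OF F(2)] l(1) unfolding l(2)[symmetric] whisk_split dtc[OF F(2)] ..
    also have "\<dots> = c (Suc m) k (ev (tcomp E (Lev ?F'' l2)))
        (c k (Suc m) (wh (tcomp E ?F') q k x) (ev (tcomp E (Lev F0 l1))))"
      using ttc[OF F(2) cpB] ttc[OF F(2) cpB'] tc[OF F(2), of l1] tc[OF d(2), of l2]
      by (simp only:)
    also have "\<dots> = c (Suc m) k (c i (Suc m) (ev E) ?A) (c k (Suc m) (c i k (ev E) ?W) (c i (Suc m) (ev E) ?B))"
      unfolding ev1[OF cpA d(2)] ev1[OF cpB F(2)] w ..
    also have "c k (Suc m) (c i k (ev E) ?W) (c i (Suc m) (ev E) ?B) = c i k (ev E) (c k (Suc m) ?W ?B)"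
      using distrib_left[of i k "Suc m" ?W ?B "ev E"] W CW ev.cp_map[OF cpB] im a by simp
    also have "c (Suc m) k (c i (Suc m) (ev E) ?A) (c i k (ev E) (c k (Suc m) ?W ?B)) =
        c i k (ev E) (c (Suc m) k ?A (c k (Suc m) ?W ?B))"
      using distrib_left[of i "Suc m" k ?A "c k (Suc m) ?W ?B" "ev E"] W CW ev.cp_map[OF cpB] ev.cp_map[OF cpA] im a
        cp_distrib_left[of i k "Suc m" ?W ?B "ev E"] by simp
    also have "c (Suc m) k ?A (c k (Suc m) ?W ?B) = wh F p k x"
      unfolding F(1) l(1) l(2)[symmetric] whisk_split F(2) ..
    finally show "wh (tcomp E F) p k x = c i k (ev E) (wh F p k x)" .
  qed
qed

theorem eval_tcomp: "cpT i j E F \<Longrightarrow> ev (tcomp E F) = c i j (ev E) (ev F)"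
  using eval_whisk_tcomp_left[of F j i] eval_whisk_tcomp_right[of E i j] cpT_dest[of i j E F]
  by (cases "j \<le> i") auto

theorem eval_tflat:
  assumes "T.V W" "tdim W \<le> n"
  shows "ev (tflat W) = ev (map_tower ev W)"
  using assms
proof (induction W rule: T.tower_induct)
  case (tunit m E)
  then have "ev E \<in> X m" using ev.f_closed by blast
  then show ?case
    using tunit tflat_tunit[OF tunit(2)] ev.map_tower_tunit[OF tunit] eval_tunit by simp
next
  case (unit W)
  then show ?case using tdim_tflat by simp
next
  case (tcomp i j W W')
  have d: "tdim W = i" "tdim W' = j" using T.cpT_dest[OF tcomp(1)] by auto
  have "ev (tflat (tcomp W W')) = c i j (ev (tflat W)) (ev (tflat W'))"
    using tflat_tcomp[of W W'] tcomp(1) d eval_tcomp[OF flat.cp_map[OF tcomp(1)]] by simp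
  also have "\<dots> = ev (tcomp (map_tower ev W) (map_tower ev W'))"
    using tcomp eval_tcomp[OF mapev.cp_map[OF tcomp(1)]] by simp
  finally show ?case by (simp add: map_tower_tcomp)
qed

end

section \<open>Algebras on towers\<close>

text \<open>The laws of \<open>T_algebra\<close> with labelled diagrams read as towers:
  \<open>tunit\<close> is the unit, \<open>tflat\<close> the multiplication and
  \<open>map_tower\<close> the action on maps.\<close>

locale tower_algebra = globular_set +
  fixes \<alpha> :: "'a tower \<Rightarrow> 'a"
  assumes \<alpha>_globular: "globular_map n TW (\<lambda>_. tsrc) (\<lambda>_. tt) X s t \<alpha>"
    and \<alpha>_tunit: "m \<le> n \<Longrightarrow> x \<in> X m \<Longrightarrow> \<alpha> (tunit s m x) = x"
    and \<alpha>_tflat: "valid TW (\<lambda>_. tsrc) (\<lambda>_. tt) W \<Longrightarrow> tdim W \<le> n \<Longrightarrow> \<alpha> (tflat W) = \<alpha> (map_tower \<alpha> W)"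
begin

interpretation T: globular_set n TW "\<lambda>_. tsrc" "\<lambda>_. tt"
  by (rule towers_globular_set)

interpretation T: precategorical n TW "\<lambda>_. tsrc" "\<lambda>_. tt" "\<lambda>_ _. tcomp"
  by (rule precategorical_towers)

interpretation \<alpha>: globular_morphism n TW "\<lambda>_. tsrc" "\<lambda>_. tt" X s t \<alpha>
  by unfold_locales (rule \<alpha>_globular)

text \<open>The multiplication law is applied to the composite of the unit towers on
  \<open>E\<close> and \<open>F\<close>. Flattening it gives \<open>tcomp E F\<close>; applying
  \<open>\<alpha>\<close> to the labels gives the composite of the unit towers on the
  values.\<close>

lemma \<alpha>_tcomp:
  assumes "cpT i j E F"
  shows "\<alpha> (tcomp E F) = \<alpha> (tcomp (tunit s i (\<alpha> E)) (tunit s j (\<alpha> F)))"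
proof -
  let ?W = "tcomp (tunit (\<lambda>_. tsrc) i E) (tunit (\<lambda>_. tsrc) j F)"
  have EF: "E \<in> TW i" "F \<in> TW j" "i \<le> n" "j \<le> n" "0 < i" "0 < j"
    using cpT_dest[OF assms] by (auto simp: towers_def)
  have cp: "T.cpT i j (tunit (\<lambda>_. tsrc) i E) (tunit (\<lambda>_. tsrc) j F)" by (rule T.cpT_tunit[OF assms])
  then have "T.V ?W" using T.valid_tcomp by simp
  moreover have "tdim ?W \<le> n" using EF by simp
  ultimately have "\<alpha> (tflat ?W) = \<alpha> (map_tower \<alpha> ?W)" by (rule \<alpha>_tflat)
  moreover have "tflat ?W = tcomp E F" using tflat_tcomp[of "tunit (\<lambda>_. tsrc) i E" "tunit (\<lambda>_. tsrc) j F"] cp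
    by (simp add: tflat_tunit EF)
  moreover have "map_tower \<alpha> ?W = tcomp (tunit s i (\<alpha> E)) (tunit s j (\<alpha> F))"
    by (simp add: map_tower_tcomp \<alpha>.map_tower_tunit EF)
  ultimately show ?thesis by simp
qed

lemma \<alpha>_degenerate:
  assumes "E \<in> TW m" "m < n"
  shows "\<alpha> (Lev E []) = \<alpha> (Lev (tunit s m (\<alpha> E)) [])"
proof -
  let ?W = "Lev (tunit (\<lambda>_. tsrc) m E) []"
  have "T.V ?W" "tdim ?W \<le> n" using T.valid_tunit[of E m] assms by auto
  then have "\<alpha> (tflat ?W) = \<alpha> (map_tower \<alpha> ?W)" by (rule \<alpha>_tflat)
  then show ?thesis using assms by (simp add: tflat_tunit \<alpha>.map_tower_tunit)
qed

lemma \<alpha>_closed: "cpT i j E F \<Longrightarrow> \<alpha> (tcomp E F) \<in> X (max i j)"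
  using T.c_closed[of i j E F] \<alpha>.f_closed[of "max i j"] cpT_dest[of i j E F] by auto

lemma \<alpha>_s: "E \<in> TW (Suc k) \<Longrightarrow> Suc k \<le> n \<Longrightarrow> s (Suc k) (\<alpha> E) = \<alpha> (tsrc E)"
  and \<alpha>_t: "E \<in> TW (Suc k) \<Longrightarrow> Suc k \<le> n \<Longrightarrow> t (Suc k) (\<alpha> E) = \<alpha> (tt E)"
  using \<alpha>.f_s \<alpha>.f_t by auto

lemma degenerate_mem: "x \<in> X i \<Longrightarrow> Suc i \<le> n \<Longrightarrow> Lev (tunit s i x) [] \<in> TW (Suc i)"
  using valid_tunit by (simp add: towers_def)

lemma degenerate_bounds:
  assumes "x \<in> X i" "Suc i \<le> n"
  shows "\<alpha> (Lev (tunit s i x) []) \<in> X (Suc i)" "s (Suc i) (\<alpha> (Lev (tunit s i x) [])) = x" "t (Suc i) (\<alpha> (Lev (tunit s i x) [])) = x"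
  using \<alpha>.f_closed[OF assms(2) degenerate_mem[OF assms]] \<alpha>_s[OF degenerate_mem[OF assms] assms(2)]
    \<alpha>_t[OF degenerate_mem[OF assms] assms(2)] \<alpha>_tunit[of i x] assms
  by (simp_all del: ttgt.simps)

text \<open>The value of the degenerate tower has source and target \<open>x\<close>, matching the
  boundary \<open>tunit s i x\<close> of the tower itself, so composability of cells lifts to
  towers.\<close>

lemma cpT_degenerate_left:
  assumes "x \<in> X i" "cp n X s t (Suc i) j (\<alpha> (Lev (tunit s i x) [])) y"
  shows "cpT (Suc i) j (Lev (tunit s i x) []) (tunit s j y)"
proof -
  have n: "Suc i \<le> n" using cp_dest[OF assms(2)] by simp
  have V: "V (Lev (tunit s i x) [])" using degenerate_mem[OF assms(1) n] by (simp add: towers_def)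
  show ?thesis
  proof (cases "j \<le> i")
    case True
    then have "cp n X s t i j x y" using assms(2) cp_gt[OF True] degenerate_bounds[OF assms(1) n] by simp
    then show ?thesis using cpT_tunit[of i j x y] V n by (simp add: cpT_gt[OF True])
  next
    case False
    then have "Suc i \<le> j" by simp
    then show ?thesis using assms(2)
    proof (induction j arbitrary: y rule: dec_induct)
      case base
      then have "x = t (Suc i) y" "y \<in> X (Suc i)"
        using degenerate_bounds[OF assms(1) n] by (simp_all add: cp_eq)
      then show ?case using V n valid_tunit[of y "Suc i"] ttgt_tunit[of y i] by (simp add: cpT_eq)
    next
      case (step j)
      then show ?case using valid_tunit[of y "Suc j"] by (simp add: cp_lt_s cpT_lt_s)
    qed
  qed
qed

lemma cpT_degenerate_right:
  assumes "x \<in> X i" "cp n X s t j (Suc i) y (\<alpha> (Lev (tunit s i x) []))"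
  shows "cpT j (Suc i) (tunit s j y) (Lev (tunit s i x) [])"
proof -
  have n: "Suc i \<le> n" using cp_dest[OF assms(2)] by simp
  have V: "V (Lev (tunit s i x) [])" using degenerate_mem[OF assms(1) n] by (simp add: towers_def)
  show ?thesis
  proof (cases "j \<le> i")
    case True
    then have "cp n X s t j i y x" using assms(2) cp_lt[OF True] degenerate_bounds[OF assms(1) n] by simp
    then show ?thesis using cpT_tunit[of j i y x] V n by (simp add: cpT_lt_s[OF True])
  next
    case False
    then have "Suc i \<le> j" by simp
    then show ?thesis using assms(2)
    proof (induction j arbitrary: y rule: dec_induct)
      case base
      then have "s (Suc i) y = x" "y \<in> X (Suc i)"
        using degenerate_bounds[OF assms(1) n] by (simp_all add: cp_eq)
      then show ?case using V n valid_tunit[of y "Suc i"] by (simp add: cpT_eq del: ttgt.simps)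
    next
      case (step j)
      then show ?case using valid_tunit[of y "Suc j"] by (simp add: cp_gt cpT_gt)
    qed
  qed
qed

text \<open>Unlike absorption on the left this uses composability: a composite takes its base from
  the right factor, and it is \<open>cpT\<close> that identifies this base with the one in
  \<open>E\<close>.\<close>

lemma tcomp_unit_right_absorb:
  "cpT (tdim E) (Suc (tdim F)) E (Lev F []) \<Longrightarrow> tdim F < tdim E \<Longrightarrow> tcomp E (Lev F []) = E"
proof (induction E)
  case (Lev E l)
  show ?case
  proof (cases "tdim E = tdim F")
    case True
    then show ?thesis using Lev.prems by (simp add: cpT_eq tcomp_eq)
  next
    case False
    then have "cpT (tdim E) (Suc (tdim F)) E (Lev F [])" "Suc (tdim F) \<le> tdim E"
      using Lev.prems by (auto simp: cpT_gt)
    then show ?thesis using Lev.IH by (simp add: tcomp_gt)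
  qed
qed simp

text \<open>Cells are the values of their unit towers, and \<open>\<alpha>\<close> turns
  \<open>tcomp\<close> into \<open>c\<close> and empty levels into \<open>u\<close>, so each
  equation is the image of one between towers. As \<open>c\<close> and \<open>u\<close> are known
  only on their domains, composability of the towers is established before each use.\<close>

lemma sesqui_of_tower_algebra:
  assumes c: "\<And>i j x y. cp n X s t i j x y \<Longrightarrow> c i j x y = \<alpha> (tcomp (tunit s i x) (tunit s j y))"
    and u: "\<And>i x. x \<in> X i \<Longrightarrow> Suc i \<le> n \<Longrightarrow> u (Suc i) x = \<alpha> (Lev (tunit s i x) [])"
  shows "sesqui n X s t c u"
proof -
  let ?U = "tunit s"
  have U: "\<alpha> (?U i x) = x" "\<alpha> (?U j y) = y" if "cp n X s t i j x y" for i j x y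
    using cp_dest[OF that] \<alpha>_tunit by simp_all
  have d: "0 < i" "0 < j" "i \<le> n" "j \<le> n" "x \<in> X i" "y \<in> X j" if "cp n X s t i j x y" for i j x y
    using cp_dest[OF that] by auto
  have cT: "c i j (\<alpha> E) (\<alpha> F) = \<alpha> (tcomp E F)" if "cpT i j E F" for i j E F
    using c[OF \<alpha>.cp_map[OF that]] \<alpha>_tcomp[OF that] by simp
  have uT: "u (Suc i) (\<alpha> E) = \<alpha> (Lev E [])" if "E \<in> TW i" "i < n" for i E
    using u[of "\<alpha> E" i] \<alpha>.f_closed[of i E] \<alpha>_degenerate[OF that] that by simp
  show ?thesis unfolding sesqui_def
  proof (intro conjI allI impI; (elim conjE)?)
    fix i j x y assume a: "cp n X s t i j x y"
    then show "c i j x y \<in> X (max i j)" using \<alpha>_closed[OF cpT_tunit[OF a]] by (simp add: c)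
  next
    fix i x assume "i \<in> {1..n}" "x \<in> X (i - 1)"
    then show "u i x \<in> X i" "s i (u i x) = x" "t i (u i x) = x"
      using degenerate_bounds[of x "i - 1"] u[of x "i - 1"] by auto
  next
    fix i j x y assume a: "cp n X s t i j x y" "j < i"
    then obtain i' where i: "i = Suc i'" "j \<le> i'" by (cases i) auto
    have cp: "cpT (Suc i') j (?U (Suc i') x) (?U j y)" using cpT_tunit[OF a(1)] i by simp
    have "tcomp (?U (Suc i') x) (?U j y) \<in> TW (Suc i')" using T.c_closed[OF cp] i by simp
    then have "s (Suc i') (c (Suc i') j x y) = \<alpha> (tsrc (tcomp (?U (Suc i') x) (?U j y)))"
      "t (Suc i') (c (Suc i') j x y) = \<alpha> (tt (tcomp (?U (Suc i') x) (?U j y)))"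
      using \<alpha>_s \<alpha>_t d[OF a(1)] i a by (simp_all add: c)
    then show "s i (c i j x y) = c (i - 1) j (s i x) y" "t i (c i j x y) = c (i - 1) j (t i x) y"
      using T.c_gt[OF cp i(2)] ttgt_tunit[of x i'] d[OF a(1)] i cp_gt[OF i(2), of x y] cp_gt_t[OF i(2), of x y] a
      by (simp_all add: c)
  next
    fix i j x y assume a: "cp n X s t i j x y" "i < j"
    then obtain j' where j: "j = Suc j'" "i \<le> j'" by (cases j) auto
    have cp: "cpT i (Suc j') (?U i x) (?U (Suc j') y)" using cpT_tunit[OF a(1)] j by simp
    have "tcomp (?U i x) (?U (Suc j') y) \<in> TW (Suc j')" using T.c_closed[OF cp] j by (simp add: max_absorb2)
    then have "s (Suc j') (c i (Suc j') x y) = \<alpha> (tsrc (tcomp (?U i x) (?U (Suc j') y)))"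
      "t (Suc j') (c i (Suc j') x y) = \<alpha> (tt (tcomp (?U i x) (?U (Suc j') y)))"
      using \<alpha>_s \<alpha>_t d[OF a(1)] j a by (simp_all add: c)
    then show "s j (c i j x y) = c i (j - 1) x (s j y)" "t j (c i j x y) = c i (j - 1) x (t j y)"
      using T.c_lt[OF cp j(2)] ttgt_tunit[of y j'] d[OF a(1)] j cp_lt[OF j(2), of x y] cp_lt_s[OF j(2), of x y] a
      by (simp_all add: c)
  next
    fix i x y assume a: "cp n X s t i i x y"
    then obtain i' where i: "i = Suc i'" using d[OF a] by (cases i) auto
    have cp: "cpT (Suc i') (Suc i') (?U (Suc i') x) (?U (Suc i') y)" using cpT_tunit[OF a] i by simp
    have "tcomp (?U (Suc i') x) (?U (Suc i') y) \<in> TW (Suc i')" using T.c_closed[OF cp] by simp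
    then have "s (Suc i') (c (Suc i') (Suc i') x y) = \<alpha> (tsrc (tcomp (?U (Suc i') x) (?U (Suc i') y)))"
      "t (Suc i') (c (Suc i') (Suc i') x y) = \<alpha> (tt (tcomp (?U (Suc i') x) (?U (Suc i') y)))"
      using \<alpha>_s \<alpha>_t d[OF a] i a by (simp_all add: c)
    then show "s i (c i i x y) = s i y" "t i (c i i x y) = t i x"
      using T.c_eq[OF cp] ttgt_tunit[of x i'] d[OF a] i s_closed t_closed by (simp_all add: \<alpha>_tunit)
  next
    fix i j k x y z assume a: "cp n X s t i j x y" "cp n X s t j k y z" "two_smallest_eq i j k"
    note cps = cpT_tunit[OF a(1)] cpT_tunit[OF a(2)]
    have "c (max i j) k (c i j x y) z = \<alpha> (tcomp (tcomp (?U i x) (?U j y)) (?U k z))"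
      using cT[OF T.cp_assoc_left[OF cps a(3)]] U[OF a(2)] by (simp add: c[OF a(1)])
    also have "\<dots> = \<alpha> (tcomp (?U i x) (tcomp (?U j y) (?U k z)))"
      using tcomp_assoc[of "?U i x" "?U j y" "?U k z"] a(3) d[OF a(1)] d[OF a(2)] by simp
    also have "\<dots> = c i (max j k) x (c j k y z)"
      using cT[OF T.cp_assoc_right[OF cps a(3)]] U[OF a(1)] by (simp add: c[OF a(2)])
    finally show "c (max i j) k (c i j x y) z = c i (max j k) x (c j k y z)" .
  next
    fix i j k x y z
    assume a: "i < j" "i < k" "cp n X s t j k y z" "cp n X s t i j x y" "cp n X s t i k x z"
    note cps = T.cp_distrib_left[OF a(1,2) cpT_tunit[OF a(3)] cpT_tunit[OF a(4)] cpT_tunit[OF a(5)]]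
    have "c i (max j k) x (c j k y z) = \<alpha> (tcomp (?U i x) (tcomp (?U j y) (?U k z)))"
      using cT[OF conjunct1[OF cps]] U[OF a(4)] by (simp add: c[OF a(3)])
    also have "\<dots> = \<alpha> (tcomp (tcomp (?U i x) (?U j y)) (tcomp (?U i x) (?U k z)))"
      using tcomp_distrib_left[of "?U i x" "?U j y" "?U k z"] a d[OF a(4)] by simp
    also have "\<dots> = c j k (c i j x y) (c i k x z)"
      using cT[OF conjunct2[OF cps]] by (simp add: c[OF a(4)] c[OF a(5)])
    finally show "c i (max j k) x (c j k y z) = c (max i j) (max i k) (c i j x y) (c i k x z)"
      using a by (simp add: max_absorb2)
  next
    fix i j k x y z
    assume a: "k < i" "k < j" "cp n X s t i j x y" "cp n X s t i k x z" "cp n X s t j k y z"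
    note cps = T.cp_distrib_right[OF a(1,2) cpT_tunit[OF a(3)] cpT_tunit[OF a(4)] cpT_tunit[OF a(5)]]
    have "c (max i j) k (c i j x y) z = \<alpha> (tcomp (tcomp (?U i x) (?U j y)) (?U k z))"
      using cT[OF conjunct1[OF cps]] U[OF a(4)] by (simp add: c[OF a(3)])
    also have "\<dots> = \<alpha> (tcomp (tcomp (?U i x) (?U k z)) (tcomp (?U j y) (?U k z)))"
      using tcomp_distrib_right[of "?U k z" "?U i x" "?U j y"] a d[OF a(4)] by simp
    also have "\<dots> = c i j (c i k x z) (c j k y z)"
      using cT[OF conjunct2[OF cps]] by (simp add: c[OF a(4)] c[OF a(5)])
    finally show "c (max i j) k (c i j x y) z = c (max i k) (max j k) (c i k x z) (c j k y z)"
      using a by (simp add: max_absorb1)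
  next
    fix i j x y assume a: "x \<in> X (i - 1)" "cp n X s t i j (u i x) y" "i - 1 < j"
    then obtain i' where i: "i = Suc i'" "i' < j" using d[OF a(2)] by (cases i) auto
    have ux: "u i x = \<alpha> (Lev (?U i' x) [])" using u[of x i'] a d[OF a(2)] i by simp
    have cp: "cpT (Suc i') j (Lev (?U i' x) []) (?U j y)" using cpT_degenerate_left a i ux by simp
    then show "c i j (u i x) y = y"
      using cT[OF cp] U(2)[OF a(2)] i tcomp_unit_left_absorb[of "?U i' x" "?U j y"] ux by simp
  next
    fix i j x y assume a: "x \<in> X (i - 1)" "cp n X s t i j (u i x) y" "j \<le> i - 1"
    then obtain i' where i: "i = Suc i'" "j \<le> i'" using d[OF a(2)] by (cases i) auto
    have ux: "u i x = \<alpha> (Lev (?U i' x) [])" using u[of x i'] a d[OF a(2)] i by simp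
    have cp: "cpT (Suc i') j (Lev (?U i' x) []) (?U j y)" using cpT_degenerate_left a i ux by simp
    then have cp': "cpT i' j (?U i' x) (?U j y)" by (simp add: cpT_gt[OF i(2)])
    have "c i j (u i x) y = \<alpha> (tcomp (Lev (?U i' x) []) (?U j y))"
      using cT[OF cp] U(2)[OF a(2)] i ux by simp
    also have "\<dots> = \<alpha> (Lev (tcomp (?U i' x) (?U j y)) [])"
      using tcomp_unit_left[of "?U j y" "?U i' x"] d[OF a(2)] i by simp
    also have "\<dots> = u (Suc i') (\<alpha> (tcomp (?U i' x) (?U j y)))"
      using T.c_closed[OF cp'] d[OF a(2)] i by (intro uT[symmetric]) auto
    also have "\<alpha> (tcomp (?U i' x) (?U j y)) = c i' j x y"
      using cT[OF cp'] U(2)[OF a(2)] \<alpha>_tunit[of i' x] a(1) d[OF a(2)] i by simp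
    finally show "c i j (u i x) y = u i (c (i - 1) j x y)" using i by simp
  next
    fix i j x y assume a: "y \<in> X (j - 1)" "cp n X s t i j x (u j y)" "j - 1 < i"
    then obtain j' where j: "j = Suc j'" "j' < i" using d[OF a(2)] by (cases j) auto
    have uy: "u j y = \<alpha> (Lev (?U j' y) [])" using u[of y j'] a d[OF a(2)] j by simp
    have cp: "cpT i (Suc j') (?U i x) (Lev (?U j' y) [])" using cpT_degenerate_right a j uy by simp
    then show "c i j x (u j y) = x"
      using cT[OF cp] U(1)[OF a(2)] j tcomp_unit_right_absorb[of "?U i x" "?U j' y"] uy by simp
  next
    fix i j x y assume a: "y \<in> X (j - 1)" "cp n X s t i j x (u j y)" "i \<le> j - 1"
    then obtain j' where j: "j = Suc j'" "i \<le> j'" using d[OF a(2)] by (cases j) auto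
    have uy: "u j y = \<alpha> (Lev (?U j' y) [])" using u[of y j'] a d[OF a(2)] j by simp
    have cp: "cpT i (Suc j') (?U i x) (Lev (?U j' y) [])" using cpT_degenerate_right a j uy by simp
    then have cp': "cpT i j' (?U i x) (?U j' y)" by (simp add: cpT_lt_s[OF j(2)])
    have "c i j x (u j y) = \<alpha> (tcomp (?U i x) (Lev (?U j' y) []))"
      using cT[OF cp] U(1)[OF a(2)] j uy by simp
    also have "\<dots> = \<alpha> (Lev (tcomp (?U i x) (?U j' y)) [])"
      using tcomp_unit_right[of "?U i x" "?U j' y"] d[OF a(2)] j by simp
    also have "\<dots> = u (Suc j') (\<alpha> (tcomp (?U i x) (?U j' y)))"
      using T.c_closed[OF cp'] d[OF a(2)] j by (intro uT[symmetric]) (auto simp: max_absorb2)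
    also have "\<alpha> (tcomp (?U i x) (?U j' y)) = c i j' x y"
      using cT[OF cp'] U(1)[OF a(2)] \<alpha>_tunit[of j' y] a(1) d[OF a(2)] j by simp
    finally show "c i j x (u j y) = u j (c i (j - 1) x y)" using j by simp
  qed
qed

end

text \<open>The value at \<open>tcomp E F\<close> is determined by the values at \<open>E\<close>
  and \<open>F\<close>, and likewise for an empty level, so agreement on cells propagates along
  \<open>tower_induct\<close>.\<close>

lemma tower_algebra_unique:
  assumes "tower_algebra n X s t \<alpha>" "tower_algebra n X s t \<beta>"
    and comp: "\<And>i j x y. cp n X s t i j x y \<Longrightarrow>
      \<alpha> (tcomp (tunit s i x) (tunit s j y)) = \<beta> (tcomp (tunit s i x) (tunit s j y))"
    and unit: "\<And>i x. x \<in> X i \<Longrightarrow> Suc i \<le> n \<Longrightarrow> \<alpha> (Lev (tunit s i x) []) = \<beta> (Lev (tunit s i x) [])"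
    and "valid X s t E" "tdim E \<le> n"
  shows "\<alpha> E = \<beta> E"
proof -
  interpret a: tower_algebra n X s t \<alpha> by fact
  interpret b: tower_algebra n X s t \<beta> by fact
  interpret am: globular_morphism n a.TW "\<lambda>_. tsrc" "\<lambda>_. a.tt" X s t \<alpha>
    by (intro globular_morphism.intro globular_morphism_axioms.intro a.towers_globular_set
        a.globular_set_axioms a.\<alpha>_globular)
  show ?thesis using assms(5,6)
  proof (induction E rule: a.tower_induct)
    case (tunit m x)
    then show ?case using a.\<alpha>_tunit b.\<alpha>_tunit by simp
  next
    case (unit E)
    then have E: "E \<in> a.TW (tdim E)" by (simp add: towers_def)
    then have "\<alpha> E \<in> X (tdim E)" using unit by (intro am.f_closed) auto
    then show ?case using a.\<alpha>_degenerate[OF E] b.\<alpha>_degenerate[OF E] unit assms(4)[of "\<alpha> E" "tdim E"] by simp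
  next
    case (tcomp i j E F)
    then show ?case using a.\<alpha>_tcomp[OF tcomp(1)] b.\<alpha>_tcomp[OF tcomp(1)] comp[OF am.cp_map[OF tcomp(1)]]
      by simp
  qed
qed

theorem (in sesquicategory) tower_algebra_eval: "tower_algebra n X s t ev"
  by unfold_locales (simp_all add: globular_map_eval eval_tunit eval_tflat)

section \<open>Labelled diagrams as towers\<close>

text \<open>The positions are the values of the map of the diagram, in the order of its domain.
  \<open>Tgt\<close> cells are dropped, since their labels are targets of labels of
  \<open>Orig\<close> cells.\<close>

primrec tower_upto :: "nat list list \<Rightarrow> (hcell \<Rightarrow> 'a) \<Rightarrow> nat \<Rightarrow> 'a tower" where
  "tower_upto D \<phi> 0 = Pt (\<phi> (Orig 0 0))"
| "tower_upto D \<phi> (Suc m) =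
    Lev (tower_upto D \<phi> m) (map (\<lambda>a. (par D (Suc m) a, \<phi> (Orig (Suc m) a))) [0..<ell D (Suc m)])"

definition tower_of :: "'a lab \<Rightarrow> 'a tower" where
  "tower_of w = tower_upto (fst w) (snd w) (length (fst w))"

primrec shape :: "'a tower \<Rightarrow> nat list list" where
  "shape (Pt x) = []"
| "shape (Lev E l) = shape E @ [map fst l]"

primrec lbls_at :: "'a tower \<Rightarrow> nat \<Rightarrow> 'a list" where
  "lbls_at (Pt x) j = [x]"
| "lbls_at (Lev E l) j = (if j = Suc (tdim E) then map snd l else lbls_at E j)"

definition lab_of :: "(nat \<Rightarrow> 'a \<Rightarrow> 'a) \<Rightarrow> 'a tower \<Rightarrow> 'a lab" where
  "lab_of t E = (shape E, \<lambda>c. if c \<in> allcells (shape E)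
     then (case c of Orig j a \<Rightarrow> lbls_at E j ! a | Tgt j b \<Rightarrow> t (Suc j) (lbls_at E (Suc j) ! b))
     else undefined)"

text \<open>A globular labelling is determined by the cells \<open>Orig\<close>, because \<open>Tgt j b\<close> is the target of \<open>Orig (Suc j) b\<close>.\<close>
definition canonical :: "(nat \<Rightarrow> 'a \<Rightarrow> 'a) \<Rightarrow> 'a lab \<Rightarrow> bool" where
  "canonical t w \<longleftrightarrow> (\<forall>c. c \<notin> allcells (fst w) \<longrightarrow> snd w c = undefined) \<and>
     (\<forall>j b. j < length (fst w) \<longrightarrow> b < ell (fst w) (Suc j) \<longrightarrow>
        snd w (Tgt j b) = t (Suc j) (snd w (Orig (Suc j) b)))"

lemma Orig_allcells [simp]: "Orig j a \<in> allcells D \<longleftrightarrow> j \<le> length D \<and> a < ell D j"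
  by (auto simp: allcells_def hcells_def)

lemma Tgt_allcells [simp]: "Tgt j b \<in> allcells D \<longleftrightarrow> j < length D \<and> b < ell D (Suc j)"
  by (auto simp: allcells_def hcells_def)

lemma ell_0 [simp]: "ell D 0 = 1"
  by (simp add: ell_def)

lemma ell_append: "ell (D @ D') j = (if j \<le> length D then ell D j else length (D' ! (j - Suc (length D))))"
  by (cases j) (auto simp: ell_def nth_append)

lemma par_append: "0 < j \<Longrightarrow> par (D @ D') j a = (if j \<le> length D then par D j a else D' ! (j - Suc (length D)) ! a)"
  by (cases j) (auto simp: par_def nth_append)

lemma ell_butlast: "j < length D \<Longrightarrow> ell (butlast D) j = ell D j"
  by (cases j) (auto simp: ell_def nth_butlast)

lemma par_butlast: "0 < j \<Longrightarrow> j < length D \<Longrightarrow> par (butlast D) j a = par D j a"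
  by (cases j) (auto simp: par_def nth_butlast)

lemma tdim_tower_upto [simp]: "tdim (tower_upto D \<phi> m) = m"
  by (induction m) auto

lemma tdim_tower_of [simp]: "tdim (tower_of w) = length (fst w)"
  by (simp add: tower_of_def)

lemma lbls_tower_upto: "lbls (tower_upto D \<phi> m) = map (\<lambda>a. \<phi> (Orig m a)) [0..<ell D m]"
  by (cases m) (auto simp: comp_def)

lemma tower_upto_cong:
  assumes "\<And>j. j \<le> m \<Longrightarrow> ell D j = ell D' j"
    "\<And>j a. 0 < j \<Longrightarrow> j \<le> m \<Longrightarrow> a < ell D j \<Longrightarrow> par D j a = par D' j a"
    "\<And>j a. j \<le> m \<Longrightarrow> a < ell D j \<Longrightarrow> \<phi> (Orig j a) = \<phi>' (Orig j a)"
  shows "tower_upto D \<phi> m = tower_upto D' \<phi>' m"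
  using assms by (induction m) auto

lemma length_shape [simp]: "length (shape E) = tdim E"
  by (induction E) auto

lemma lbls_at_top: "lbls_at E (tdim E) = lbls E"
  by (cases E) auto

lemma length_lbls_at: "j \<le> tdim E \<Longrightarrow> length (lbls_at E j) = ell (shape E) j"
  by (induction E) (auto simp: ell_append)

lemma tower_upto_shape:
  "(\<And>j a. j \<le> tdim E \<Longrightarrow> a < ell (shape E) j \<Longrightarrow> \<phi> (Orig j a) = lbls_at E j ! a) \<Longrightarrow>
    tower_upto (shape E) \<phi> (tdim E) = E"
proof (induction E)
  case (Lev E l)
  have lower: "\<phi> (Orig j a) = lbls_at E j ! a" if "j \<le> tdim E" "a < ell (shape E) j" for j a
    using Lev.prems[of j a] that by (simp add: ell_append)
  have top: "\<phi> (Orig (Suc (tdim E)) a) = snd (l ! a)" if "a < length l" for a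
    using Lev.prems[of "Suc (tdim E)" a] that by (simp add: ell_append)
  have "tower_upto (shape (Lev E l)) \<phi> (tdim E) = tower_upto (shape E) \<phi> (tdim E)"
    by (rule tower_upto_cong) (auto simp: ell_append par_append)
  also have "\<dots> = E" using Lev.IH lower by blast
  finally show ?case
    using top by (auto simp: ell_append par_append intro!: nth_equalityI)
qed simp

lemma tower_of_lab_of [simp]: "tower_of (lab_of t E) = E"
  unfolding tower_of_def lab_of_def fst_conv snd_conv length_shape
  by (rule tower_upto_shape) simp

lemma shape_tower_upto: "m \<le> length D \<Longrightarrow> shape (tower_upto D \<phi> m) = take m D"
proof (induction m)
  case (Suc m)
  have "map (\<lambda>a. D ! m ! a) [0..<length (D ! m)] = D ! m" by (rule map_nth)
  then show ?case using Suc by (simp add: take_Suc_conv_app_nth comp_def par_def ell_def)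
qed simp

lemma lbls_at_tower_upto: "j \<le> m \<Longrightarrow> lbls_at (tower_upto D \<phi> m) j = map (\<lambda>a. \<phi> (Orig j a)) [0..<ell D j]"
  by (induction m) (auto simp: comp_def le_Suc_eq)

lemma shape_tower_of [simp]: "shape (tower_of w) = fst w"
  by (simp add: tower_of_def shape_tower_upto)

lemma lab_of_tower_of:
  assumes "canonical t w"
  shows "lab_of t (tower_of w) = w"
proof -
  have "snd (lab_of t (tower_of w)) c = snd w c" for c
    using assms by (cases c) (auto simp: lab_of_def canonical_def tower_of_def lbls_at_tower_upto shape_tower_upto)
  then show ?thesis by (simp add: prod_eq_iff fun_eq_iff) (simp add: lab_of_def)
qed

lemma canonical_lab_of: "canonical t (lab_of t E)"
  by (auto simp: canonical_def lab_of_def)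

section \<open>The gluing of a diagram as a running state\<close>

lemma legal_upt_iff:
  "legal \<sigma> \<tau> (map g [0..<N]) st \<longleftrightarrow>
    (\<forall>a<N. fst (g a) < length st \<and> run \<tau> (map g [0..<a]) st ! fst (g a) = \<sigma> (snd (g a)))"
proof (induction N)
  case (Suc N)
  obtain p x where "g N = (p, x)" by force
  then show ?case using Suc by (auto simp: legal_append less_Suc_eq)
qed simp

text \<open>The state at \<open>q\<close> is left by the last move over \<open>q\<close>. This
  \<open>Max\<close> is the one in \<open>osrc\<close>, for the moves before a given one, and the
  one in \<open>tincl\<close>, for all moves.\<close>

lemma run_upt_nth:
  assumes "q < length st"
  shows "run \<tau> (map (\<lambda>a. (p a, x a)) [0..<N]) st ! q =
    (if \<exists>b<N. p b = q then \<tau> (x (Max {b. b < N \<and> p b = q})) else st ! q)"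
proof (induction N)
  case (Suc N)
  show ?case
  proof (cases "p N = q")
    case True
    have "Max {b. b < Suc N \<and> p b = q} = N"
      by (rule Max_eqI) (use True in auto)
    then show ?thesis using True assms by (auto simp: run_append)
  next
    case False
    then have "{b. b < Suc N \<and> p b = q} = {b. b < N \<and> p b = q}" by (auto simp: less_Suc_eq)
    moreover have "(\<exists>b<Suc N. p b = q) \<longleftrightarrow> (\<exists>b<N. p b = q)" using False by (auto simp: less_Suc_eq)
    ultimately show ?thesis using Suc False by (auto simp: run_append)
  qed
qed simp

lemma canonical_osrc:
  assumes "canonical t w" "Suc k \<le> length (fst w)" "a < ell (fst w) (Suc k)"
    "par (fst w) (Suc k) a < ell (fst w) k"
  shows "run (t (Suc k)) (map (\<lambda>a. (par (fst w) (Suc k) a, snd w (Orig (Suc k) a))) [0..<a])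
      (lbls (tower_upto (fst w) (snd w) k)) ! par (fst w) (Suc k) a = snd w (osrc (fst w) (Suc k) a)"
proof -
  let ?D = "fst w" and ?p = "\<lambda>a. par (fst w) (Suc k) a"
  have "snd w (Tgt k b) = t (Suc k) (snd w (Orig (Suc k) b))" if "b < a" for b
    using assms that by (simp add: canonical_def)
  moreover have "Max {b. b < a \<and> ?p b = ?p a} < a" if "\<exists>b<a. ?p b = ?p a"
  proof -
    have "Max {b. b < a \<and> ?p b = ?p a} \<in> {b. b < a \<and> ?p b = ?p a}" by (rule Max_in) (use that in auto)
    then show ?thesis by simp
  qed
  ultimately show ?thesis using assms(4)
    by (subst run_upt_nth) (auto simp: lbls_tower_upto osrc_def)
qed

context globular_set
begin

lemma canonical_TX: "w \<in> TX X s t m \<Longrightarrow> canonical t w"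
  unfolding canonical_def
proof (intro conjI allI impI)
  assume w: "w \<in> TX X s t m"
  show "snd w c = undefined" if "c \<notin> allcells (fst w)" for c
    using w that by (auto simp: TX_def ghom_def)
  show "snd w (Tgt j b) = t (Suc j) (snd w (Orig (Suc j) b))"
    if "j < length (fst w)" "b < ell (fst w) (Suc j)" for j b
  proof -
    have "\<forall>j\<in>{1..length (fst w)}. \<forall>c\<in>hcells (fst w) j. t j (snd w c) = snd w (htgt (fst w) c)"
      using w by (auto simp: TX_def ghom_def)
    from bspec[OF bspec[OF this, of "Suc j"], of "Orig (Suc j) b"]
    show ?thesis using that by (simp add: htgt_def hcells_def)
  qed
qed

lemma length_TX: "w \<in> TX X s t m \<Longrightarrow> length (fst w) = m"
  by (auto simp: TX_def)

lemma valid_tower_of: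
  assumes w: "w \<in> TX X s t m"
  shows "V (tower_of w)"
proof -
  let ?D = "fst w" and ?\<phi> = "snd w"
  note can = canonical_TX[OF w]
  have len: "length ?D = m" and wf: "wf_diag ?D" and g: "ghom ?D X s t ?\<phi>"
    using w by (auto simp: TX_def)
  have lab: "?\<phi> (Orig j a) \<in> X j" if "j \<le> m" "a < ell ?D j" for j a
    using g that len by (auto simp: ghom_def hcells_def)
  have "k \<le> m \<Longrightarrow> V (tower_upto ?D ?\<phi> k)" for k
  proof (induction k)
    case 0
    then show ?case using lab[of 0 0] by simp
  next
    case (Suc k)
    have src: "s (Suc k) (?\<phi> (Orig (Suc k) a)) = ?\<phi> (osrc ?D (Suc k) a)" if "a < ell ?D (Suc k)" for a
    proof -
      have "\<forall>j\<in>{1..length ?D}. \<forall>c\<in>hcells ?D j. s j (?\<phi> c) = ?\<phi> (hsrc ?D c)"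
        using g by (auto simp: ghom_def)
      from bspec[OF bspec[OF this, of "Suc k"], of "Orig (Suc k) a"]
      show ?thesis using that len Suc.prems by (simp add: hsrc_def hcells_def)
    qed
    have p: "par ?D (Suc k) a < ell ?D k" if "a < ell ?D (Suc k)" for a
      using wf that len Suc.prems by (force simp: wf_diag_def)
    have "legal (s (Suc k)) (t (Suc k)) (map (\<lambda>a. (par ?D (Suc k) a, ?\<phi> (Orig (Suc k) a))) [0..<ell ?D (Suc k)])
        (lbls (tower_upto ?D ?\<phi> k))"
      unfolding legal_upt_iff using canonical_osrc[OF can] p src len Suc.prems
      by (simp add: lbls_tower_upto)
    then show ?case using Suc lab by auto
  qed
  then show ?thesis by (simp add: tower_of_def len)
qed

lemma canonical_mem_TX:
  assumes can: "canonical t w" and len: "length (fst w) = m" and V: "V (tower_of w)" and n: "m \<le> n"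
  shows "w \<in> TX X s t m"
proof -
  let ?D = "fst w" and ?\<phi> = "snd w"
  have Vk: "V (tower_upto ?D ?\<phi> k)" if "k \<le> m" for k
    using that
  proof (induction k rule: inc_induct)
    case base
    then show ?case using V by (simp add: tower_of_def len)
  qed simp
  have leg: "legal (s (Suc k)) (t (Suc k)) (map (\<lambda>a. (par ?D (Suc k) a, ?\<phi> (Orig (Suc k) a))) [0..<ell ?D (Suc k)])
        (lbls (tower_upto ?D ?\<phi> k))" if "Suc k \<le> m" for k
    using Vk[OF that] by simp
  have p: "par ?D (Suc k) a < ell ?D k" if "Suc k \<le> m" "a < ell ?D (Suc k)" for k a
    using leg[OF that(1)] that(2) unfolding legal_upt_iff by (simp add: lbls_tower_upto)
  have src: "s (Suc k) (?\<phi> (Orig (Suc k) a)) = ?\<phi> (osrc ?D (Suc k) a)"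
    if "Suc k \<le> m" "a < ell ?D (Suc k)" for k a
    using leg[OF that(1)] that(2) canonical_osrc[OF can, of k a] p[OF that] that len
    unfolding legal_upt_iff by (simp add: lbls_tower_upto)
  have lab: "?\<phi> (Orig j a) \<in> X j" if "j \<le> m" "a < ell ?D j" for j a
    using valid_lbls[OF Vk[OF that(1)]] that by (auto simp: lbls_tower_upto)
  have tgt: "?\<phi> (Tgt k b) = t (Suc k) (?\<phi> (Orig (Suc k) b))" if "Suc k \<le> m" "b < ell ?D (Suc k)" for k b
    using can that len by (simp add: canonical_def)
  \<comment> \<open>\<open>Tgt k b\<close> has the same boundary cells in the diagram as its parent,
    so its label must be parallel to that of the parent. The parent's label is parallel to the state
    just before move \<open>b\<close>, which is the source of that move's label, and this is
    parallel to its target.\<close>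
  have par: "parallel k (?\<phi> (Orig k (par ?D (Suc k) b))) (?\<phi> (Tgt k b))"
    if "Suc k \<le> m" "b < ell ?D (Suc k)" for k b
  proof -
    let ?g = "\<lambda>a. (par ?D (Suc k) a, ?\<phi> (Orig (Suc k) a))"
    let ?st = "lbls (tower_upto ?D ?\<phi> k)"
    have "[0..<ell ?D (Suc k)] = [0..<b] @ [b..<ell ?D (Suc k)]"
      using that(2) by (metis le_add_diff_inverse less_imp_le_nat upt_add_eq_append zero_le)
    then have l: "legal (s (Suc k)) (t (Suc k)) (map ?g [0..<b]) ?st"
      using leg[OF that(1)] by (simp add: legal_append)
    have "snd ` set (map ?g [0..<b]) \<subseteq> X (Suc k)" using lab that by auto
    moreover have "set ?st \<subseteq> X k" using valid_lbls[OF Vk[of k]] that by simp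
    ultimately have "list_all2 (parallel k) ?st (run (t (Suc k)) (map ?g [0..<b]) ?st)"
      using run_parallel[OF l] that n by simp
    then have "parallel k (?st ! par ?D (Suc k) b) (run (t (Suc k)) (map ?g [0..<b]) ?st ! par ?D (Suc k) b)"
      by (rule list_all2_nthD) (simp add: lbls_tower_upto p[OF that])
    moreover have "run (t (Suc k)) (map ?g [0..<b]) ?st ! par ?D (Suc k) b = s (Suc k) (?\<phi> (Orig (Suc k) b))"
      using leg[OF that(1)] that(2) unfolding legal_upt_iff by simp
    moreover have "parallel k (s (Suc k) (?\<phi> (Orig (Suc k) b))) (?\<phi> (Tgt k b))"
      unfolding tgt[OF that] using lab that n by (intro parallel_s_t) auto
    ultimately show ?thesis using p[OF that] parallel_trans by (simp add: lbls_tower_upto)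
  qed
  have "wf_diag ?D"
    unfolding wf_diag_def
  proof (intro ballI allI impI)
    fix j a assume "j \<in> {1..length ?D}" "a < ell ?D j"
    then show "par ?D j a < ell ?D (j - 1)" using p[of "j - 1" a] len by auto
  qed
  moreover have "ghom ?D X s t ?\<phi>"
    unfolding ghom_def
  proof (intro conjI ballI allI impI)
    fix j c assume "j \<le> length ?D" "c \<in> hcells ?D j"
    then show "?\<phi> c \<in> X j" using lab tgt t_closed n len by (auto simp: hcells_def)
  next
    fix j c assume j: "j \<in> {1..length ?D}" and c: "c \<in> hcells ?D j"
    then obtain j' where j': "j = Suc j'" "Suc j' \<le> m" using len by (cases j) auto
    have "s j (?\<phi> c) = ?\<phi> (hsrc ?D c) \<and> t j (?\<phi> c) = ?\<phi> (htgt ?D c)"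
    proof (cases "\<exists>a<ell ?D j. c = Orig j a")
      case True
      then show ?thesis using src[of j'] tgt[of j'] j' by (auto simp: hsrc_def htgt_def)
    next
      case False
      then obtain b where b: "c = Tgt j b" "j < m" "b < ell ?D (Suc j)" using c len by (auto simp: hcells_def)
      have q: "par ?D (Suc j) b < ell ?D j" using p b by simp
      have "parallel j (?\<phi> (Orig j (par ?D (Suc j) b))) (?\<phi> c)" using par[of j b] b by simp
      then have "s j (?\<phi> c) = s j (?\<phi> (Orig j (par ?D (Suc j) b)))" "t j (?\<phi> c) = t j (?\<phi> (Orig j (par ?D (Suc j) b)))"
        using j' by (auto simp: parallel_def)
      then show ?thesis using src[of j' "par ?D (Suc j) b"] tgt[of j' "par ?D (Suc j) b"] q j' b
        by (simp add: hsrc_def htgt_def)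
    qed
    then show "s j (?\<phi> c) = ?\<phi> (hsrc ?D c)" "t j (?\<phi> c) = ?\<phi> (htgt ?D c)" by auto
  next
    fix c assume "c \<notin> allcells ?D"
    then show "?\<phi> c = undefined" using can by (simp add: canonical_def)
  qed
  ultimately show ?thesis using len by (simp add: TX_def case_prod_beta)
qed

lemma lab_of_mem_TX: "E \<in> TW m \<Longrightarrow> m \<le> n \<Longrightarrow> lab_of t E \<in> TX X s t m"
  by (rule canonical_mem_TX) (auto simp: canonical_lab_of towers_def, simp add: lab_of_def)

lemma tower_of_mem_TW: "w \<in> TX X s t m \<Longrightarrow> tower_of w \<in> TW m"
  by (simp add: towers_def valid_tower_of length_TX)

lemma lab_of_tower_of_TX: "w \<in> TX X s t m \<Longrightarrow> lab_of t (tower_of w) = w"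
  by (rule lab_of_tower_of[OF canonical_TX])

lemma tower_of_Ts:
  assumes "w \<in> TX X s t (Suc m)"
  shows "tower_of (Ts w) = tsrc (tower_of w)" "canonical t (Ts w)"
proof -
  have len: "length (fst w) = Suc m" using length_TX[OF assms] .
  have "tower_upto (fst (Ts w)) (snd (Ts w)) m = tower_upto (fst w) (snd w) m"
    by (rule tower_upto_cong) (auto simp: Ts_def ell_butlast par_butlast len)
  then show "tower_of (Ts w) = tsrc (tower_of w)" by (simp add: tower_of_def len) (simp add: Ts_def len)
  show "canonical t (Ts w)"
    using canonical_TX[OF assms] by (auto simp: canonical_def Ts_def ell_butlast len)
qed

lemma tower_of_Tt:
  assumes w: "w \<in> TX X s t (Suc m)" and n: "Suc m \<le> n"
  shows "tower_of (Tt w) = tt (tower_of w)" "canonical t (Tt w)"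
proof -
  let ?D = "fst w" and ?\<phi> = "snd w" and ?\<phi>' = "snd (Tt w)"
  note can = canonical_TX[OF w]
  have len: "length ?D = Suc m" using length_TX[OF w] .
  let ?l = "map (\<lambda>a. (par ?D (Suc m) a, ?\<phi> (Orig (Suc m) a))) [0..<ell ?D (Suc m)]"
  let ?E = "tower_upto ?D ?\<phi> m"
  have E: "tower_of w = Lev ?E ?l" by (simp add: tower_of_def len)
  have V: "V (Lev ?E ?l)" using valid_tower_of[OF w] E by simp
  have lower: "?\<phi>' (Orig j a) = ?\<phi> (Orig j a)" if "j < m" "a < ell ?D j" for j a
    using that len by (auto simp: Tt_def tincl_def ell_butlast)
  \<comment> \<open>\<open>tincl\<close> selects the last element of the fibre over
    \<open>q\<close>, whose target is the final state there; an empty fibre keeps the old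
    label.\<close>
  have top: "?\<phi>' (Orig m q) = run (t (Suc m)) ?l (lbls ?E) ! q" if q: "q < ell ?D m" for q
  proof -
    have "Max {b. b < ell ?D (Suc m) \<and> par ?D (Suc m) b = q} < ell ?D (Suc m)"
      if "\<exists>b<ell ?D (Suc m). par ?D (Suc m) b = q"
    proof -
      have "Max {b. b < ell ?D (Suc m) \<and> par ?D (Suc m) b = q} \<in> {b. b < ell ?D (Suc m) \<and> par ?D (Suc m) b = q}"
        by (rule Max_in) (use that in auto)
      then show ?thesis by simp
    qed
    then have "\<exists>b<ell ?D (Suc m). par ?D (Suc m) b = q \<Longrightarrow>
      ?\<phi> (Tgt m (Max {b. b < ell ?D (Suc m) \<and> par ?D (Suc m) b = q})) =
      t (Suc m) (?\<phi> (Orig (Suc m) (Max {b. b < ell ?D (Suc m) \<and> par ?D (Suc m) b = q})))"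
      using can len by (simp add: canonical_def)
    then show ?thesis using q len
      by (subst run_upt_nth) (auto simp: lbls_tower_upto Tt_def tincl_def ell_butlast)
  qed
  have fst: "fst (Tt w) = butlast ?D" by (simp add: Tt_def)
  have st: "run (t (Suc m)) ?l (lbls ?E) = map (\<lambda>a. ?\<phi>' (Orig m a)) [0..<ell ?D m]"
    using top by (intro nth_equalityI) (auto simp: lbls_tower_upto)
  have "tower_upto (butlast ?D) ?\<phi>' m = relabel ?E (map (\<lambda>a. ?\<phi>' (Orig m a)) [0..<ell ?D m])"
  proof (cases m)
    case (Suc k)
    have "tower_upto (butlast ?D) ?\<phi>' k = tower_upto ?D ?\<phi> k"
      by (rule tower_upto_cong) (use Suc len lower in \<open>auto simp: ell_butlast par_butlast\<close>)
    then show ?thesis using Suc len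
      by (auto simp: ell_butlast par_butlast intro!: nth_equalityI)
  qed simp
  then show "tower_of (Tt w) = tt (tower_of w)"
    unfolding E by (simp add: tower_of_def fst len st)
  have par: "list_all2 (parallel m) (lbls ?E) (run (t (Suc m)) ?l (lbls ?E))"
    using run_parallel[of m ?l "lbls ?E"] V n valid_lbls[of ?E] by simp
  show "canonical t (Tt w)"
    unfolding canonical_def fst
  proof (intro conjI allI impI)
    show "?\<phi>' c = undefined" if "c \<notin> allcells (butlast ?D)" for c using that by (simp add: Tt_def)
    fix j b assume j: "j < length (butlast ?D)" and b: "b < ell (butlast ?D) (Suc j)"
    then have j: "j < m" and b: "b < ell ?D (Suc j)" using len by (auto simp: ell_butlast)
    have "?\<phi>' (Tgt j b) = ?\<phi> (Tgt j b)" using j b len by (simp add: Tt_def tincl_def ell_butlast)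
    also have "\<dots> = t (Suc j) (?\<phi> (Orig (Suc j) b))" using can j b len by (simp add: canonical_def)
    also have "\<dots> = t (Suc j) (?\<phi>' (Orig (Suc j) b))"
    proof (cases "Suc j = m")
      case True
      \<comment> \<open>At the new top level labels have been replaced, but by parallel ones, so the
        old \<open>Tgt\<close> labels below are still their targets.\<close>
      then have "parallel m (lbls ?E ! b) (?\<phi>' (Orig m b))"
        using par b list_all2_nthD[OF par, of b] by (simp add: lbls_tower_upto top)
      then show ?thesis using True b by (auto simp: parallel_def lbls_tower_upto)
    qed (use lower j b in simp)
    finally show "?\<phi>' (Tgt j b) = t (Suc j) (?\<phi>' (Orig (Suc j) b))" .
  qed
qed

lemma tower_of_eta:
  shows "tower_of (eta s t m x) = tunit s m x" "canonical t (eta s t m x)"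
proof -
  have ell: "ell (replicate m [0]) j = 1" if "j \<le> m" for j
    using that by (cases j) (auto simp: ell_def)
  have par: "par (replicate m [0]) (Suc j) 0 = 0" if "j < m" for j
    using that by (auto simp: par_def)
  have "tower_upto (replicate m [0]) (snd (eta s t m x)) k = tunit s k (spow s m (m - k) x)" if "k \<le> m" for k
    using that
  proof (induction k)
    case 0
    then show ?case by (simp add: eta_def)
  next
    case (Suc k)
    then have "m - k = Suc (m - Suc k)" by simp
    then have "spow s m (m - k) x = s (Suc k) (spow s m (m - Suc k) x)" using Suc.prems by simp
    then show ?case using Suc by (simp add: ell par) (simp add: eta_def)
  qed
  from this[of m] show "tower_of (eta s t m x) = tunit s m x" by (simp add: tower_of_def) (simp add: eta_def)
  show "canonical t (eta s t m x)"
    unfolding canonical_def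
  proof (intro conjI allI impI)
    fix c assume "c \<notin> allcells (fst (eta s t m x))"
    then show "snd (eta s t m x) c = undefined" by (cases c) (auto simp: eta_def ell)
  next
    fix j b assume "j < length (fst (eta s t m x))" "b < ell (fst (eta s t m x)) (Suc j)"
    then have "j < m" "b = 0" by (auto simp: eta_def ell)
    then show "snd (eta s t m x) (Tgt j b) = t (Suc j) (snd (eta s t m x) (Orig (Suc j) b))"
      by (simp add: eta_def)
  qed
qed

end

lemma tower_of_Tmap: "tower_of (Tmap f W) = map_tower f (tower_of W)"
proof -
  have "m \<le> length (fst W) \<Longrightarrow> tower_upto (fst W) (snd (Tmap f W)) m = map_tower f (tower_upto (fst W) (snd W) m)" for m
    by (induction m) (auto simp: Tmap_def)
  from this[of "length (fst W)"] show ?thesis by (simp add: tower_of_def) (simp add: Tmap_def)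
qed

lemma canonical_Tmap:
  assumes "canonical t' W" "\<And>j b. j < length (fst W) \<Longrightarrow> b < ell (fst W) (Suc j) \<Longrightarrow>
    f (t' (Suc j) (snd W (Orig (Suc j) b))) = t (Suc j) (f (snd W (Orig (Suc j) b)))"
  shows "canonical t (Tmap f W)"
  using assms by (auto simp: canonical_def Tmap_def)

section \<open>Substitution\<close>

lemma block_less: "a < A \<Longrightarrow> i < N a \<Longrightarrow> sum N {..<a} + i < sum N {..<A}" for N :: "nat \<Rightarrow> nat"
proof (induction A)
  case (Suc A)
  then show ?case by (cases "a = A") auto
qed simp

lemma block_exists: "m < sum N {..<A} \<Longrightarrow> \<exists>a<A. \<exists>i<N a. m = sum N {..<a} + i" for N :: "nat \<Rightarrow> nat"
proof (induction A)
  case (Suc A)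
  show ?case
  proof (cases "m < sum N {..<A}")
    case True
    then show ?thesis using Suc.IH less_SucI by blast
  next
    case False
    then have "m - sum N {..<A} < N A" "m = sum N {..<A} + (m - sum N {..<A})" using Suc.prems by auto
    then show ?thesis by blast
  qed
qed simp

text \<open>The uniqueness behind the \<open>THE\<close> in \<open>mu_lab\<close>: a position
  determines its block and the index inside the block.\<close>

lemma block_inject:
  fixes N :: "nat \<Rightarrow> nat"
  assumes "i < N a" "i' < N a'" "sum N {..<a} + i = sum N {..<a'} + i'"
  shows "a = a' \<and> i = i'"
  using block_less[of a a' i N] block_less[of a' a i' N] assms
  by (cases a a' rule: linorder_cases) auto

lemma length_blocks: "length (concat (map (\<lambda>a. map (g a) [0..<N a]) [0..<A])) = sum N {..<A}"
  by (induction A) auto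

lemma nth_blocks:
  "a < A \<Longrightarrow> i < N a \<Longrightarrow> concat (map (\<lambda>a. map (g a) [0..<N a]) [0..<A]) ! (sum N {..<a} + i) = g a i"
proof (induction A)
  case (Suc A)
  then show ?case
    using block_less[of a A i N] length_blocks[of g N A] by (cases "a = A") (auto simp: nth_append)
qed simp

lemma map_upt_blocks:
  "map h [0..<sum N {..<A}] = concat (map (\<lambda>a. map (\<lambda>i. h (sum N {..<a} + i)) [0..<N a]) [0..<A])"
proof (induction A)
  case (Suc A)
  have 1: "[0..<sum N {..<A} + N A] = [0..<sum N {..<A}] @ [sum N {..<A}..<sum N {..<A} + N A]"
    by (rule upt_add_eq_append) simp
  have 2: "[sum N {..<A}..<sum N {..<A} + N A] = map (\<lambda>i. sum N {..<A} + i) [0..<N A]"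
    by (rule nth_equalityI) simp_all
  have "sum N {..<Suc A} = sum N {..<A} + N A" by simp
  then have "map h [0..<sum N {..<Suc A}] =
      map h [0..<sum N {..<A}] @ map (\<lambda>i. h (sum N {..<A} + i)) [0..<N A]"
    by (simp only: 1 2 map_append map_map comp_def)
  then show ?case using Suc by simp
qed simp

lemma length_mu_diag [simp]: "length (mu_diag D \<Phi>) = length D"
  by (simp add: mu_diag_def del: upt_Suc)

lemma mu_diag_nth: "k < length D \<Longrightarrow> mu_diag D \<Phi> ! k =
    concat (map (\<lambda>a. map (\<lambda>i. off \<Phi> k (par D (Suc k) a) + par (fst (\<Phi> (Orig (Suc k) a))) (Suc k) i)
      [0..<ell (fst (\<Phi> (Orig (Suc k) a))) (Suc k)]) [0..<ell D (Suc k)])"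
  by (simp add: mu_diag_def del: upt_Suc)

lemma ell_mu_diag: "j \<le> length D \<Longrightarrow> ell (mu_diag D \<Phi>) j = off \<Phi> j (ell D j)"
proof (cases j)
  case (Suc k)
  assume "j \<le> length D"
  then have "ell (mu_diag D \<Phi>) j = length (mu_diag D \<Phi> ! k)" using Suc by (simp add: ell_def)
  also have "\<dots> = off \<Phi> j (ell D j)"
    using Suc \<open>j \<le> length D\<close> by (simp add: mu_diag_nth length_blocks off_def)
  finally show ?thesis .
qed (simp add: off_def)

lemma par_mu_diag:
  assumes "k < length D" "a < ell D (Suc k)" "i < ell (fst (\<Phi> (Orig (Suc k) a))) (Suc k)"
  shows "par (mu_diag D \<Phi>) (Suc k) (off \<Phi> (Suc k) a + i) =
    off \<Phi> k (par D (Suc k) a) + par (fst (\<Phi> (Orig (Suc k) a))) (Suc k) i"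
  using nth_blocks[of a "ell D (Suc k)" i "\<lambda>a. ell (fst (\<Phi> (Orig (Suc k) a))) (Suc k)"
      "\<lambda>a i. off \<Phi> k (par D (Suc k) a) + par (fst (\<Phi> (Orig (Suc k) a))) (Suc k) i"] assms
  by (simp add: par_def[of "mu_diag D \<Phi>"] mu_diag_nth off_def[of _ "Suc k"])

lemma mu_lab_Orig:
  assumes "a < ell D j" "i < ell (fst (\<Phi> (Orig j a))) j"
  shows "mu_lab D \<Phi> (Orig j (off \<Phi> j a + i)) = snd (\<Phi> (Orig j a)) (Orig j i)"
proof -
  have "(THE (a', i'). a' < ell D j \<and> i' < ell (fst (\<Phi> (Orig j a'))) j \<and> off \<Phi> j a + i = off \<Phi> j a' + i') = (a, i)"
    by (rule the_equality)
      (use assms block_inject[of _ "\<lambda>a. ell (fst (\<Phi> (Orig j a))) j"] in \<open>auto simp: off_def\<close>)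
  then show ?thesis by (simp add: mu_lab_def)
qed

lemma mu_lab_Tgt:
  assumes "b < ell D (Suc j)" "i < ell (fst (\<Phi> (Orig (Suc j) b))) (Suc j)"
  shows "mu_lab D \<Phi> (Tgt j (off \<Phi> (Suc j) b + i)) = snd (\<Phi> (Orig (Suc j) b)) (Tgt j i)"
proof -
  have "(THE (a', i'). a' < ell D (Suc j) \<and> i' < ell (fst (\<Phi> (Orig (Suc j) a'))) (Suc j) \<and>
      off \<Phi> (Suc j) b + i = off \<Phi> (Suc j) a' + i') = (b, i)"
    by (rule the_equality)
      (use assms block_inject[of _ "\<lambda>a. ell (fst (\<Phi> (Orig (Suc j) a))) (Suc j)"] in \<open>auto simp: off_def\<close>)
  then show ?thesis by (simp add: mu_lab_def)
qed

lemma mu_Orig: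
  assumes "j \<le> length (fst W)" "a < ell (fst W) j" "i < ell (fst (snd W (Orig j a))) j"
  shows "snd (mu W) (Orig j (off (snd W) j a + i)) = snd (snd W (Orig j a)) (Orig j i)"
  using assms block_less[of a "ell (fst W) j" i "\<lambda>a. ell (fst (snd W (Orig j a))) j"]
  by (simp add: mu_def ell_mu_diag mu_lab_Orig) (simp add: off_def)

text \<open>On both sides the label of \<open>Orig (Suc k) a\<close> contributes its moves as the
  block of number \<open>a\<close>, shifted to where the block of its parent begins.
  \<open>off\<close> reads the block sizes off the labels of \<open>Orig\<close> cells, and these
  are the initial labels that \<open>tflat\<close> uses.\<close>

lemma tower_of_mu:
  assumes len: "\<And>j a. j \<le> length (fst W) \<Longrightarrow> a < ell (fst W) j \<Longrightarrow> length (fst (snd W (Orig j a))) = j"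
    and wf: "wf_diag (fst W)"
  shows "tower_of (mu W) = tflat (map_tower tower_of (tower_of W))"
proof -
  let ?D = "fst W" and ?\<Phi> = "snd W"
  let ?N = "\<lambda>j a. ell (fst (?\<Phi> (Orig j a))) j"
  have off: "offset (lbls (map_tower tower_of (tower_upto ?D ?\<Phi> k))) p = off ?\<Phi> k p"
    if "k \<le> length ?D" "p \<le> ell ?D k" for k p
  proof -
    have "length (lbls (tower_of (?\<Phi> (Orig k a)))) = ?N k a" if "a < ell ?D k" for a
      using len[OF \<open>k \<le> length ?D\<close> that] by (simp add: tower_of_def lbls_tower_upto)
    then have "map (length \<circ> (lbls \<circ> (tower_of \<circ> (\<lambda>a. ?\<Phi> (Orig k a))))) [0..<p] = map (?N k) [0..<p]"
      using that(2) by simp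
    then show ?thesis using that(2)
      by (simp add: offset_def lbls_tower_upto take_map length_concat off_def interv_sum_list_conv_sum_set_nat
          lessThan_atLeast0 comp_def min_def)
  qed
  have "k \<le> length ?D \<Longrightarrow> tower_upto (fst (mu W)) (snd (mu W)) k = tflat (map_tower tower_of (tower_upto ?D ?\<Phi> k))" for k
  proof (induction k)
    case 0
    have "snd (mu W) (Orig 0 0) = snd (?\<Phi> (Orig 0 0)) (Orig 0 0)"
      using mu_Orig[of 0 W 0 0] by (simp add: off_def)
    then show ?case using len[of 0 0] by (simp add: tower_of_def)
  next
    case (Suc k)
    let ?h = "\<lambda>m. (par (fst (mu W)) (Suc k) m, snd (mu W) (Orig (Suc k) m))"
    let ?A = "ell ?D (Suc k)"
    have block: "map (\<lambda>i. ?h (sum (?N (Suc k)) {..<a} + i)) [0..<?N (Suc k) a] =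
        shift (off ?\<Phi> k (par ?D (Suc k) a)) (moves (tower_of (?\<Phi> (Orig (Suc k) a))))" if a: "a < ?A" for a
    proof -
      have h: "?h (sum (?N (Suc k)) {..<a} + i) = (off ?\<Phi> k (par ?D (Suc k) a) + par (fst (?\<Phi> (Orig (Suc k) a))) (Suc k) i,
          snd (?\<Phi> (Orig (Suc k) a)) (Orig (Suc k) i))" if "i < ?N (Suc k) a" for i
        using par_mu_diag[of k ?D a i ?\<Phi>] mu_Orig[of "Suc k" W a i] that a Suc.prems
        by (simp add: off_def[of _ "Suc k"]) (simp add: mu_def)
      have "moves (tower_of (?\<Phi> (Orig (Suc k) a))) = map (\<lambda>i. (par (fst (?\<Phi> (Orig (Suc k) a))) (Suc k) i,
          snd (?\<Phi> (Orig (Suc k) a)) (Orig (Suc k) i))) [0..<?N (Suc k) a]"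
        using len[OF Suc.prems a] by (simp add: tower_of_def)
      then show ?thesis using h by (simp add: shift_def)
    qed
    have "map ?h [0..<ell (fst (mu W)) (Suc k)] = map ?h [0..<sum (?N (Suc k)) {..<?A}]"
      using Suc.prems ell_mu_diag[of "Suc k" ?D ?\<Phi>] by (simp add: mu_def off_def)
    also have "\<dots> = concat (map (\<lambda>a. map (\<lambda>i. ?h (sum (?N (Suc k)) {..<a} + i)) [0..<?N (Suc k) a]) [0..<?A])"
      by (rule map_upt_blocks)
    also have "\<dots> = concat (map (\<lambda>a. shift (off ?\<Phi> k (par ?D (Suc k) a)) (moves (tower_of (?\<Phi> (Orig (Suc k) a))))) [0..<?A])"
      using block by (intro arg_cong[where f = concat] map_cong) auto
    also have "\<dots> = concat (map (\<lambda>a. shift (offset (lbls (map_tower tower_of (tower_upto ?D ?\<Phi> k))) (par ?D (Suc k) a))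
        (moves (tower_of (?\<Phi> (Orig (Suc k) a))))) [0..<?A])"
    proof (intro arg_cong[where f = concat] map_cong refl)
      fix a assume "a \<in> set [0..<?A]"
      \<comment> \<open>\<open>offset\<close> saturates at the end of the list of labels while
        \<open>off\<close> keeps summing; they agree because positions stay in range.\<close>
      then have "par ?D (Suc k) a < ell ?D k" using wf Suc.prems by (force simp: wf_diag_def)
      then show "shift (off ?\<Phi> k (par ?D (Suc k) a)) (moves (tower_of (?\<Phi> (Orig (Suc k) a)))) =
          shift (offset (lbls (map_tower tower_of (tower_upto ?D ?\<Phi> k))) (par ?D (Suc k) a))
            (moves (tower_of (?\<Phi> (Orig (Suc k) a))))"
        using off[of k "par ?D (Suc k) a"] Suc.prems by simp
    qed
    finally have "map ?h [0..<ell (fst (mu W)) (Suc k)] =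
        flat_moves (lbls (map_tower tower_of (tower_upto ?D ?\<Phi> k)))
          (map (\<lambda>a. (par ?D (Suc k) a, tower_of (?\<Phi> (Orig (Suc k) a)))) [0..<?A])"
      by (simp add: flat_moves_def comp_def)
    then show ?case using Suc by (simp add: comp_def del: lbls_map_tower)
  qed
  from this[of "length ?D"] show ?thesis by (simp add: tower_of_def) (simp add: mu_def)
qed

lemma canonical_mu:
  assumes can: "\<And>j a. j \<le> length (fst W) \<Longrightarrow> a < ell (fst W) j \<Longrightarrow>
      canonical t (snd W (Orig j a)) \<and> length (fst (snd W (Orig j a))) = j"
  shows "canonical t (mu W)"
  unfolding canonical_def
proof (intro conjI allI impI)
  let ?D = "fst W" and ?\<Phi> = "snd W"
  show "snd (mu W) x = undefined" if "x \<notin> allcells (fst (mu W))" for x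
    using that by (simp add: mu_def)
  fix j m assume j: "j < length (fst (mu W))" and m: "m < ell (fst (mu W)) (Suc j)"
  have jD: "j < length ?D" using j by (simp add: mu_def)
  have "m < off ?\<Phi> (Suc j) (ell ?D (Suc j))" using m jD by (simp add: mu_def ell_mu_diag)
  from block_exists[OF this[unfolded off_def]]
  obtain b i where b: "b < ell ?D (Suc j)" and i: "i < ell (fst (?\<Phi> (Orig (Suc j) b))) (Suc j)"
    and mi: "m = off ?\<Phi> (Suc j) b + i"
    unfolding off_def by blast
  have "snd (mu W) (Tgt j m) = snd (?\<Phi> (Orig (Suc j) b)) (Tgt j i)"
    using mu_lab_Tgt[where D = ?D and \<Phi> = ?\<Phi> and j = j, OF b i] m jD mi by (simp add: mu_def)
  also have "\<dots> = t (Suc j) (snd (?\<Phi> (Orig (Suc j) b)) (Orig (Suc j) i))"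
    using can[of "Suc j" b] jD b i by (simp add: canonical_def)
  also have "\<dots> = t (Suc j) (snd (mu W) (Orig (Suc j) m))"
    using mu_Orig[of "Suc j" W b i] jD b i mi by simp
  finally show "snd (mu W) (Tgt j m) = t (Suc j) (snd (mu W) (Orig (Suc j) m))" .
qed

section \<open>Passing between algebras on labelled diagrams and on towers\<close>

context globular_set
begin

interpretation T: globular_set n TW "\<lambda>_. tsrc" "\<lambda>_. tt"
  by (rule towers_globular_set)

abbreviation "L \<equiv> TX X s t"

lemma TX_eqI: "w \<in> L m \<Longrightarrow> w' \<in> L m' \<Longrightarrow> tower_of w = tower_of w' \<Longrightarrow> w = w'"
  using lab_of_tower_of_TX by metis

lemma Ts_mem: "w \<in> L (Suc m) \<Longrightarrow> Suc m \<le> n \<Longrightarrow> Ts w \<in> L m"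
  using tower_of_Ts[of w m] tower_of_mem_TW[of w "Suc m"] T.s_closed[of "tower_of w" m]
  by (intro canonical_mem_TX) (auto simp: towers_def Ts_def length_TX)

lemma Tt_mem: "w \<in> L (Suc m) \<Longrightarrow> Suc m \<le> n \<Longrightarrow> Tt w \<in> L m"
  using tower_of_Tt[of w m] tower_of_mem_TW[of w "Suc m"] T.t_closed[of "tower_of w" m]
  by (intro canonical_mem_TX) (auto simp: towers_def Tt_def length_TX)

text \<open>\<open>tower_of\<close> is injective on labelled diagrams and respects boundaries, so
  the identities are inherited from towers.\<close>

lemma globular_TX: "globular n L (\<lambda>_. Ts) (\<lambda>_. Tt)"
  unfolding globular_def
proof (intro conjI ballI)
  fix k w assume a: "k \<in> {1..n}" "w \<in> L k"
  then obtain m where k: "k = Suc m" by (cases k) auto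
  show "Ts w \<in> L (k - 1)" "Tt w \<in> L (k - 1)" using Ts_mem[of w m] Tt_mem[of w m] a k by auto
next
  fix k w assume a: "k \<in> {2..n}" "w \<in> L k"
  then obtain m where k: "k = Suc (Suc m)" by (metis atLeastAtMost_iff Suc_le_D numeral_2_eq_2 Suc_le_mono)
  have n: "Suc (Suc m) \<le> n" "Suc m \<le> n" using a k by auto
  have w: "w \<in> L (Suc (Suc m))" using a k by simp
  note mem = Ts_mem[OF w n(1)] Tt_mem[OF w n(1)]
  have w': "tower_of w \<in> TW (Suc (Suc m))" by (rule tower_of_mem_TW[OF w])
  show "Ts (Ts w) = Ts (Tt w)"
    using TX_eqI[OF Ts_mem[OF mem(1) n(2)] Ts_mem[OF mem(2) n(2)]] tower_of_Ts[OF mem(1)] tower_of_Ts[OF mem(2)]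
      tower_of_Ts[OF w] tower_of_Tt[OF w n(1)] T.ss_st[OF w' n(1)] by simp
  show "Tt (Ts w) = Tt (Tt w)"
    using TX_eqI[OF Tt_mem[OF mem(1) n(2)] Tt_mem[OF mem(2) n(2)]] tower_of_Tt[OF mem(1) n(2)] tower_of_Tt[OF mem(2) n(2)]
      tower_of_Ts[OF w] tower_of_Tt[OF w n(1)] T.ts_tt[OF w' n(1)] by simp
qed

interpretation L: globular_set n L "\<lambda>_. Ts" "\<lambda>_. Tt"
  by unfold_locales (rule globular_TX)

lemma globular_map_tower_of: "globular_map n L (\<lambda>_. Ts) (\<lambda>_. Tt) TW (\<lambda>_. tsrc) (\<lambda>_. tt) tower_of"
  unfolding globular_map_def using tower_of_mem_TW tower_of_Ts tower_of_Tt by auto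

lemma Ts_lab_of: "E \<in> TW (Suc m) \<Longrightarrow> Suc m \<le> n \<Longrightarrow> Ts (lab_of t E) = lab_of t (tsrc E)"
  using lab_of_tower_of[OF tower_of_Ts(2)[OF lab_of_mem_TX]] tower_of_Ts(1)[OF lab_of_mem_TX] by (metis tower_of_lab_of)

lemma Tt_lab_of: "E \<in> TW (Suc m) \<Longrightarrow> Suc m \<le> n \<Longrightarrow> Tt (lab_of t E) = lab_of t (tt E)"
  using lab_of_tower_of[OF tower_of_Tt(2)[OF lab_of_mem_TX]] tower_of_Tt(1)[OF lab_of_mem_TX] by (metis tower_of_lab_of)

lemma globular_map_lab_of: "globular_map n TW (\<lambda>_. tsrc) (\<lambda>_. tt) L (\<lambda>_. Ts) (\<lambda>_. Tt) (lab_of t)"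
  unfolding globular_map_def using lab_of_mem_TX Ts_lab_of Tt_lab_of by auto

interpretation tower_of: globular_morphism n L "\<lambda>_. Ts" "\<lambda>_. Tt" TW "\<lambda>_. tsrc" "\<lambda>_. tt" tower_of
  by unfold_locales (rule globular_map_tower_of)

interpretation lab_of: globular_morphism n TW "\<lambda>_. tsrc" "\<lambda>_. tt" L "\<lambda>_. Ts" "\<lambda>_. Tt" "lab_of t"
  by unfold_locales (rule globular_map_lab_of)

lemma mu_TX:
  assumes W: "W \<in> TX L (\<lambda>_. Ts) (\<lambda>_. Tt) m" and n: "m \<le> n"
  shows "tower_of (mu W) = tflat (map_tower tower_of (tower_of W))" "canonical t (mu W)"
proof -
  have "ghom (fst W) L (\<lambda>_. Ts) (\<lambda>_. Tt) (snd W)" and wf: "wf_diag (fst W)" using W by (auto simp: TX_def)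
  then have "snd W (Orig j a) \<in> L j" if "j \<le> length (fst W)" "a < ell (fst W) j" for j a
    using that by (auto simp: ghom_def hcells_def)
  then have "canonical t (snd W (Orig j a)) \<and> length (fst (snd W (Orig j a))) = j"
    if "j \<le> length (fst W)" "a < ell (fst W) j" for j a
    using that canonical_TX length_TX by blast
  then show "tower_of (mu W) = tflat (map_tower tower_of (tower_of W))" "canonical t (mu W)"
    using tower_of_mu[OF _ wf] canonical_mu by blast+
qed

theorem tower_algebra_of_T_algebra:
  assumes "T_algebra n X s t a"
  shows "tower_algebra n X s t (\<lambda>E. a (lab_of t E))"
proof -
  have a1: "a w \<in> X m" if "m \<le> n" "w \<in> L m" for m w
    using assms that by (auto simp: T_algebra_def)
  have a2: "s (Suc m) (a w) = a (Ts w)" "t (Suc m) (a w) = a (Tt w)" if "Suc m \<le> n" "w \<in> L (Suc m)" for m w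
  proof -
    have "\<forall>m\<in>{1..n}. \<forall>w\<in>TX X s t m. s m (a w) = a (Ts w) \<and> t m (a w) = a (Tt w)"
      using assms by (simp add: T_algebra_def)
    from bspec[OF this, of "Suc m"] that
    show "s (Suc m) (a w) = a (Ts w)" "t (Suc m) (a w) = a (Tt w)" by auto
  qed
  have a3: "a (eta s t m x) = x" if "m \<le> n" "x \<in> X m" for m x
    using assms that by (auto simp: T_algebra_def)
  have a4: "a (mu W) = a (Tmap a W)" if "m \<le> n" "W \<in> TX L (\<lambda>_. Ts) (\<lambda>_. Tt) m" for m W
    using assms that by (auto simp: T_algebra_def)
  show ?thesis
  proof unfold_locales
    show "globular_map n TW (\<lambda>_. tsrc) (\<lambda>_. tt) X s t (\<lambda>E. a (lab_of t E))"
      unfolding globular_map_def using a1 a2 lab_of_mem_TX by (auto simp: Ts_lab_of Tt_lab_of)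
    show "a (lab_of t (tunit s m x)) = x" if "m \<le> n" "x \<in> X m" for m x
      using lab_of_tower_of[OF tower_of_eta(2)] a3[OF that] by (metis tower_of_eta(1))
    fix W assume W: "T.V W" "tdim W \<le> n"
    \<comment> \<open>A tower of towers becomes a labelled diagram of labelled diagrams by
      converting first its labels and then the tower itself; the outer conversion takes targets with
      \<open>Tt\<close>, as its labels live in \<open>L\<close>.\<close>
    let ?W1 = "map_tower (lab_of t) W"
    let ?W = "lab_of (\<lambda>_. Tt) ?W1"
    have "L.V ?W1" using lab_of.valid_map_tower W by blast
    then have mem: "?W \<in> TX L (\<lambda>_. Ts) (\<lambda>_. Tt) (tdim W)"
      using L.lab_of_mem_TX[of ?W1 "tdim W"] W(2) by (simp add: towers_def)
    have "tower_of (mu ?W) = tflat W"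
      using mu_TX(1)[OF mem W(2)] by (simp add: tower.map_comp comp_def tower.map_ident)
    then have 1: "mu ?W = lab_of t (tflat W)" using lab_of_tower_of[OF mu_TX(2)[OF mem W(2)]] by simp
    have "tower_of (Tmap a ?W) = map_tower (\<lambda>E. a (lab_of t E)) W"
      by (simp add: tower_of_Tmap tower.map_comp comp_def)
    \<comment> \<open>\<open>Tmap a ?W\<close> can be recovered from its tower because its
      \<open>Tgt\<close> labels are targets, \<open>a\<close> being compatible with targets.\<close>
    moreover have "canonical t (Tmap a ?W)"
    proof (rule canonical_Tmap[OF canonical_lab_of])
      fix j b assume jb: "j < length (fst ?W)" "b < ell (fst ?W) (Suc j)"
      have "ghom (fst ?W) L (\<lambda>_. Ts) (\<lambda>_. Tt) (snd ?W)" using mem by (auto simp: TX_def)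
      then have "snd ?W (Orig (Suc j) b) \<in> L (Suc j)" using jb by (auto simp: ghom_def hcells_def)
      moreover have "Suc j \<le> n" using jb W(2) by (simp add: lab_of_def)
      ultimately show "a (Tt (snd ?W (Orig (Suc j) b))) = t (Suc j) (a (snd ?W (Orig (Suc j) b)))"
        using a2 by simp
    qed
    ultimately have "Tmap a ?W = lab_of t (map_tower (\<lambda>E. a (lab_of t E)) W)"
      using lab_of_tower_of by metis
    then show "a (lab_of t (tflat W)) = a (lab_of t (map_tower (\<lambda>E. a (lab_of t E)) W))"
      using 1 a4[OF W(2) mem] by simp
  qed
qed

theorem T_algebra_of_tower_algebra:
  assumes "tower_algebra n X s t \<alpha>"
  shows "T_algebra n X s t (\<lambda>w. \<alpha> (tower_of w))"
proof -
  interpret tower_algebra n X s t \<alpha> by fact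
  interpret \<alpha>: globular_morphism n TW "\<lambda>_. tsrc" "\<lambda>_. tt" X s t \<alpha>
    by unfold_locales (rule \<alpha>_globular)
  show ?thesis
    unfolding T_algebra_def
  proof (intro conjI allI impI ballI)
    fix m w assume "m \<le> n" "w \<in> L m"
    then show "\<alpha> (tower_of w) \<in> X m" using \<alpha>.f_closed tower_of_mem_TW by blast
  next
    fix m w assume a: "m \<in> {1..n}" "w \<in> L m"
    then obtain k where m: "m = Suc k" by (cases m) auto
    show "s m (\<alpha> (tower_of w)) = \<alpha> (tower_of (Ts w))" "t m (\<alpha> (tower_of w)) = \<alpha> (tower_of (Tt w))"
      using a m tower_of_Ts[of w k] tower_of_Tt[of w k] \<alpha>_s[of "tower_of w" k] \<alpha>_t[of "tower_of w" k]
        tower_of_mem_TW[of w m] by auto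
  next
    fix m x assume "m \<le> n" "x \<in> X m"
    then show "\<alpha> (tower_of (eta s t m x)) = x" by (simp add: tower_of_eta \<alpha>_tunit)
  next
    fix m W assume a: "m \<le> n" "W \<in> TX L (\<lambda>_. Ts) (\<lambda>_. Tt) m"
    have "L.V (tower_of W)" "tdim (tower_of W) = m" using L.valid_tower_of[OF a(2)] L.length_TX[OF a(2)] by auto
    then have "T.V (map_tower tower_of (tower_of W))" "tdim (map_tower tower_of (tower_of W)) \<le> n"
      using tower_of.valid_map_tower a(1) by auto
    then have "\<alpha> (tflat (map_tower tower_of (tower_of W))) = \<alpha> (map_tower \<alpha> (map_tower tower_of (tower_of W)))"
      by (rule \<alpha>_tflat)
    then show "\<alpha> (tower_of (mu W)) = \<alpha> (tower_of (Tmap (\<lambda>w. \<alpha> (tower_of w)) W))"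
      using mu_TX(1)[OF a(2) a(1)] by (simp add: tower_of_Tmap tower.map_comp comp_def)
  qed
qed

end

section \<open>The operations of an algebra\<close>

lemma ell_replicate: "j \<le> m \<Longrightarrow> ell (replicate m [0]) j = 1"
  by (cases j) (auto simp: ell_def)

lemma shape_tunit: "shape (tunit s m x) = replicate m [0]"
  by (induction m arbitrary: x) (auto simp: replicate_append_same)

lemma cdiag_eq: "cdiag (Suc m) (Suc m) = replicate m [0] @ [[0, 0]]"
  by (simp add: cdiag_def)

text \<open>In dimension \<open>j\<close> the cell \<open>y\<close> is performed first and has index
  0. The part belonging to \<open>x\<close> has index 1, so the next level sits over 1, and all
  later levels over a single element.\<close>

lemma cdiag_gt: "0 < j \<Longrightarrow> j \<le> i \<Longrightarrow> cdiag (Suc i) j = cdiag i j @ [[if i = j then 1 else 0]]"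
proof (cases "i = j")
  case False
  assume "0 < j" "j \<le> i"
  then have "i - j = Suc (i - Suc j)" using False by simp
  then have "replicate (i - j) [0] = replicate (i - Suc j) [0] @ [[0]]" by (simp add: replicate_append_same)
  then show ?thesis using False \<open>j \<le> i\<close> by (simp add: cdiag_def)
qed (simp add: cdiag_def)

lemma cdiag_lt: "0 < i \<Longrightarrow> i \<le> j \<Longrightarrow> cdiag i (Suc j) = cdiag i j @ [[0]]"
proof (cases "i = j")
  case False
  assume "0 < i" "i \<le> j"
  then have "j - i = Suc (j - Suc i)" using False by simp
  then have "replicate (j - i) [0] = replicate (j - Suc i) [0] @ [[0]]" by (simp add: replicate_append_same)
  then show ?thesis using False \<open>i \<le> j\<close> by (simp add: cdiag_def)
qed (simp add: cdiag_def)

lemma length_lbls_shape: "length (lbls E) = ell (shape E) (tdim E)"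
  using length_lbls_at[of "tdim E" E] by (simp add: lbls_at_top)

lemma shape_Lev_eq: "shape E = D @ [ps] \<longleftrightarrow> (\<exists>E' l. E = Lev E' l \<and> shape E' = D \<and> map fst l = ps)"
  by (cases E) auto

lemma lbls_at_tunit_top: "lbls_at (tunit s m x) m = [x]"
  by (cases m) auto

text \<open>Only the entries named by \<open>xcell\<close> and \<open>ycell\<close> count:
  \<open>x\<close> stands at index 1 when \<open>i \<le> j\<close>, and \<open>y\<close> always at
  index 0, because it is performed first.\<close>

lemma tcomp_tunit_at:
  assumes "0 < i" "0 < j"
  shows "shape (tcomp (tunit s i x) (tunit s j y)) = cdiag i j \<and>
    (\<exists>x' y'. lbls_at (tcomp (tunit s i x) (tunit s j y)) i = (if i \<le> j then [x', x] else [x]) \<and>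
      lbls_at (tcomp (tunit s i x) (tunit s j y)) j = (if j \<le> i then [y, y'] else [y]))"
proof -
  have eq: "shape (tcomp (tunit s i x) (tunit s i y)) = cdiag i i \<and>
    lbls_at (tcomp (tunit s i x) (tunit s i y)) i = [y, x]" if "0 < i" for i x y
    using that by (cases i) (auto simp: tcomp_eq shape_tunit cdiag_eq)
  have dim: "tdim (tcomp (tunit s i x) (tunit s j y)) = max i j" if "0 < i" "0 < j" for i j x y
    using that by simp
  have gt: "shape (tcomp (tunit s i x) (tunit s j y)) = cdiag i j \<and>
    lbls_at (tcomp (tunit s i x) (tunit s j y)) i = (if i \<le> j then [y, x] else [x]) \<and>
    (\<exists>y'. lbls_at (tcomp (tunit s i x) (tunit s j y)) j = [y, y'])" if "j \<le> i" for x
    using that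
  proof (induction i arbitrary: x rule: dec_induct)
    case base
    then show ?case using eq[OF assms(2)] by simp
  next
    case (step i)
    then show ?case using assms(2) by (auto simp: tcomp_gt cdiag_gt dim max_absorb1)
  qed
  have lt: "shape (tcomp (tunit s i x) (tunit s j y)) = cdiag i j \<and>
    lbls_at (tcomp (tunit s i x) (tunit s j y)) j = (if j \<le> i then [y, x] else [y]) \<and>
    (\<exists>x'. lbls_at (tcomp (tunit s i x) (tunit s j y)) i = [x', x])" if "i \<le> j" for y
    using that
  proof (induction j arbitrary: y rule: dec_induct)
    case base
    then show ?case using eq[OF assms(1)] by simp
  next
    case (step j)
    then show ?case using assms(1) by (auto simp: tcomp_lt cdiag_lt dim max_absorb2)
  qed
  show ?thesis using gt[of x] lt[of y] by (cases "j \<le> i") auto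
qed

section \<open>Labellings of the composition and unit diagrams\<close>

context globular_set
begin

text \<open>Each level has a single move, and legality forces the label below it to be its
  source.\<close>

lemma tower_eq_tunit: "V E \<Longrightarrow> shape E = replicate m [0] \<Longrightarrow> lbls E = [x] \<Longrightarrow> E = tunit s m x"
proof (induction m arbitrary: E x)
  case 0
  then show ?case by (cases E) auto
next
  case (Suc m)
  then have "shape E = replicate m [0] @ [[0]]" by (simp add: replicate_append_same)
  then obtain E' l where E: "E = Lev E' l" and sh: "shape E' = replicate m [0]" "map fst l = [0]"
    by (auto simp: shape_Lev_eq)
  have l: "l = [(0, x)]" using sh(2) Suc.prems(3) E by auto
  have dim: "tdim E' = m" using sh(1) length_shape[of E'] by simp
  then have "length (lbls E') = 1"
    by (simp add: length_lbls_shape sh(1) ell_replicate)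
  then have "lbls E' = [s (Suc m) x]" using Suc.prems(1) E l dim by (cases "lbls E'") auto
  then show ?case using Suc.IH[of E' "s (Suc m) x"] Suc.prems(1) E l sh by simp
qed

text \<open>The uniqueness behind the \<open>THE\<close> in \<open>comp_of\<close>: the diagram
  fixes all positions, and legality forces every label other than \<open>x\<close> and
  \<open>y\<close> to be an iterated source of one of them. The higher of the two cells is peeled
  off until the dimensions agree.\<close>

lemma tower_eq_tcomp_tunit:
  assumes "0 < i" "0 < j" "V E" "shape E = cdiag i j"
    "lbls_at E i ! (if i \<le> j then 1 else 0) = x" "lbls_at E j ! 0 = y"
  shows "E = tcomp (tunit s i x) (tunit s j y)"
proof -
  have len: "length (cdiag i j) = max i j" if "0 < i" "0 < j" for i j
    using that by (auto simp: cdiag_def max_def)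
  have eq: "E = tcomp (tunit s i x) (tunit s i y)"
    if i: "0 < i" and E: "V E" "shape E = cdiag i i" "lbls_at E i ! 1 = x" "lbls_at E i ! 0 = y" for i E x y
  proof -
    obtain m where m: "i = Suc m" using i by (cases i) auto
    obtain E' l where E': "E = Lev E' l" and sh: "shape E' = replicate m [0]" "map fst l = [0, 0]"
      using E(2) unfolding m cdiag_eq shape_Lev_eq by auto
    have dim: "tdim E' = m" using sh(1) length_shape[of E'] by simp
    have l: "l = [(0, y), (0, x)]" using sh(2) E(3,4) E' m dim by (auto simp: map_eq_Cons_conv)
    have "length (lbls E') = 1"
      by (simp add: length_lbls_shape sh(1) dim ell_replicate)
    then have "lbls E' = [s (Suc m) y]" using E(1) E' l dim by (cases "lbls E'") auto
    then have "E' = tunit s m (s (Suc m) y)" using tower_eq_tunit[OF _ sh(1)] E(1) E' by simp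
    then show ?thesis using m E' l by (simp add: tcomp_eq)
  qed
  have gt: "E = tcomp (tunit s i x) (tunit s j y)"
    if "j \<le> i" "V E" "shape E = cdiag i j" "lbls_at E i ! (if i \<le> j then 1 else 0) = x" "lbls_at E j ! 0 = y"
    for E x
    using that
  proof (induction i arbitrary: E x rule: dec_induct)
    case base
    then show ?case using eq[OF assms(2)] by simp
  next
    case (step i)
    obtain E' l where E': "E = Lev E' l" and sh: "shape E' = cdiag i j" "map fst l = [if i = j then 1 else 0]"
      using step.prems(2) cdiag_gt[OF assms(2) step.hyps(1)] by (auto simp: shape_Lev_eq)
    have dim: "tdim E' = i" using sh(1) length_shape[of E'] len[of i j] assms(2) step.hyps by simp
    have l: "l = [(if i = j then 1 else 0, x)]" using sh(2) step E' dim by (auto simp: map_eq_Cons_conv)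
    have "lbls_at E' i ! (if i \<le> j then 1 else 0) = s (Suc i) x"
      using step.prems(1) step.hyps E' l dim lbls_at_top[of E'] by (auto split: if_splits)
    moreover have "lbls_at E' j ! 0 = y" using step.prems(4) step.hyps E' dim by simp
    ultimately have "E' = tcomp (tunit s i (s (Suc i) x)) (tunit s j y)"
      using step.IH[OF _ sh(1)] step.prems(1) E' by simp
    then show ?case using E' l assms(2) step.hyps by (auto simp: tcomp_gt)
  qed
  have lt: "E = tcomp (tunit s i x) (tunit s j y)"
    if "i \<le> j" "V E" "shape E = cdiag i j" "lbls_at E i ! 1 = x" "lbls_at E j ! 0 = y"
    for E y
    using that
  proof (induction j arbitrary: E y rule: dec_induct)
    case base
    then show ?case using eq[OF assms(1)] by simp
  next
    case (step j)
    obtain E' l where E': "E = Lev E' l" and sh: "shape E' = cdiag i j" "map fst l = [0]"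
      using step.prems(2) cdiag_lt[OF assms(1) step.hyps(1)] by (auto simp: shape_Lev_eq)
    have dim: "tdim E' = j" using sh(1) length_shape[of E'] len[of i j] assms(1) step.hyps by simp
    have l: "l = [(0, y)]" using sh(2) step E' dim by (auto simp: map_eq_Cons_conv)
    have "lbls_at E' j ! 0 = s (Suc j) y"
      using step.prems(1) E' l dim lbls_at_top[of E'] by auto
    moreover have "lbls_at E' i ! 1 = x" using step.prems(3) step.hyps E' dim by simp
    ultimately have "E' = tcomp (tunit s i x) (tunit s j (s (Suc j) y))"
      using step.IH[OF _ sh(1)] step.prems(1) E' by simp
    then show ?case using E' l assms(1) step.hyps by (auto simp: tcomp_lt)
  qed
  show ?thesis using gt[of E x] lt[of E y] assms by (cases "j \<le> i") auto
qed

text \<open>Reduces a definite description of labellings to an equality of towers, because a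
  labelled diagram is determined by its tower.\<close>

lemma the_labelling:
  assumes w: "w \<in> TX X s t m"
    and "P (snd w)"
    and unique: "\<And>\<phi>. (fst w, \<phi>) \<in> TX X s t m \<Longrightarrow> P \<phi> \<Longrightarrow> tower_of (fst w, \<phi>) = tower_of w"
  shows "(THE \<phi>. ghom (fst w) X s t \<phi> \<and> P \<phi>) = snd w"
proof (rule the_equality)
  show "ghom (fst w) X s t (snd w) \<and> P (snd w)" using w assms(2) by (auto simp: TX_def)
  fix \<phi> assume a: "ghom (fst w) X s t \<phi> \<and> P \<phi>"
  then have mem: "(fst w, \<phi>) \<in> TX X s t m" using w by (auto simp: TX_def)
  have "(fst w, \<phi>) = w" using TX_eqI[OF mem w unique[OF mem]] a by simp
  then show "\<phi> = snd w" by (metis snd_conv)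
qed

lemma comp_of_eq:
  assumes cp: "cp n X s t i j x y"
  shows "comp_of X s t a i j x y = a (lab_of t (tcomp (tunit s i x) (tunit s j y)))"
proof -
  let ?T = "tcomp (tunit s i x) (tunit s j y)"
  let ?w = "lab_of t ?T"
  have pos: "0 < i" "0 < j" "i \<le> n" "j \<le> n" using cp_dest[OF cp] by auto
  have "V ?T" using valid_tcomp[of "tunit s i x" "tunit s j y"] cpT_tunit[OF cp] by simp
  then have w: "?w \<in> TX X s t (max i j)"
    using lab_of_mem_TX[of ?T "max i j"] pos by (simp add: towers_def)
  note at = tcomp_tunit_at[OF pos(1,2), of s x y]
  have sh: "fst ?w = cdiag i j" using at by (simp add: lab_of_def)
  have len: "length (cdiag i j) = max i j" using length_TX[OF w] sh by simp
  have ell: "ell (cdiag i j) i = (if i \<le> j then 2 else 1)" "ell (cdiag i j) j = (if j \<le> i then 2 else 1)"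
    using at length_lbls_at[of i ?T] length_lbls_at[of j ?T] pos by auto
  have "(THE \<phi>. ghom (fst ?w) X s t \<phi> \<and> (\<phi> (xcell i j) = x \<and> \<phi> (ycell i j) = y)) = snd ?w"
  proof (rule the_labelling[OF w])
    show "snd ?w (xcell i j) = x \<and> snd ?w (ycell i j) = y"
      using at ell len pos by (auto simp: lab_of_def xcell_def ycell_def)
    fix \<phi> assume mem: "(fst ?w, \<phi>) \<in> TX X s t (max i j)" and \<phi>: "\<phi> (xcell i j) = x \<and> \<phi> (ycell i j) = y"
    let ?E = "tower_of (cdiag i j, \<phi>)"
    have "?E = ?T"
    proof (rule tower_eq_tcomp_tunit[OF pos(1,2)])
      show "V ?E" using valid_tower_of[OF mem] sh by simp
      show "lbls_at ?E i ! (if i \<le> j then 1 else 0) = x" "lbls_at ?E j ! 0 = y"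
        using \<phi> ell len by (auto simp: tower_of_def lbls_at_tower_upto xcell_def ycell_def)
    qed simp
    then show "tower_of (fst ?w, \<phi>) = tower_of ?w" using sh by simp
  qed
  then have "(cdiag i j, THE \<phi>. ghom (cdiag i j) X s t \<phi> \<and> \<phi> (xcell i j) = x \<and> \<phi> (ycell i j) = y) = ?w"
    unfolding sh by (metis prod.collapse sh)
  then show ?thesis unfolding comp_of_def by simp
qed

lemma unit_of_eq:
  assumes "x \<in> X k" "Suc k \<le> n"
  shows "unit_of X s t a (Suc k) x = a (lab_of t (Lev (tunit s k x) []))"
proof -
  let ?T = "Lev (tunit s k x) []"
  let ?w = "lab_of t ?T"
  have "V ?T" using valid_tunit[of x k] assms by simp
  then have w: "?w \<in> TX X s t (Suc k)"
    using lab_of_mem_TX[of ?T "Suc k"] assms by (simp add: towers_def)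
  have sh: "fst ?w = udiag (Suc k)" by (simp add: lab_of_def udiag_def shape_tunit)
  have len: "length (udiag (Suc k)) = Suc k" by (simp add: udiag_def)
  have ell: "ell (udiag (Suc k)) k = 1" by (simp add: udiag_def ell_append ell_replicate)
  have "(THE \<phi>. ghom (fst ?w) X s t \<phi> \<and> \<phi> (Orig k 0) = x) = snd ?w"
  proof (rule the_labelling[OF w])
    show "snd ?w (Orig k 0) = x"
      using ell sh len lbls_at_tunit_top[of s k x] by (simp add: lab_of_def)
    fix \<phi> assume mem: "(fst ?w, \<phi>) \<in> TX X s t (Suc k)" and \<phi>: "\<phi> (Orig k 0) = x"
    let ?E = "tower_of (udiag (Suc k), \<phi>)"
    have "V ?E" using valid_tower_of[OF mem] sh by simp
    moreover have "shape ?E = replicate k [0] @ [[]]" by (simp add: udiag_def)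
    then obtain E' l where E: "?E = Lev E' l" "shape E' = replicate k [0]" "l = []"
      unfolding shape_Lev_eq by auto
    moreover have "tdim E' = k" using E(2) length_shape[of E'] by simp
    moreover have "lbls_at ?E k = [x]" using \<phi> ell by (simp add: tower_of_def udiag_def lbls_at_tower_upto)
    ultimately have "E' = tunit s k x" using lbls_at_top[of E'] by (intro tower_eq_tunit) auto
    then show "tower_of (fst ?w, \<phi>) = tower_of ?w" using sh E by simp
  qed
  then have "(udiag (Suc k), THE \<phi>. ghom (udiag (Suc k)) X s t \<phi> \<and> \<phi> (Orig k 0) = x) = ?w"
    unfolding sh by (metis prod.collapse sh)
  then show ?thesis unfolding unit_of_def by simp
qed

end

theorem theorem1p1:
  fixes n :: nat and X :: "nat \<Rightarrow> 'a set" and s t :: "nat \<Rightarrow> 'a \<Rightarrow> 'a"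
  assumes "globular n X s t"
  shows "(\<forall>a. T_algebra n X s t a \<longrightarrow> sesqui n X s t (comp_of X s t a) (unit_of X s t a))
       \<and> (\<forall>c u. sesqui n X s t c u \<longrightarrow>
            (\<exists>a. T_algebra n X s t a \<and>
                 (\<forall>i j x y. cp n X s t i j x y \<longrightarrow> comp_of X s t a i j x y = c i j x y) \<and>
                 (\<forall>i x. i \<in> {1..n} \<and> x \<in> X (i - 1) \<longrightarrow> unit_of X s t a i x = u i x)))
       \<and> (\<forall>a b. T_algebra n X s t a \<and> T_algebra n X s t b \<and>
            (\<forall>i j x y. cp n X s t i j x y \<longrightarrow> comp_of X s t a i j x y = comp_of X s t b i j x y) \<and>
            (\<forall>i x. i \<in> {1..n} \<and> x \<in> X (i - 1) \<longrightarrow> unit_of X s t a i x = unit_of X s t b i x)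
            \<longrightarrow> (\<forall>m\<le>n. \<forall>w\<in>TX X s t m. a w = b w))"
proof -
  interpret globular_set n X s t by unfold_locales fact
  have 1: "sesqui n X s t (comp_of X s t a) (unit_of X s t a)" if a: "T_algebra n X s t a" for a
    using tower_algebra.sesqui_of_tower_algebra[OF tower_algebra_of_T_algebra[OF a]] comp_of_eq unit_of_eq by blast
  have 2: "\<exists>a. T_algebra n X s t a \<and>
        (\<forall>i j x y. cp n X s t i j x y \<longrightarrow> comp_of X s t a i j x y = c i j x y) \<and>
        (\<forall>i x. i \<in> {1..n} \<and> x \<in> X (i - 1) \<longrightarrow> unit_of X s t a i x = u i x)" if "sesqui n X s t c u" for c u
  proof -
    interpret S: sesquicategory n X s t c u by unfold_locales fact
    \<comment> \<open>Evaluation sends \<open>tcomp\<close> to \<open>c\<close>, empty levels to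
      \<open>u\<close> and unit towers to their cells, so this algebra induces the given
      operations.\<close>
    let ?a = "\<lambda>w. S.ev (tower_of w)"
    have "comp_of X s t ?a i j x y = c i j x y" if "cp n X s t i j x y" for i j x y
      using comp_of_eq[OF that, of ?a] S.eval_tcomp[OF cpT_tunit[OF that]] S.eval_tunit cp_dest[OF that] by simp
    moreover have "unit_of X s t ?a i x = u i x" if "i \<in> {1..n}" "x \<in> X (i - 1)" for i x
      using unit_of_eq[of x "i - 1" ?a] S.eval_tunit[of "i - 1" x] that by (simp add: le_diff_conv)
    ultimately show ?thesis using T_algebra_of_tower_algebra[OF S.tower_algebra_eval] by blast
  qed
  have 3: "a w = b w"
    if a: "T_algebra n X s t a" and b: "T_algebra n X s t b"
      and c: "\<forall>i j x y. cp n X s t i j x y \<longrightarrow> comp_of X s t a i j x y = comp_of X s t b i j x y"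
      and u: "\<forall>i x. i \<in> {1..n} \<and> x \<in> X (i - 1) \<longrightarrow> unit_of X s t a i x = unit_of X s t b i x"
      and w: "m \<le> n" "w \<in> TX X s t m" for a b m w
  proof -
    \<comment> \<open>A labelled diagram is recovered from its tower, so it suffices to compare the
      two algebras on towers.\<close>
    have "a (lab_of t (tower_of w)) = b (lab_of t (tower_of w))"
    proof (rule tower_algebra_unique[OF tower_algebra_of_T_algebra[OF a] tower_algebra_of_T_algebra[OF b]])
      show "a (lab_of t (tcomp (tunit s i x) (tunit s j y))) = b (lab_of t (tcomp (tunit s i x) (tunit s j y)))"
        if "cp n X s t i j x y" for i j x y
        using c that comp_of_eq[OF that] by metis
      show "a (lab_of t (Lev (tunit s i x) [])) = b (lab_of t (Lev (tunit s i x) []))"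
        if "x \<in> X i" "Suc i \<le> n" for i x
        using u[rule_format, of "Suc i" x] that unit_of_eq[OF that, of a] unit_of_eq[OF that, of b] by simp
    qed (use w valid_tower_of length_TX in auto)
    then show ?thesis by (simp add: lab_of_tower_of_TX[OF w(2)])
  qed
  show ?thesis using 1 2 3 by blast
qed

end
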